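(* Let $N$ be a non-negative integer. (a) The polynomial family $\mathcal{D}^{0}_{N}(\lambda)\in\mathcal{U}(\mathfrak{n}_{n+1}^-)$ induces (acting by right differentiation $R$) a family of left $G^{n+1}$-equivariant operators $$D'_N(\lambda):\mathrm{Ind}_{P^{n+1}}^{G^{n+1}}(\xi_{\lambda})\rightarrow\mathrm{Ind}_{P^n}^{G^{n+1}}(\xi_{\lambda-N}\otimes\sigma),$$ where $\sigma$ is the trivial representation of $M^n$ if $N$ is even and $\sigma=\sigma_-$ if $N$ is odd. The composition $D_N(\lambda)=i^*\circ D'_N(\lambda)$ of $D'_N(\lambda)$ with the restriction map $i^*:C^\infty(G^{n+1})\rightarrow C^\infty(G^n)$ defines a family of left $G^n$-equivariant operators $$D_N(\lambda):\mathrm{Ind}_{P^{n+1}}^{G^{n+1}}(\xi_{\lambda})\rightarrow\mathrm{Ind}_{P^n}^{G^{n}}(\xi_{\lambda-N}\otimes\sigma).$$ (b) The polynomial family $\mathcal{D}^{0}_{N}(\lambda)\in\mathcal{U}(\mathfrak{n}_{n+1}^-)$ induces a family of left $G^{n+1}$-equivariant operators $$\hat{D}'_N(\lambda):\mathrm{Ind}_{\hat{P}^{n+1}}^{G^{n+1}}(\xi_{\lambda})\rightarrow\mathrm{Ind}_{\hat{P}^n}^{G^{n+1}}(\xi_{\lambda-N}).$$ The composition $\hat{D}_N(\lambda)=i^*\circ\hat{D}'_N(\lambda)$ defines a family of left $G^n$-equivariant operators $$\hat{D}_N(\lambda):\mathrm{Ind}_{\hat{P}^{n+1}}^{G^{n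+1}}(\xi_{\lambda})\rightarrow\mathrm{Ind}_{\hat{P}^n}^{G^{n}}(\xi_{\lambda-N}).$$
   Context: Fix an integer $n\ge 4$. For $m\in\{n,n+1\}$ let $G^m=O(2,m-1)$ be the group of real $(m+1)\times(m+1)$ matrices preserving $-t_1^2-t_2^2+x_1^2+\dots+x_{m-1}^2$ (coordinates ordered $(t_1,t_2,x_1,\dots,x_{m-1})$), and $\mathfrak{g}_m=\mathfrak{o}(2,m-1)$ its Lie algebra. Let $E_{ab}$ be the elementary matrices. Put $H=E_{14}+E_{41}$, $H_2=E_{23}+E_{32}$, $Q_1^-=-E_{12}+E_{21}+E_{24}+E_{42}$, $Q_2^-=E_{13}+E_{31}+E_{34}-E_{43}$, and for $1\le i,j\le m-3$: $Y_j^-=E_{4+j,1}+E_{4+j,4}+E_{1,4+j}-E_{4,4+j}$, $Z_j^+=E_{2,4+j}+E_{3,4+j}+E_{4+j,2}-E_{4+j,3}$, $M_{ij}=E_{4+i,4+j}-E_{4+j,4+i}$. Let $Q_i^+=(Q_i^-)^t$, $Y_j^+=(Y_j^-)^t$, $Z_j^-=(Z_j^+)^t$. Put $\mathfrak{a}=\mathbb{R}H$, $\mathfrak{m}_m=\mathrm{span}(H_2,Z_j^\pm,M_{ij})\cong\mathfrak{so}(1,m-2)$, $\mathfrak{n}_m^\pm=\mathrm{span}(Q_1^\pm,Q_2^\pm,Y_j^\pm:1\le j\le m-3)$ (abelian). $\mathcal{U}(\cdot)$ denotes the complex universal enveloping algebra; $\mathfrak{g}_n\subset\mathfrak{g}_{n+1}$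 via $X\mapsto\begin{pmatrix}X&0\\0&0\end{pmatrix}$. Groups: $A=\exp\mathfrak{a}$, $(N^\pm)^m=\exp\mathfrak{n}_m^\pm$, $M_0^m$ is the analytic subgroup of $G^m$ with Lie algebra $\mathfrak{m}_m$, $w_1=\mathrm{diag}(1,-1,1,1,\dots,1)$, $w_2=\mathrm{diag}(1,1,-1,1,\dots,1)$, $J_{(m)}=-1\in G^m$, $\hat{M}^m=\langle w_1,w_2\rangle M_0^m$, $M^m=\{1,J_{(m)}\}\hat{M}^m$, $P^m=M^mA(N^+)^m$, $\hat{P}^m=\hat{M}^mA(N^+)^m$. $G^n$ (hence $P^n,\hat P^n$) is viewed as a subgroup of $G^{n+1}$ via $i(g)=\begin{pmatrix}g&0\\0&1\end{pmatrix}$, and $i^*$ is pullback along $i$. $\sigma_-:M^m\to\mathbb{C}^*$ is the character with $\sigma_-=1$ on $\hat{M}^m$ and $\sigma_-(J_{(m)})=-1$. $\xi_\lambda(\exp(tH))=e^{\lambda t}$. For a parabolic $P^m=M^mA(N^+)^m$, a group $G\in\{G^n,G^{n+1}\}$ containing it and a character $\sigma$ of $M^m$, $\mathrm{Ind}_{P^m}^{G}(\xi_\lambda\otimes\sigma)$ is the space of $u\in C^\infty(G)$ with $u(g\tilde m\tilde a\tilde n)=\sigma(\tilde m)\xi_\lambda(\tilde a)u(g)$ for all $g\in G$, $\tilde m\tilde a\tilde n\in P^m$, with $G$ acting by left translation $(g\cdot u)(x)=u(g^{-1}x)$; $\mathrm{Ind}(\xi_\lambda)$ means $\sigma$ trivial.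 The same definition is used for $\hat{P}^m$ (with $\hat M^m$ in place of $M^m$). Elements of $\mathcal{U}(\mathfrak{g}_{n+1})$ act on $C^\infty(G^{n+1})$ as left-invariant differential operators by extending $(R(X)u)(x)=\frac{d}{dt}\big|_{t=0}u(x\exp(tX))$. The family $\mathcal{D}_N^0(\lambda)$: let $\Delta_{n-1}=-(Q_1^-)^2+(Q_2^-)^2+\sum_{j=1}^{n-3}(Y_j^-)^2\in\mathcal{U}(\mathfrak{n}_n^-)$ and $T_n=Y_{n-2}^-\in\mathfrak{n}_{n+1}^-$. Then for $k\ge 0$ $\mathcal{D}_{2k}^0(\lambda)=\sum_{j=0}^k a_j(\lambda)\Delta_{n-1}^jT_n^{2k-2j}$, with $a_k(\lambda)=1$ and $(k-j+1)(2k-2j+1)a_{j-1}(\lambda)+j(n-1+2\lambda-4k+2j)a_j(\lambda)=0$ for $j=1,\dots,k$; $\mathcal{D}_{2k+1}^0(\lambda)=\sum_{j=0}^k b_j(\lambda)\Delta_{n-1}^jT_n^{2k-2j+1}$, with $b_k(\lambda)=1$ and $(k-j+1)(2k-2j+3)b_{j-1}(\lambda)+j(n-3+2\lambda-4k+2j)b_j(\lambda)=0$ for $j=1,\dots,k$. *)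

theory Defs
  imports
    "HOL-Analysis.Analysis"
    "HOL-Algebra.Generated_Groups"
    "HOL-Algebra.QuotRing"
    "HOL-Library.Poly_Mapping"
    "HOL-Computational_Algebra.Polynomial"
begin

text \<open>
  The coordinates \<open>1, \<dots>, m + 1\<close> of the space on which \<open>O(2, m - 1)\<close> acts: the constructors
  \<open>I1, I2, I3, I4\<close> are the first four, and \<open>Ix j\<close> is the coordinate \<open>4 + j\<close>, where \<open>j\<close> ranges over
  a type with \<open>m - 3\<close> elements.  If \<open>'j\<close> serves for \<open>m = n\<close>, then \<open>'j option\<close> serves for
  \<open>m = n + 1\<close>, with \<open>None\<close> in the role of the last index \<open>j = n - 2\<close>.
\<close>

datatype 'j idx = I1 | I2 | I3 | I4 | Ix 'j

instance idx :: (finite) finite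
proof
  have "x \<in> {I1, I2, I3, I4} \<union> range Ix" for x :: "'a idx"
    by (cases x) auto
  then have "(UNIV :: 'a idx set) = {I1, I2, I3, I4} \<union> range Ix"
    by blast
  also have "finite \<dots>"
    by simp
  finally show "finite (UNIV :: 'a idx set)" .
qed

type_synonym 'i sqmat = "((real, 'i) vec, 'i) vec"
type_synonym 'j gmat = "'j idx sqmat"


subsection \<open>Matrix exponential and Lie bracket\<close>

text \<open>The library's \<open>exp\<close> is not available for square matrices.\<close>

definition mexp :: "('i::finite) sqmat \<Rightarrow> 'i sqmat" where
  "mexp X = suminf (\<lambda>k. (1 / fact k) *\<^sub>R (((**) X ^^ k) (mat 1)))"

definition mbracket :: "('i::finite) sqmat \<Rightarrow> 'i sqmat \<Rightarrow> 'i sqmat" where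
  "mbracket X Y = X ** Y - Y ** X"

definition Emat :: "'i \<Rightarrow> 'i \<Rightarrow> ('i::finite) sqmat" where
  "Emat a b = (\<chi> i j. if i = a \<and> j = b then 1 else 0)"


subsection \<open>The group \<open>O(2, m - 1)\<close>\<close>

definition qform :: "(real, 'j::finite idx) vec \<Rightarrow> real" where
  "qform v = - (v $ I1)\<^sup>2 - (v $ I2)\<^sup>2 + (v $ I3)\<^sup>2 + (v $ I4)\<^sup>2 + (\<Sum>j\<in>UNIV. (v $ Ix j)\<^sup>2)"

definition O2 :: "('j::finite) gmat set" where
  "O2 = {g. \<forall>v. qform (g *v v) = qform v}"

definition O2_grp :: "('j::finite) gmat monoid" where
  "O2_grp = \<lparr>carrier = O2, monoid.mult = (**), one = mat 1\<rparr>"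

definition emb :: "('j::finite) gmat \<Rightarrow> ('j option) gmat" where
  "emb g = (\<chi> a b. if a = Ix None \<or> b = Ix None then (if a = b then 1 else 0)
                   else g $ (map_idx the a) $ (map_idx the b))"


subsection \<open>Lie algebra elements and subalgebras\<close>

definition Hmat :: "('j::finite) gmat" where
  "Hmat = Emat I1 I4 + Emat I4 I1"

definition H2 :: "('j::finite) gmat" where
  "H2 = Emat I2 I3 + Emat I3 I2"

definition Q1m :: "('j::finite) gmat" where
  "Q1m = - Emat I1 I2 + Emat I2 I1 + Emat I2 I4 + Emat I4 I2"

definition Q2m :: "('j::finite) gmat" where
  "Q2m = Emat I1 I3 + Emat I3 I1 + Emat I3 I4 - Emat I4 I3"

definition Ym :: "'j \<Rightarrow> ('j::finite) gmat" where
  "Ym j = Emat (Ix j) I1 + Emat (Ix j) I4 + Emat I1 (Ix j) - Emat I4 (Ix j)"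

definition Zp :: "'j \<Rightarrow> ('j::finite) gmat" where
  "Zp j = Emat I2 (Ix j) + Emat I3 (Ix j) + Emat (Ix j) I2 - Emat (Ix j) I3"

definition Mrot :: "'j \<Rightarrow> 'j \<Rightarrow> ('j::finite) gmat" where
  "Mrot i j = Emat (Ix i) (Ix j) - Emat (Ix j) (Ix i)"

definition Q1p :: "('j::finite) gmat" where
  "Q1p = transpose Q1m"

definition Q2p :: "('j::finite) gmat" where
  "Q2p = transpose Q2m"

definition Yp :: "'j \<Rightarrow> ('j::finite) gmat" where
  "Yp j = transpose (Ym j)"

definition Zm :: "'j \<Rightarrow> ('j::finite) gmat" where
  "Zm j = transpose (Zp j)"

definition lie_a :: "('j::finite) gmat set" where
  "lie_a = span {Hmat}"

definition lie_m :: "('j::finite) gmat set" where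
  "lie_m = span ({H2} \<union> range Zp \<union> range Zm \<union> {Mrot i j | i j. True})"

definition lie_n_plus :: "('j::finite) gmat set" where
  "lie_n_plus = span ({Q1p, Q2p} \<union> range Yp)"

definition lie_n_minus :: "('j::finite) gmat set" where
  "lie_n_minus = span ({Q1m, Q2m} \<union> range Ym)"


subsection \<open>Subgroups and characters\<close>

definition grp_A :: "('j::finite) gmat set" where
  "grp_A = mexp ` lie_a"

definition grp_N_plus :: "('j::finite) gmat set" where
  "grp_N_plus = mexp ` lie_n_plus"

text \<open>The analytic subgroup with Lie algebra \<open>\<mm>\<close> is the subgroup generated by \<open>exp \<mm>\<close>.\<close>

definition grp_M0 :: "('j::finite) gmat set" where
  "grp_M0 = generate O2_grp (mexp ` lie_m)"

definition w1 :: "('j::finite) gmat" where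
  "w1 = (\<chi> a b. if a = b then (if a = I2 then -1 else 1) else 0)"

definition w2 :: "('j::finite) gmat" where
  "w2 = (\<chi> a b. if a = b then (if a = I3 then -1 else 1) else 0)"

definition Jmat :: "('j::finite) gmat" where
  "Jmat = - mat 1"

definition grp_Mhat :: "('j::finite) gmat set" where
  "grp_Mhat = generate O2_grp {w1, w2} <#>\<^bsub>O2_grp\<^esub> grp_M0"

definition grp_M :: "('j::finite) gmat set" where
  "grp_M = {mat 1, Jmat} <#>\<^bsub>O2_grp\<^esub> grp_Mhat"

text \<open>
  On \<open>M\<close>, the union of \<open>\<^term>\<open>grp_Mhat\<close>\<close> and its coset by the central element \<open>\<^term>\<open>Jmat\<close>\<close>, this is
  the character that is \<open>1\<close> on the first and \<open>-1\<close> on the second; they are disjoint because the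
  first diagonal entry is \<open>1\<close> on \<open>\<^term>\<open>grp_Mhat\<close>\<close>.
\<close>

definition sigma_minus :: "('j::finite) gmat \<Rightarrow> complex" where
  "sigma_minus m = (if m \<in> grp_Mhat then 1 else -1)"

definition xi :: "complex \<Rightarrow> ('j::finite) gmat \<Rightarrow> complex" where
  "xi lam a = exp (lam * of_real (THE t. a = mexp (t *\<^sub>R Hmat)))"


subsection \<open>Smooth functions and induced representations\<close>

primrec Ck_on :: "nat \<Rightarrow> 'a::real_normed_vector set \<Rightarrow> ('a \<Rightarrow> 'b::real_normed_vector) \<Rightarrow> bool" where
  "Ck_on 0 S f \<longleftrightarrow> continuous_on S f"
| "Ck_on (Suc k) S f \<longleftrightarrow>
     (\<forall>x\<in>S. f differentiable (at x)) \<and> (\<forall>v. Ck_on k S (\<lambda>x. frechet_derivative f (at x) v))"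

text \<open>
  A function on a subset of a normed space (here the embedded submanifold \<open>\<^term>\<open>O2\<close>\<close> of the matrix
  space) is smooth if it locally extends to a smooth function on an open subset of the space.
  Functions on the group are represented by total functions whose values elsewhere are irrelevant.
\<close>

definition smooth_fun :: "'a::real_normed_vector set \<Rightarrow> ('a \<Rightarrow> 'b::real_normed_vector) set" where
  "smooth_fun S = {u. \<forall>x\<in>S. \<exists>U F. open U \<and> x \<in> U \<and> (\<forall>k. Ck_on k U F) \<and> (\<forall>y\<in>U \<inter> S. F y = u y)}"

text \<open>
  \<open>Ind \<iota> M \<sigma> lam\<close> is the space of smooth \<open>u\<close> on the group of matrices of type \<open>'k gmat\<close> that
  transform by \<open>\<sigma>\<close> on \<open>M\<close> and \<open>xi lam\<close> on \<open>A\<close> under right translation by the parabolic \<open>M A N\<^sup>+\<close>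
  of matrices of type \<open>'j gmat\<close>, regarded as a subgroup via \<open>\<iota>\<close>.
\<close>

definition Ind ::
  "(('j::finite) gmat \<Rightarrow> ('k::finite) gmat) \<Rightarrow> 'j gmat set \<Rightarrow> ('j gmat \<Rightarrow> complex) \<Rightarrow> complex
    \<Rightarrow> ('k gmat \<Rightarrow> complex) set" where
  "Ind \<iota> M \<sigma> lam = {u \<in> smooth_fun O2. \<forall>g\<in>O2. \<forall>m\<in>M. \<forall>a\<in>grp_A. \<forall>n\<in>grp_N_plus.
      u (g ** \<iota> (m ** a ** n)) = \<sigma> m * xi lam a * u g}"

definition ltrans :: "('i::finite) sqmat \<Rightarrow> ('i sqmat \<Rightarrow> complex) \<Rightarrow> ('i sqmat \<Rightarrow> complex)" where
  "ltrans g u = (\<lambda>x. u (matrix_inv g ** x))"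

text \<open>
  \<open>D\<close> is a linear operator from \<open>V\<close> to the space \<open>W\<close> of functions on \<open>\<^term>\<open>O2\<close>\<close> (of type \<open>'l gmat\<close>)
  that commutes with left translation by this group, which acts on \<open>V\<close> through \<open>\<iota>\<close>.
\<close>

definition equivariant_op ::
  "(('l::finite) gmat \<Rightarrow> ('k::finite) gmat) \<Rightarrow> ('k gmat \<Rightarrow> complex) set \<Rightarrow> ('l gmat \<Rightarrow> complex) set
    \<Rightarrow> (('k gmat \<Rightarrow> complex) \<Rightarrow> ('l gmat \<Rightarrow> complex)) \<Rightarrow> bool" where
  "equivariant_op \<iota> V W D \<longleftrightarrow>
     (\<forall>u\<in>V. D u \<in> W) \<and>
     (\<forall>u\<in>V. \<forall>v\<in>V. \<forall>x\<in>O2. D (\<lambda>y. u y + v y) x = D u x + D v x) \<and>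
     (\<forall>c. \<forall>u\<in>V. \<forall>x\<in>O2. D (\<lambda>y. c * u y) x = c * D u x) \<and>
     (\<forall>g\<in>O2. \<forall>u\<in>V. \<forall>x\<in>O2. D (ltrans (\<iota> g) u) x = ltrans g (D u) x)"


subsection \<open>The complex universal enveloping algebra\<close>

text \<open>
  Words are wrapped in a datatype in order to make concatenation an instance of \<open>\<^class>\<open>monoid_add\<close>\<close>;
  then \<open>'g word \<Rightarrow>\<^sub>0 complex\<close> with its ring structure is the free associative algebra over \<open>'g\<close>.
\<close>

datatype 'g word = Word (letters: "'g list")

instantiation word :: (type) monoid_add
begin

definition zero_word :: "'a word" where
  "zero_word = Word []"

definition plus_word :: "'a word \<Rightarrow> 'a word \<Rightarrow> 'a word" where
  "plus_word v w = Word (letters v @ letters w)"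

instance
  by standard (auto simp: zero_word_def plus_word_def)

end

definition free_alg :: "'g set \<Rightarrow> ('g word \<Rightarrow>\<^sub>0 complex) ring" where
  "free_alg L = \<lparr>carrier = {p. \<forall>w\<in>Poly_Mapping.keys p. set (letters w) \<subseteq> L},
                 monoid.mult = (*), one = 1, ring.zero = 0, add = (+)\<rparr>"

definition free_const :: "complex \<Rightarrow> ('g word \<Rightarrow>\<^sub>0 complex)" where
  "free_const c = Poly_Mapping.single 0 c"

definition free_gen :: "'g \<Rightarrow> ('g word \<Rightarrow>\<^sub>0 complex)" where
  "free_gen X = Poly_Mapping.single (Word [X]) 1"

definition lie_relations :: "('i::finite) sqmat set \<Rightarrow> ('i sqmat word \<Rightarrow>\<^sub>0 complex) set" where
  "lie_relations L =
     {free_gen (X + Y) - free_gen X - free_gen Y | X Y. X \<in> L \<and> Y \<in> L} \<union>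
     {free_gen (r *\<^sub>R X) - free_const (of_real r) * free_gen X | r X. X \<in> L} \<union>
     {free_gen X * free_gen Y - free_gen Y * free_gen X - free_gen (mbracket X Y) | X Y.
        X \<in> L \<and> Y \<in> L}"

definition uea_ideal :: "('i::finite) sqmat set \<Rightarrow> ('i sqmat word \<Rightarrow>\<^sub>0 complex) set" where
  "uea_ideal L = genideal (free_alg L) (lie_relations L)"

text \<open>
  The universal enveloping algebra of the complexification of a real Lie algebra \<open>L\<close> of matrices.
\<close>

definition uea :: "('i::finite) sqmat set \<Rightarrow> ('i sqmat word \<Rightarrow>\<^sub>0 complex) set ring" where
  "uea L = free_alg L Quot uea_ideal L"

definition uea_const :: "('i::finite) sqmat set \<Rightarrow> complex \<Rightarrow> ('i sqmat word \<Rightarrow>\<^sub>0 complex) set" where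
  "uea_const L c = uea_ideal L +>\<^bsub>free_alg L\<^esub> free_const c"

definition uea_gen :: "('i::finite) sqmat set \<Rightarrow> 'i sqmat \<Rightarrow> ('i sqmat word \<Rightarrow>\<^sub>0 complex) set" where
  "uea_gen L X = uea_ideal L +>\<^bsub>free_alg L\<^esub> free_gen X"


subsection \<open>Left-invariant differential operators\<close>

definition R_vec :: "('i::finite) sqmat \<Rightarrow> ('i sqmat \<Rightarrow> complex) \<Rightarrow> ('i sqmat \<Rightarrow> complex)" where
  "R_vec X u = (\<lambda>x. vector_derivative (\<lambda>t. u (x ** mexp (t *\<^sub>R X))) (at 0))"

definition R_free ::
  "('i::finite sqmat word \<Rightarrow>\<^sub>0 complex) \<Rightarrow> ('i sqmat \<Rightarrow> complex) \<Rightarrow> ('i sqmat \<Rightarrow> complex)" where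
  "R_free p u = (\<lambda>x. \<Sum>w\<in>Poly_Mapping.keys p. Poly_Mapping.lookup p w * foldr R_vec (letters w) u x)"

text \<open>
  An element of the enveloping algebra is a coset in the free algebra; all its members act in the
  same way on smooth functions on the group, because the defining relations act by \<open>0\<close>.
\<close>

definition R_act ::
  "('i::finite sqmat word \<Rightarrow>\<^sub>0 complex) set \<Rightarrow> ('i sqmat \<Rightarrow> complex) \<Rightarrow> ('i sqmat \<Rightarrow> complex)" where
  "R_act d u = R_free (SOME p. p \<in> d) u"


subsection \<open>The family \<open>\<D>\<^sub>N\<^sup>0(\<lambda>)\<close>\<close>

text \<open>The recursions run downwards from \<open>j = k\<close>; values for \<open>j > k\<close> are never used.\<close>

function a_coef :: "nat \<Rightarrow> complex \<Rightarrow> nat \<Rightarrow> nat \<Rightarrow> complex" where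
  "a_coef n lam k j = (if k \<le> j then 1 else
     - (of_nat (j + 1) * (of_nat n - 1 + 2 * lam - 4 * of_nat k + 2 * of_nat (j + 1)))
       / (of_nat (k - j) * of_nat (2 * (k - j) - 1)) * a_coef n lam k (j + 1))"
  by pat_completeness auto
termination by (relation "Wellfounded.measure (\<lambda>(n, lam, k, j). k - j)") auto

function b_coef :: "nat \<Rightarrow> complex \<Rightarrow> nat \<Rightarrow> nat \<Rightarrow> complex" where
  "b_coef n lam k j = (if k \<le> j then 1 else
     - (of_nat (j + 1) * (of_nat n - 3 + 2 * lam - 4 * of_nat k + 2 * of_nat (j + 1)))
       / (of_nat (k - j) * of_nat (2 * (k - j) + 1)) * b_coef n lam k (j + 1))"
  by pat_completeness auto
termination by (relation "Wellfounded.measure (\<lambda>(n, lam, k, j). k - j)") auto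

declare a_coef.simps [simp del] b_coef.simps [simp del]

lemma a_coef_top: "a_coef n lam k k = 1"
  by (simp add: a_coef.simps)

lemma b_coef_top: "b_coef n lam k k = 1"
  by (simp add: b_coef.simps)

lemma recurrence_aux:
  fixes A B J P Q X :: complex
  assumes "A = - (J * X) / (P * Q) * B" "P \<noteq> 0" "Q \<noteq> 0"
  shows "P * Q * A + J * X * B = 0"
  using assms by simp

lemma a_coef_recurrence:
  assumes "1 \<le> j" "j \<le> k"
  shows "(of_nat k - of_nat j + 1) * (2 * of_nat k - 2 * of_nat j + 1) * a_coef n lam k (j - 1)
       + of_nat j * (of_nat n - 1 + 2 * lam - 4 * of_nat k + 2 * of_nat j) * a_coef n lam k j = 0"
proof -
  obtain d where d: "k = j + d" using le_Suc_ex[OF assms(2)] by blast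
  have P: "k - (j - 1) = Suc d" "2 * Suc d - 1 = 2 * d + 1" and j: "j - 1 + 1 = j"
    and nle: "\<not> k \<le> j - 1"
    using assms(1) d by auto
  have "a_coef n lam k (j - 1)
      = - (of_nat j * (of_nat n - 1 + 2 * lam - 4 * of_nat k + 2 * of_nat j))
        / (of_nat (Suc d) * of_nat (2 * d + 1)) * a_coef n lam k j"
    by (subst a_coef.simps) (simp only: P j nle if_False)
  then have "of_nat (Suc d) * of_nat (2 * d + 1) * a_coef n lam k (j - 1)
      + of_nat j * (of_nat n - 1 + 2 * lam - 4 * of_nat k + 2 * of_nat j) * a_coef n lam k j = 0"
    by (rule recurrence_aux) (unfold of_nat_eq_0_iff, simp_all)
  moreover have "of_nat (Suc d) = (of_nat k - of_nat j + 1 :: complex)"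
    "of_nat (2 * d + 1) = (2 * of_nat k - 2 * of_nat j + 1 :: complex)"
    by (simp_all add: d)
  ultimately show ?thesis by (simp only:)
qed

lemma b_coef_recurrence:
  assumes "1 \<le> j" "j \<le> k"
  shows "(of_nat k - of_nat j + 1) * (2 * of_nat k - 2 * of_nat j + 3) * b_coef n lam k (j - 1)
       + of_nat j * (of_nat n - 3 + 2 * lam - 4 * of_nat k + 2 * of_nat j) * b_coef n lam k j = 0"
proof -
  obtain d where d: "k = j + d" using le_Suc_ex[OF assms(2)] by blast
  have P: "k - (j - 1) = Suc d" "2 * Suc d + 1 = 2 * d + 3" and j: "j - 1 + 1 = j"
    and nle: "\<not> k \<le> j - 1"
    using assms(1) d by auto
  have "b_coef n lam k (j - 1)
      = - (of_nat j * (of_nat n - 3 + 2 * lam - 4 * of_nat k + 2 * of_nat j))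
        / (of_nat (Suc d) * of_nat (2 * d + 3)) * b_coef n lam k j"
    by (subst b_coef.simps) (simp only: P j nle if_False)
  then have "of_nat (Suc d) * of_nat (2 * d + 3) * b_coef n lam k (j - 1)
      + of_nat j * (of_nat n - 3 + 2 * lam - 4 * of_nat k + 2 * of_nat j) * b_coef n lam k j = 0"
    by (rule recurrence_aux) (unfold of_nat_eq_0_iff, simp_all)
  moreover have "of_nat (Suc d) = (of_nat k - of_nat j + 1 :: complex)"
    "of_nat (2 * d + 3) = (2 * of_nat k - 2 * of_nat j + 3 :: complex)"
    by (simp_all add: d)
  ultimately show ?thesis by (simp only:)
qed

lemma a_coef_polynomial: "\<exists>p. \<forall>lam. a_coef n lam k j = poly p lam"
proof (induction "k - j" arbitrary: j)
  case 0
  then show ?case by (intro exI[of _ 1]) (simp add: a_coef.simps)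
next
  case (Suc d)
  then obtain p where p: "\<forall>lam. a_coef n lam k (j + 1) = poly p lam" by force
  define s where "s = (of_nat (k - j) * of_nat (2 * (k - j) - 1) :: complex)"
  define r where "r = (of_nat (j + 1) :: complex)"
  have "a_coef n lam k j
      = poly (smult (- r / s) [: of_nat n - 1 - 4 * of_nat k + 2 * r, 2 :] * p) lam" for lam
  proof -
    have "a_coef n lam k j
        = - (r * (of_nat n - 1 + 2 * lam - 4 * of_nat k + 2 * r)) / s * a_coef n lam k (j + 1)"
      using Suc.hyps(2) unfolding s_def r_def by (subst a_coef.simps) (simp del: of_nat_add of_nat_mult)
    then show ?thesis
      using p by (simp add: divide_inverse algebra_simps)
  qed
  then show ?case by blast
qed

lemma b_coef_polynomial: "\<exists>p. \<forall>lam. b_coef n lam k j = poly p lam"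
proof (induction "k - j" arbitrary: j)
  case 0
  then show ?case by (intro exI[of _ 1]) (simp add: b_coef.simps)
next
  case (Suc d)
  then obtain p where p: "\<forall>lam. b_coef n lam k (j + 1) = poly p lam" by force
  define s where "s = (of_nat (k - j) * of_nat (2 * (k - j) + 1) :: complex)"
  define r where "r = (of_nat (j + 1) :: complex)"
  have "b_coef n lam k j
      = poly (smult (- r / s) [: of_nat n - 3 - 4 * of_nat k + 2 * r, 2 :] * p) lam" for lam
  proof -
    have "b_coef n lam k j
        = - (r * (of_nat n - 3 + 2 * lam - 4 * of_nat k + 2 * r)) / s * b_coef n lam k (j + 1)"
      using Suc.hyps(2) unfolding s_def r_def by (subst b_coef.simps) (simp del: of_nat_add of_nat_mult)
    then show ?thesis
      using p by (simp add: divide_inverse algebra_simps)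
  qed
  then show ?case by blast
qed

text \<open>
  Elements of \<open>\<U>(\<nn>\<^sup>-)\<close> for \<open>m = n + 1\<close>.  Under \<open>X \<mapsto> diag(X, 0)\<close> the matrices \<open>\<^term>\<open>Q1m\<close>\<close>, \<open>\<^term>\<open>Q2m\<close>\<close>
  for \<open>m = n\<close> are sent to the matrices of the same name, and \<open>\<^term>\<open>Ym j\<close>\<close> to \<open>\<^term>\<open>Ym (Some j)\<close>\<close>.
\<close>

abbreviation Un_minus :: "(('j::finite) option gmat word \<Rightarrow>\<^sub>0 complex) set ring" where
  "Un_minus \<equiv> uea lie_n_minus"

definition Lap :: "(('j::finite) option gmat word \<Rightarrow>\<^sub>0 complex) set" where
  "Lap = (\<ominus>\<^bsub>Un_minus\<^esub> (uea_gen lie_n_minus Q1m [^]\<^bsub>Un_minus\<^esub> (2::nat)))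
      \<oplus>\<^bsub>Un_minus\<^esub> (uea_gen lie_n_minus Q2m [^]\<^bsub>Un_minus\<^esub> (2::nat))
      \<oplus>\<^bsub>Un_minus\<^esub> (\<Oplus>\<^bsub>Un_minus\<^esub>j\<in>(UNIV :: 'j set). uea_gen lie_n_minus (Ym (Some j)) [^]\<^bsub>Un_minus\<^esub> (2::nat))"

definition Tlast :: "(('j::finite) option gmat word \<Rightarrow>\<^sub>0 complex) set" where
  "Tlast = uea_gen lie_n_minus (Ym None)"

definition D0 :: "nat \<Rightarrow> nat \<Rightarrow> complex \<Rightarrow> (('j::finite) option gmat word \<Rightarrow>\<^sub>0 complex) set" where
  "D0 n N lam = (let k = N div 2 in
     if even N
     then (\<Oplus>\<^bsub>Un_minus\<^esub>j\<in>{0..k}. uea_const lie_n_minus (a_coef n lam k j) \<otimes>\<^bsub>Un_minus\<^esub>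
            ((Lap [^]\<^bsub>Un_minus\<^esub> j) \<otimes>\<^bsub>Un_minus\<^esub> (Tlast [^]\<^bsub>Un_minus\<^esub> (2 * k - 2 * j))))
     else (\<Oplus>\<^bsub>Un_minus\<^esub>j\<in>{0..k}. uea_const lie_n_minus (b_coef n lam k j) \<otimes>\<^bsub>Un_minus\<^esub>
            ((Lap [^]\<^bsub>Un_minus\<^esub> j) \<otimes>\<^bsub>Un_minus\<^esub> (Tlast [^]\<^bsub>Un_minus\<^esub> (2 * k - 2 * j + 1)))))"

text \<open>The operator induced by \<open>\<^term>\<open>D0\<close>\<close>, without and with restriction to the smaller group.\<close>

definition D_prime ::
  "nat \<Rightarrow> nat \<Rightarrow> complex \<Rightarrow> (('j::finite) option gmat \<Rightarrow> complex) \<Rightarrow> ('j option gmat \<Rightarrow> complex)" where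
  "D_prime n N lam u = R_act (D0 n N lam) u"

definition D_restr ::
  "nat \<Rightarrow> nat \<Rightarrow> complex \<Rightarrow> (('j::finite) option gmat \<Rightarrow> complex) \<Rightarrow> ('j gmat \<Rightarrow> complex)" where
  "D_restr n N lam u = D_prime n N lam u \<circ> emb"

end

theory Submission
  imports Defs "HOL-Library.Function_Algebras"
begin

text \<open>
  Left translation commutes with every operator \<open>R(D)\<close>, so equivariance is automatic once \<open>R(D)\<close> is known
  to be well defined and to map into the right space.  What has to be shown is that \<open>R(D) u\<close> transforms
  under right translation by \<open>P\<^sup>n\<close> as required.  There are three ingredients.

  First, \<open>X \<mapsto> R(X)\<close> is a representation of the Lie algebra on smooth functions on the group; the
  commutator relation (\<open>R_vec_bracket\<close>) is the symmetry of second derivatives.  Hence the ideal that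
  defines the enveloping algebra acts by zero, any representative of an element may be used, and the
  element \<open>\<D>\<^sub>N\<^sup>0(\<lambda>)\<close> acts as \<open>\<Sum>\<^sub>j c\<^sub>j \<Delta>\<^sup>j T\<^sup>N\<^sup>-\<^sup>2\<^sup>j\<close> (\<open>acts_D0\<close>), with one formula for both parities of \<open>N\<close>.

  Second, an element \<open>u\<close> of the induced representation satisfies \<open>R(H) u = \<lambda> u\<close> and is killed by
  \<open>R(\<mm>)\<close> and \<open>R(\<nn>\<^sup>+)\<close>.  The elements \<open>\<Delta>\<close> and \<open>T\<close> are invariant under \<open>\<mm>\<close> of the smaller group and lower the
  \<open>H\<close>-weight by 2 and 1, so only the raising vectors \<open>X\<^sub>a\<close> of the smaller group remain.  The brackets
  \<open>[X\<^sub>a, Y\<^sub>b]\<close> lie in \<open>\<aa> + \<mm>\<close>, which gives, with \<open>\<epsilon>\<^sub>a = \<plusminus>1\<close> and for \<open>g\<close> of weight \<open>\<mu>\<close> that is killed by the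
  rotations,
    \<open>X\<^sub>a T\<^sup>b u = \<epsilon>\<^sub>a b (b - 1) Y\<^sub>a T\<^sup>b\<^sup>-\<^sup>2 u\<close>  and
    \<open>X\<^sub>a \<Delta>\<^sup>j g = \<Delta>\<^sup>j X\<^sub>a g + \<epsilon>\<^sub>a j (4 \<mu> - 4 j + 2 (n - 1)) Y\<^sub>a \<Delta>\<^sup>j\<^sup>-\<^sup>1 g\<close>.
  In \<open>X\<^sub>a R(D) u\<close> the coefficient of \<open>Y\<^sub>a \<Delta>\<^sup>j\<^sup>-\<^sup>1 T\<^sup>N\<^sup>-\<^sup>2\<^sup>j u\<close> is, up to sign,
    \<open>(N - 2 j + 2) (N - 2 j + 1) c\<^sub>j\<^sub>-\<^sub>1 + 2 j (n - 1 + 2 \<lambda> - 2 N + 2 j) c\<^sub>j\<close>,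
  and the recursion for the coefficients says that it vanishes (\<open>Xn_D_op\<close>).

  Third, these infinitesimal statements integrate: if \<open>R(X) v = c v\<close>, then \<open>v (x exp (t X)) = e\<^sup>c\<^sup>t v x\<close>
  (\<open>R_vec_eigen_curve\<close>).  This settles \<open>A\<close>, \<open>N\<^sup>+\<close> and the connected group \<open>M\<^sub>0\<close>.  The remaining generators
  \<open>w\<^sub>1\<close>, \<open>w\<^sub>2\<close>, \<open>J\<close> are diagonal sign matrices; conjugation by them multiplies each \<open>Y\<^sub>a\<close> by a sign, so that
  \<open>\<Delta>\<close> is fixed, and \<open>T\<close> is fixed by \<open>w\<^sub>1\<close>, \<open>w\<^sub>2\<close> and reversed by the embedded \<open>J\<close> of the smaller group.
  The latter is an element of \<open>M\<close> of the larger group (\<open>emb_Jmat\<close>), hence fixes \<open>u\<close>, and the sign \<open>(-1)\<^sup>N\<close>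
  that it produces is the character \<open>\<sigma>\<close>.
\<close>

section \<open>The matrix exponential\<close>

lemma sums_vecI:
  fixes f :: "nat \<Rightarrow> ('a::real_normed_vector, 'i::finite) vec"
  assumes "\<And>i. (\<lambda>k. f k $ i) sums (s $ i)"
  shows "f sums s"
  using assms unfolding sums_def by (intro vec_tendstoI) (simp add: sum_component)

lemma has_vector_derivative_vecI:
  fixes f :: "real \<Rightarrow> ('a::euclidean_space, 'i::finite) vec"
  assumes "\<And>i. ((\<lambda>t. f t $ i) has_vector_derivative (d $ i)) (at t)"
  shows "(f has_vector_derivative d) (at t)"
  unfolding has_vector_derivative_def
proof (subst has_derivative_componentwise_within, intro ballI)
  fix b :: "('a, 'i) vec"
  assume "b \<in> Basis"
  then obtain i u where b: "b = axis i u" "u \<in> Basis" by (auto simp: Basis_vec_def)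
  have "((\<lambda>t. f t $ i) has_derivative (\<lambda>x. x *\<^sub>R d $ i)) (at t)"
    using assms[of i] by (simp add: has_vector_derivative_def)
  from has_derivative_inner_left[OF this, of u]
  show "((\<lambda>x. f x \<bullet> b) has_derivative (\<lambda>x. (x *\<^sub>R d) \<bullet> b)) (at t)"
    by (simp add: b inner_axis)
qed

interpretation matrix_mult: bounded_bilinear "(**) :: 'i::finite sqmat \<Rightarrow> 'i sqmat \<Rightarrow> 'i sqmat"
proof -
  have "bilinear ((**) :: 'i::finite sqmat \<Rightarrow> 'i sqmat \<Rightarrow> 'i sqmat)"
    unfolding bilinear_def linear_iff
    by (auto simp: vec_eq_iff matrix_matrix_mult_def sum.distrib sum_distrib_left algebra_simps)
  then show "bounded_bilinear ((**) :: 'i sqmat \<Rightarrow> 'i sqmat \<Rightarrow> 'i sqmat)"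
    by (simp add: bilinear_conv_bounded_bilinear)
qed

text \<open>
  The constant is the sum of the absolute values of all entries.  The estimate is crude, but it makes
  every entry of the exponential a power series in \<open>t\<close> that converges everywhere.
\<close>

lemma mpow_bound:
  fixes X :: "('i::finite) sqmat"
  shows "\<bar>((**) X ^^ k) (mat 1) $ i $ j\<bar> \<le> (\<Sum>i\<in>UNIV. \<Sum>j\<in>UNIV. \<bar>X $ i $ j\<bar>) ^ k"
proof (induction k arbitrary: i j)
  case 0
  then show ?case by (simp add: mat_def)
next
  case (Suc k)
  let ?c = "\<Sum>i\<in>UNIV. \<Sum>j\<in>UNIV. \<bar>X $ i $ j\<bar>"
  have c0: "?c \<ge> 0" by (intro sum_nonneg) auto
  have "\<bar>((**) X ^^ Suc k) (mat 1) $ i $ j\<bar> \<le> (\<Sum>l\<in>UNIV. \<bar>X $ i $ l\<bar> * \<bar>((**) X ^^ k) (mat 1) $ l $ j\<bar>)"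
    by (simp add: matrix_matrix_mult_def abs_mult[symmetric])
  also have "\<dots> \<le> (\<Sum>l\<in>UNIV. \<bar>X $ i $ l\<bar> * ?c ^ k)"
    by (intro sum_mono mult_left_mono Suc.IH) auto
  also have "\<dots> = (\<Sum>l\<in>UNIV. \<bar>X $ i $ l\<bar>) * ?c ^ k"
    by (simp add: sum_distrib_right)
  also have "\<dots> \<le> ?c * ?c ^ k"
    by (intro mult_right_mono member_le_sum[where f = "\<lambda>i. \<Sum>j\<in>UNIV. \<bar>X $ i $ j\<bar>"] zero_le_power c0)
       (auto intro: sum_nonneg)
  finally show ?case by simp
qed

lemma mpow_summable:
  fixes X :: "('i::finite) sqmat"
  shows "summable (\<lambda>k. ((**) X ^^ k) (mat 1) $ i $ j / fact k * t ^ k)"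
proof (rule summable_comparison_test')
  let ?c = "\<Sum>i\<in>UNIV. \<Sum>j\<in>UNIV. \<bar>X $ i $ j\<bar>"
  show "summable (\<lambda>k. inverse (fact k) * (?c * \<bar>t\<bar>) ^ k)"
    by (rule summable_exp)
  show "norm (((**) X ^^ k) (mat 1) $ i $ j / fact k * t ^ k) \<le> inverse (fact k) * (?c * \<bar>t\<bar>) ^ k"
    if "k \<ge> 0" for k
    using mult_right_mono[OF mpow_bound[of k X i j], of "inverse (fact k) * \<bar>t\<bar> ^ k"]
    by (simp add: abs_mult power_abs power_mult_distrib field_simps)
qed

lemma mpow_scaleR:
  fixes X :: "('i::finite) sqmat"
  shows "((**) (t *\<^sub>R X) ^^ k) (mat 1) = t ^ k *\<^sub>R ((**) X ^^ k) (mat 1)"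
  by (induction k) (auto simp: matrix_mult.scaleR_left matrix_mult.scaleR_right)

lemma mexp_sums:
  fixes X :: "('i::finite) sqmat"
  shows "(\<lambda>k. (1 / fact k) *\<^sub>R (((**) X ^^ k) (mat 1))) sums mexp X"
proof -
  let ?f = "\<lambda>k. (1 / fact k) *\<^sub>R (((**) X ^^ k) (mat 1))"
  have "?f sums (\<chi> i j. suminf (\<lambda>k. ?f k $ i $ j))"
    using mpow_summable[of X _ _ 1]
    by (intro sums_vecI) (simp add: summable_sums)
  then show ?thesis unfolding mexp_def by (simp add: sums_iff)
qed

lemma mexp_entry:
  fixes X :: "('i::finite) sqmat"
  shows "(\<lambda>k. ((**) X ^^ k) (mat 1) $ i $ j / fact k * t ^ k) sums (mexp (t *\<^sub>R X) $ i $ j)"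
proof -
  have "bounded_linear (\<lambda>A::'i sqmat. A $ i $ j)"
    by (intro bounded_linear_compose[OF bounded_linear_vec_nth bounded_linear_vec_nth])
  from bounded_linear.sums[OF this mexp_sums[of "t *\<^sub>R X"]]
  show ?thesis by (simp add: mpow_scaleR mult_ac)
qed

lemma mexp_0 [simp]: "mexp 0 = (mat 1 :: ('i::finite) sqmat)"
proof -
  have "mexp 0 $ i $ j = (mat 1 :: 'i sqmat) $ i $ j" for i j
  proof -
    have "(\<lambda>k. ((**) 0 ^^ k) (mat 1 :: 'i sqmat) $ i $ j / fact k * 0 ^ k) sums ((mat 1 :: 'i sqmat) $ i $ j)"
      using powser_sums_zero[of "\<lambda>k. ((**) 0 ^^ k) (mat 1 :: 'i sqmat) $ i $ j / fact k"] by simp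
    with mexp_entry[of "0 :: 'i sqmat" i j 0] show ?thesis by (simp add: sums_iff)
  qed
  then show ?thesis by (simp add: vec_eq_iff)
qed

text \<open>
  Termwise differentiation of each entry: it turns the coefficient \<open>X\<^sup>k / k!\<close> into \<open>X\<^sup>k\<^sup>+\<^sup>1 / k!\<close>, from which
  one factor \<open>X\<close> can be split off on the left.
\<close>

lemma mexp_deriv:
  fixes X :: "('i::finite) sqmat"
  shows "((\<lambda>t. mexp (t *\<^sub>R X)) has_vector_derivative (X ** mexp (t *\<^sub>R X))) (at t)"
proof (intro has_vector_derivative_vecI)
  fix i j
  define c where "c = (\<lambda>i k. ((**) X ^^ k) (mat 1) $ i $ j / fact k)"
  have "DERIV (\<lambda>t. suminf (\<lambda>k. c i k * t ^ k)) t :> suminf (\<lambda>k. diffs (c i) k * t ^ k)"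
    using mpow_summable unfolding c_def by (intro termdiffs_strong_converges_everywhere)
  also have "(\<lambda>t. suminf (\<lambda>k. c i k * t ^ k)) = (\<lambda>t. mexp (t *\<^sub>R X) $ i $ j)"
    unfolding c_def by (intro ext sums_unique[symmetric] mexp_entry)
  also have "(\<lambda>k. diffs (c i) k * t ^ k) = (\<lambda>k. \<Sum>l\<in>UNIV. X $ i $ l * (c l k * t ^ k))"
  proof
    fix k
    have "diffs (c i) k = ((**) X ^^ Suc k) (mat 1) $ i $ j / fact k"
      by (simp add: diffs_def c_def)
    also have "\<dots> = (\<Sum>l\<in>UNIV. X $ i $ l * c l k)"
      by (simp add: matrix_matrix_mult_def c_def sum_divide_distrib)
    finally show "diffs (c i) k * t ^ k = (\<Sum>l\<in>UNIV. X $ i $ l * (c l k * t ^ k))"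
      by (simp add: sum_distrib_left sum_distrib_right mult_ac)
  qed
  also have "suminf (\<lambda>k. \<Sum>l\<in>UNIV. X $ i $ l * (c l k * t ^ k)) = (\<Sum>l\<in>UNIV. X $ i $ l * mexp (t *\<^sub>R X) $ l $ j)"
    unfolding c_def by (intro sums_unique[symmetric] sums_sum sums_mult mexp_entry)
  finally show "((\<lambda>t. mexp (t *\<^sub>R X) $ i $ j) has_vector_derivative (X ** mexp (t *\<^sub>R X)) $ i $ j) (at t)"
    by (simp add: has_real_derivative_iff_has_vector_derivative matrix_matrix_mult_def)
qed

lemma mpow_commute:
  fixes X :: "('i::finite) sqmat"
  shows "X ** ((**) X ^^ k) (mat 1) = ((**) X ^^ k) (mat 1) ** X"
proof (induction k)
  case (Suc k)
  have "X ** ((**) X ^^ Suc k) (mat 1) = X ** (((**) X ^^ k) (mat 1) ** X)"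
    using Suc by simp
  then show ?case by (simp add: matrix_mul_assoc)
qed simp

lemma mexp_commute:
  fixes X :: "('i::finite) sqmat"
  shows "X ** mexp X = mexp X ** X"
proof -
  have "(\<lambda>k. X ** ((1 / fact k) *\<^sub>R (((**) X ^^ k) (mat 1)))) sums (X ** mexp X)"
    by (intro bounded_linear.sums[OF matrix_mult.bounded_linear_right] mexp_sums)
  moreover have "(\<lambda>k. ((1 / fact k) *\<^sub>R (((**) X ^^ k) (mat 1))) ** X) sums (mexp X ** X)"
    by (intro bounded_linear.sums[OF matrix_mult.bounded_linear_left] mexp_sums)
  ultimately show ?thesis
    by (simp add: matrix_mult.scaleR_left matrix_mult.scaleR_right mpow_commute sums_iff)
qed

lemma mexp_scale_commute:
  fixes X :: "('i::finite) sqmat"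
  shows "X ** mexp (t *\<^sub>R X) = mexp (t *\<^sub>R X) ** X"
proof (cases "t = 0")
  case False
  then show ?thesis using mexp_commute[of "t *\<^sub>R X"] by (simp add: matrix_mult.scaleR_left matrix_mult.scaleR_right)
qed simp

lemma vector_derivative_zero_const:
  fixes f :: "real \<Rightarrow> 'a::real_normed_vector"
  assumes "\<And>t. (f has_vector_derivative 0) (at t)"
  shows "f t = f 0"
proof -
  have "\<exists>c. \<forall>x\<in>UNIV. f x = c"
    using assms by (intro has_derivative_zero_constant) (auto simp: has_vector_derivative_def)
  then show ?thesis by auto
qed

lemma mexp_deriv_minus:
  fixes X :: "('i::finite) sqmat"
  shows "((\<lambda>t. mexp (t *\<^sub>R (- X))) has_vector_derivative - (mexp (t *\<^sub>R (- X)) ** X)) (at t)"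
  using mexp_deriv[of "- X" t] mexp_scale_commute[of "- X" t] by (simp add: matrix_mult.minus_left matrix_mult.minus_right)

lemma mexp_inverse_left:
  fixes X :: "('i::finite) sqmat"
  shows "mexp (t *\<^sub>R (- X)) ** mexp (t *\<^sub>R X) = mat 1"
proof -
  have "((\<lambda>t. mexp (t *\<^sub>R (- X)) ** mexp (t *\<^sub>R X)) has_vector_derivative 0) (at t)" for t
    using matrix_mult.has_vector_derivative[OF mexp_deriv_minus[of X t] mexp_deriv[of X t]]
    by (simp add: matrix_mult.minus_left matrix_mul_assoc)
  from vector_derivative_zero_const[OF this, of t] show ?thesis by simp
qed

text \<open>
  Uniqueness holds because \<open>exp (- t X) F t\<close> has derivative \<open>0\<close>.  All exponentials below are computed by
  exhibiting a solution of the differential equation instead of summing a series.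
\<close>

lemma mexp_unique:
  fixes X :: "('i::finite) sqmat" and F :: "real \<Rightarrow> 'i sqmat"
  assumes "\<And>t. (F has_vector_derivative (X ** F t)) (at t)" and "F 0 = F0"
  shows "F t = mexp (t *\<^sub>R X) ** F0"
proof -
  have "((\<lambda>t. mexp (t *\<^sub>R (- X)) ** F t) has_vector_derivative 0) (at t)" for t
    using matrix_mult.has_vector_derivative[OF mexp_deriv_minus[of X t] assms(1)[of t]]
    by (simp add: matrix_mult.minus_left matrix_mul_assoc)
  from vector_derivative_zero_const[OF this, of t] have "mexp (t *\<^sub>R (- X)) ** F t = F0"
    by (simp add: assms(2))
  then have "mexp (t *\<^sub>R X) ** mexp (t *\<^sub>R (- X)) ** F t = mexp (t *\<^sub>R X) ** F0"
    by (metis matrix_mul_assoc)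
  then show ?thesis
    using mexp_inverse_left[of t "- X"] by simp
qed

lemma mexp_add:
  fixes X :: "('i::finite) sqmat"
  shows "mexp ((s + t) *\<^sub>R X) = mexp (s *\<^sub>R X) ** mexp (t *\<^sub>R X)"
proof -
  have "((\<lambda>s. mexp ((s + t) *\<^sub>R X)) has_vector_derivative (X ** mexp ((s + t) *\<^sub>R X))) (at s)" for s
  proof -
    have "((\<lambda>s. s + t) has_vector_derivative 1) (at s)"
      by (auto intro!: derivative_eq_intros)
    from vector_diff_chain_at[OF this mexp_deriv] show ?thesis by (simp add: o_def)
  qed
  from mexp_unique[OF this refl, of s] show ?thesis by simp
qed

lemma mexp_conj:
  fixes X A B :: "('i::finite) sqmat"
  assumes "B ** A = mat 1"
  shows "mexp (t *\<^sub>R (A ** X ** B)) = A ** mexp (t *\<^sub>R X) ** B"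
proof -
  let ?F = "\<lambda>t. A ** mexp (t *\<^sub>R X) ** B"
  have AB: "A ** B = mat 1" using assms matrix_left_right_inverse by blast
  have "(?F has_vector_derivative ((A ** X ** B) ** ?F t)) (at t)" for t
  proof -
    have "(?F has_vector_derivative (A ** (X ** mexp (t *\<^sub>R X)) ** B)) (at t)"
      by (intro bounded_linear.has_vector_derivative[OF matrix_mult.bounded_linear_left]
          bounded_linear.has_vector_derivative[OF matrix_mult.bounded_linear_right] mexp_deriv)
    moreover have "(A ** X ** B) ** ?F t = A ** X ** (B ** A) ** mexp (t *\<^sub>R X) ** B"
      by (simp only: matrix_mul_assoc)
    ultimately show ?thesis by (simp add: assms matrix_mul_assoc)
  qed
  from mexp_unique[OF this refl, of t] show ?thesis by (simp add: AB)
qed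

section \<open>The orthogonal group and its Lie algebra\<close>

lemma Emat_nth [simp]: "Emat a b $ i $ j = (if i = a \<and> j = b then 1 else 0)"
  by (simp add: Emat_def)

lemma Emat_mult [simp]: "Emat a b ** Emat c d = (if b = c then Emat a d else 0)"
proof -
  have "(Emat a b ** Emat c d) $ i $ j = (if b = c then Emat a d else 0) $ i $ j" for i j
  proof -
    have "(Emat a b ** Emat c d) $ i $ j = (\<Sum>k\<in>UNIV. Emat a b $ i $ k * Emat c d $ k $ j)"
      by (simp only: matrix_matrix_mult_def vec_lambda_beta)
    also have "\<dots> = (\<Sum>k\<in>UNIV. if k = b then Emat a b $ i $ b * Emat c d $ b $ j else 0)"
      by (intro sum.cong refl) simp
    also have "\<dots> = Emat a b $ i $ b * Emat c d $ b $ j" by simp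
    finally show ?thesis by simp
  qed
  then show ?thesis unfolding vec_eq_iff by blast
qed

lemma Emat_transpose [simp]: "transpose (Emat a b) = Emat b a"
  by (auto simp: vec_eq_iff transpose_def)

lemma bounded_linear_transpose: "bounded_linear (transpose :: 'i::finite sqmat \<Rightarrow> 'i sqmat)"
  by (intro linear_conv_bounded_linear[THEN iffD1] linearI) (auto simp: vec_eq_iff transpose_def)

lemmas tr_simps = linear_add[OF bounded_linear.linear[OF bounded_linear_transpose]] linear_diff[OF bounded_linear.linear[OF bounded_linear_transpose]]
  linear_cmul[OF bounded_linear.linear[OF bounded_linear_transpose]] linear_neg[OF bounded_linear.linear[OF bounded_linear_transpose]]
  linear_0[OF bounded_linear.linear[OF bounded_linear_transpose]]

lemmas mat_simps = matrix_mult.add_left matrix_mult.add_right matrix_mult.diff_left matrix_mult.diff_right matrix_mult.minus_left matrix_mult.minus_right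
  matrix_mult.scaleR_left matrix_mult.scaleR_right matrix_mult.zero_left matrix_mult.zero_right tr_simps

definition sg :: "'j idx \<Rightarrow> real" where
  "sg a = (if a = I1 \<or> a = I2 then -1 else 1)"

text \<open>
  The Gram matrix of the quadratic form.
\<close>

definition Smat :: "('j::finite) gmat" where
  "Smat = (\<chi> a b. if a = b then sg a else 0)"

lemma sg_square [simp]: "sg a * sg a = 1" "sg a * (sg a * x) = x"
  by (auto simp: sg_def)

lemma Smat_mult_nth: "(Smat ** X) $ i $ j = sg i * X $ i $ j"
  and mult_Smat_nth: "(X ** Smat) $ i $ j = sg j * X $ i $ j"
proof -
  show "(Smat ** X) $ i $ j = sg i * X $ i $ j"
    by (simp add: matrix_matrix_mult_def Smat_def if_distrib [of "\<lambda>x. x * _"] cong: if_cong)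
  have "(X ** Smat) $ i $ j = (\<Sum>k\<in>UNIV. if k = j then X $ i $ j * sg j else 0)"
    by (simp add: matrix_matrix_mult_def Smat_def if_distrib [of "\<lambda>x. _ * x"] cong: if_cong)
  then show "(X ** Smat) $ i $ j = sg j * X $ i $ j" by simp
qed

lemma Smat_Emat [simp]: "Smat ** Emat a b = sg a *\<^sub>R Emat a b" "Emat a b ** Smat = sg b *\<^sub>R Emat a b"
  by (auto simp: vec_eq_iff Smat_mult_nth mult_Smat_nth)

lemma Smat_square [simp]: "Smat ** Smat = (mat 1 :: ('j::finite) gmat)"
  by (auto simp: vec_eq_iff Smat_mult_nth mat_def) (auto simp: Smat_def)

lemma transpose_Smat [simp]: "transpose Smat = Smat"
  by (auto simp: vec_eq_iff transpose_def Smat_def)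

text \<open>
  The linearization at the identity of the equation in \<open>O2_iff\<close>, that is, the Lie algebra of the group.
\<close>

definition o2 :: "('j::finite) gmat set" where
  "o2 = {X. transpose X ** Smat + Smat ** X = 0}"

lemma UNIV_idx: "(UNIV :: 'j idx set) = insert I1 (insert I2 (insert I3 (insert I4 (range Ix))))"
proof -
  have "x \<in> {I1, I2, I3, I4} \<union> range Ix" for x :: "'j idx" by (cases x) auto
  then show ?thesis by blast
qed

lemma sum_idx:
  "sum f (UNIV :: ('j::finite) idx set) = f I1 + (f I2 + (f I3 + (f I4 + (\<Sum>j\<in>UNIV. f (Ix j)))))"
proof -
  have "inj (Ix :: 'j \<Rightarrow> _)" by (auto intro: injI)
  from sum.reindex[OF this, of f] have "sum f (range Ix) = (\<Sum>j\<in>UNIV. f (Ix j))" by (simp add: o_def)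
  then show ?thesis by (subst UNIV_idx) (simp add: image_iff)
qed

lemma qform_Smat: "qform v = v \<bullet> (Smat *v v)"
proof -
  have "(Smat *v v) $ i = sg i * v $ i" for i
    by (simp add: matrix_vector_mult_def Smat_def if_distrib [of "\<lambda>x. x * _"] cong: if_cong)
  then have "v \<bullet> (Smat *v v) = (\<Sum>i\<in>UNIV. sg i * (v $ i)\<^sup>2)"
    by (simp add: inner_vec_def power2_eq_square mult_ac)
  then show ?thesis by (simp add: qform_def sum_idx sg_def)
qed

text \<open>
  Polarization.  It turns the invariance of the quadratic form into an equation between matrices.
\<close>

lemma quadratic_form_zero:
  fixes C :: "('i::finite) sqmat"
  assumes sym: "transpose C = C" and z: "\<And>v. v \<bullet> (C *v v) = 0"
  shows "C = 0"
proof -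
  have e: "axis i 1 \<bullet> (C *v axis j 1) = C $ i $ j" for i j
    by (simp add: inner_axis' matrix_vector_mult_basis column_def)
  have "C $ i $ j = 0" for i j
  proof -
    have "transpose C $ j $ i = C $ j $ i" by (simp only: sym)
    then have "C $ i $ j = C $ j $ i" by (simp add: transpose_def)
    moreover have "C $ i $ i + C $ i $ j + (C $ j $ i + C $ j $ j) = 0"
      using z[of "axis i 1 + axis j 1"]
      by (simp add: matrix_vector_right_distrib inner_add_left inner_add_right e)
    moreover have "C $ i $ i = 0" for i using z[of "axis i 1"] by (simp add: e)
    ultimately show ?thesis by simp
  qed
  then show ?thesis by (simp add: vec_eq_iff)
qed

lemma O2_iff: "g \<in> O2 \<longleftrightarrow> transpose g ** Smat ** g = (Smat :: ('j::finite) gmat)"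
proof -
  have q: "qform (g *v v) = v \<bullet> ((transpose g ** Smat ** g) *v v)" for v
    using dot_lmul_matrix[of v "transpose g" "Smat *v (g *v v)"]
    by (simp add: qform_Smat matrix_vector_mul_assoc vector_transpose_matrix matrix_mul_assoc)
  show ?thesis
  proof
    assume "g \<in> O2"
    let ?C = "transpose g ** Smat ** g - Smat"
    have "?C = 0"
    proof (rule quadratic_form_zero)
      show "transpose ?C = ?C" by (simp add: tr_simps matrix_transpose_mul matrix_mul_assoc)
      show "v \<bullet> (?C *v v) = 0" for v
        using \<open>g \<in> O2\<close> q[of v] unfolding O2_def qform_Smat
        by (simp add: matrix_vector_mult_diff_rdistrib inner_diff_right)
    qed
    then show "transpose g ** Smat ** g = Smat" by simp
  next
    assume "transpose g ** Smat ** g = Smat"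
    then show "g \<in> O2" by (simp add: O2_def q) (simp add: qform_Smat)
  qed
qed

lemma O2_mult: "g \<in> O2 \<Longrightarrow> h \<in> O2 \<Longrightarrow> g ** h \<in> O2"
  by (simp add: O2_def matrix_vector_mul_assoc[symmetric])

lemma O2_one: "mat 1 \<in> O2"
  by (simp add: O2_def)

lemma O2_left_inverse:
  assumes "g \<in> O2"
  shows "(Smat ** transpose g ** Smat) ** g = mat 1"
proof -
  have "(Smat ** transpose g ** Smat) ** g = Smat ** (transpose g ** Smat ** g)"
    by (simp only: matrix_mul_assoc)
  then show ?thesis using assms by (simp add: O2_iff)
qed

lemma O2_inverse:
  assumes "g \<in> O2" "h ** g = mat 1"
  shows "h \<in> O2"
proof -
  have gh: "g ** h = mat 1" using assms(2) matrix_left_right_inverse by blast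
  have "qform (h *v v) = qform (g *v (h *v v))" for v
    using assms(1) by (simp add: O2_def)
  then show ?thesis by (simp add: O2_def matrix_vector_mul_assoc gh)
qed

lemma O2_matrix_inv:
  assumes "g \<in> O2"
  shows "matrix_inv g ** g = mat 1" "g ** matrix_inv g = mat 1" "matrix_inv g \<in> O2"
proof -
  have "invertible g"
    using O2_left_inverse[OF assms] invertible_left_inverse by blast
  then have "g ** matrix_inv g = mat 1 \<and> matrix_inv g ** g = mat 1"
    unfolding matrix_inv_def invertible_def by (rule someI_ex)
  then show "matrix_inv g ** g = mat 1" "g ** matrix_inv g = mat 1"
    by simp_all
  then show "matrix_inv g \<in> O2" using O2_inverse[OF assms] by blast
qed

lemma group_O2: "group (O2_grp :: ('j::finite) gmat monoid)"
proof (rule groupI)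
  fix x :: "'j gmat" assume "x \<in> carrier O2_grp"
  then show "\<exists>y\<in>carrier O2_grp. y \<otimes>\<^bsub>O2_grp\<^esub> x = \<one>\<^bsub>O2_grp\<^esub>"
    using O2_matrix_inv[of x] by (auto simp: O2_grp_def)
qed (auto simp: O2_grp_def O2_mult O2_one matrix_mul_assoc)

text \<open>
  Along the curve, \<open>g\<^sup>T S g\<close> has derivative \<open>g\<^sup>T (X\<^sup>T S + S X) g = 0\<close>.
\<close>

lemma mexp_O2:
  assumes "X \<in> o2"
  shows "mexp (t *\<^sub>R X) \<in> O2"
proof -
  let ?f = "\<lambda>t. transpose (mexp (t *\<^sub>R X)) ** Smat ** mexp (t *\<^sub>R X)"
  have "(?f has_vector_derivative 0) (at t)" for t
  proof -
    let ?g = "mexp (t *\<^sub>R X)"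
    have "(?f has_vector_derivative ((transpose ?g ** Smat) ** (X ** ?g) + transpose (X ** ?g) ** Smat ** ?g)) (at t)"
      by (intro matrix_mult.has_vector_derivative mexp_deriv
          bounded_linear.has_vector_derivative[OF matrix_mult.bounded_linear_left]
          bounded_linear.has_vector_derivative[OF bounded_linear_transpose])
    also have "(transpose ?g ** Smat) ** (X ** ?g) + transpose (X ** ?g) ** Smat ** ?g
        = transpose ?g ** (transpose X ** Smat + Smat ** X) ** ?g"
      by (simp add: matrix_transpose_mul matrix_mult.add_left matrix_mult.add_right matrix_mul_assoc)
    finally show ?thesis using assms by (simp add: o2_def)
  qed
  from vector_derivative_zero_const[OF this, of t] show ?thesis
    by (simp add: O2_iff)
qed

lemma mexp_O2': "X \<in> o2 \<Longrightarrow> mexp X \<in> O2"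
  using mexp_O2[of X 1] by simp

lemma subspace_o2: "subspace o2"
proof -
  have "linear (\<lambda>X :: 'a gmat. transpose X ** Smat + Smat ** X)"
    by (rule linearI) (simp_all add: mat_simps algebra_simps)
  then show ?thesis unfolding o2_def by (rule linear_subspace_kernel)
qed

lemma linear_mbracket: "linear (mbracket X)" "linear (\<lambda>X. mbracket X Y)"
  by (rule linearI; simp add: mbracket_def mat_simps algebra_simps)+

section \<open>Root vectors and their brackets\<close>

text \<open>
  The coordinates other than \<open>I1\<close> and \<open>I4\<close> (the set \<open>dirs\<close> below) label the restricted roots: each
  contributes one lowering vector \<open>Yn\<close> and one raising vector \<open>Xn\<close>.  With the sign \<open>eps\<close> of the quadratic form
  on the coordinate, the matrices \<open>Q1m\<close>, \<open>Q2m\<close> and \<open>Ym j\<close> form a single family \<open>Yn a\<close>, and the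
  subalgebra \<open>\<mm>\<close> is spanned by the infinitesimal rotations \<open>Rot a b\<close> of the planes spanned by two such
  coordinates.
\<close>

definition eps :: "'j idx \<Rightarrow> real" where
  "eps a = (if a = I2 then -1 else 1)"

definition dirs :: "('j::finite) idx set" where
  "dirs = - {I1, I4}"

definition Yn :: "'j idx \<Rightarrow> ('j::finite) gmat" where
  "Yn a = Emat a I1 + Emat a I4 + eps a *\<^sub>R (Emat I1 a - Emat I4 a)"

definition Xn :: "'j idx \<Rightarrow> ('j::finite) gmat" where
  "Xn a = transpose (Yn a)"

definition Rot :: "'j idx \<Rightarrow> 'j idx \<Rightarrow> ('j::finite) gmat" where
  "Rot a b = eps b *\<^sub>R Emat a b - eps a *\<^sub>R Emat b a"

lemma Xn_eq: "Xn a = Emat I1 a + Emat I4 a + eps a *\<^sub>R (Emat a I1 - Emat a I4)"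
  by (simp add: Xn_def Yn_def mat_simps)

lemma eps_square [simp]: "eps a * eps a = 1" "eps a * (eps a * x) = x"
  by (auto simp: eps_def)

lemma dirs_eq: "(dirs :: ('j::finite) idx set) = insert I2 (insert I3 (range Ix))"
proof (rule Set.set_eqI)
  show "x \<in> dirs \<longleftrightarrow> x \<in> insert I2 (insert I3 (range Ix))" for x :: "'j idx"
    by (cases x) (auto simp: dirs_def)
qed

lemma sg_dirs: "a \<in> dirs \<Longrightarrow> sg a = eps a"
  by (auto simp: dirs_def sg_def eps_def)

lemma dirs_mem [simp]: "I2 \<in> dirs" "I3 \<in> dirs" "Ix j \<in> dirs" "I1 \<notin> dirs" "I4 \<notin> dirs"
  by (auto simp: dirs_def)

lemma dirs_neq [simp]: "a \<in> dirs \<Longrightarrow> a \<noteq> I1" "a \<in> dirs \<Longrightarrow> a \<noteq> I4" "a \<in> dirs \<Longrightarrow> I1 \<noteq> a" "a \<in> dirs \<Longrightarrow> I4 \<noteq> a"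
  by (auto simp: dirs_def)

lemma o2_Hmat: "Hmat \<in> o2"
  by (simp add: o2_def Hmat_def mat_simps sg_def)

lemma o2_Yn: "a \<in> dirs \<Longrightarrow> Yn a \<in> o2"
  by (simp add: o2_def Yn_def mat_simps sg_dirs) (simp add: sg_def algebra_simps)

lemma o2_transpose: "X \<in> o2 \<Longrightarrow> transpose X \<in> o2"
proof -
  assume "X \<in> o2"
  then have "Smat ** (transpose X ** Smat + Smat ** X) ** Smat = 0" by (simp add: o2_def)
  then have "Smat ** transpose X ** (Smat ** Smat) + (Smat ** Smat) ** X ** Smat = 0"
    by (simp only: mat_simps matrix_mul_assoc)
  then show ?thesis by (simp add: o2_def add.commute)
qed

lemma o2_Xn: "a \<in> dirs \<Longrightarrow> Xn a \<in> o2"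
  by (simp add: Xn_def o2_transpose o2_Yn)

lemma o2_Rot: "a \<in> dirs \<Longrightarrow> b \<in> dirs \<Longrightarrow> Rot a b \<in> o2"
  by (simp add: o2_def Rot_def mat_simps sg_dirs algebra_simps)

lemma br_H_Yn: "a \<in> dirs \<Longrightarrow> mbracket Hmat (Yn a) = - Yn a"
  by (simp add: mbracket_def Hmat_def Yn_def mat_simps algebra_simps)

lemma br_Yn_Yn: "a \<in> dirs \<Longrightarrow> b \<in> dirs \<Longrightarrow> mbracket (Yn a) (Yn b) = 0"
  by (cases "a = b") (simp_all add: mbracket_def Yn_def mat_simps algebra_simps)

text \<open>
  The source of all commutators below: opposite root vectors have their bracket in \<open>\<aa>\<close> if they belong
  to the same coordinate, and in \<open>\<mm>\<close> otherwise.
\<close>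

lemma br_Xn_Yn: "a \<in> dirs \<Longrightarrow> b \<in> dirs \<Longrightarrow>
    mbracket (Xn a) (Yn b) = (if a = b then 2 *\<^sub>R Hmat else (2 * eps a) *\<^sub>R Rot a b)"
proof (cases "a = b")
  case True
  then show "a \<in> dirs \<Longrightarrow> b \<in> dirs \<Longrightarrow> ?thesis"
    by (simp add: mbracket_def Yn_def Xn_eq Hmat_def mat_simps algebra_simps scaleR_2)
next
  case False
  show ?thesis if "a \<in> dirs" "b \<in> dirs"
  proof -
    have "mbracket (Xn a) (Yn b) = (eps a * eps b) *\<^sub>R (Emat a b + Emat a b) - (Emat b a + Emat b a)"
      using that False by (simp add: mbracket_def Yn_def Xn_eq mat_simps scaleR_add_right scaleR_diff_right)
    also have "\<dots> = (2 * eps a) *\<^sub>R Rot a b"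
      by (simp add: Rot_def scaleR_diff_right mult_ac flip: scaleR_2)
    finally show ?thesis using False by simp
  qed
qed

text \<open>
  The lowering vectors transform under \<open>\<mm>\<close> like the coordinate vectors that label them.
\<close>

lemma br_Rot_Yn: "a \<in> dirs \<Longrightarrow> b \<in> dirs \<Longrightarrow> c \<in> dirs \<Longrightarrow>
    mbracket (Rot a b) (Yn c) = (if c = b then eps b *\<^sub>R Yn a else 0) - (if c = a then eps a *\<^sub>R Yn b else 0)"
  by (cases "c = a"; cases "c = b") (simp_all add: mbracket_def Yn_def Rot_def mat_simps algebra_simps)

lemma Rot_self [simp]: "Rot a a = 0" by (simp add: Rot_def)

lemma Yn_simps: "Yn I2 = Q1m" "Yn I3 = Q2m" "Yn (Ix j) = Ym j"
  by (simp_all add: Yn_def Q1m_def Q2m_def Ym_def eps_def algebra_simps)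

lemma lie_n_minus_eq: "lie_n_minus = span (Yn ` dirs)"
  unfolding lie_n_minus_def
  by (rule arg_cong[where f = span]) (simp add: dirs_eq Yn_simps image_image)

lemma lie_n_plus_eq: "lie_n_plus = span (Xn ` dirs)"
  unfolding lie_n_plus_def
  by (rule arg_cong[where f = span])
    (simp add: dirs_eq Yn_simps image_image Xn_def Q1p_def Q2p_def Yp_def)

text \<open>
  The generators \<open>Zp j\<close> and \<open>Zm j\<close> are the sum and the difference of the rotations of the planes
  \<open>(I2, Ix j)\<close> and \<open>(I3, Ix j)\<close>, so both of these rotations can be recovered from them.
\<close>

lemma lie_m_eq: "(lie_m :: ('j::finite) gmat set) = span {Rot a b | a b. a \<in> dirs \<and> b \<in> dirs}" (is "?L = span ?R")
proof
  have R: "Rot a b \<in> span ?R" if "a \<in> dirs" "b \<in> dirs" for a b :: "'j idx" using that by (auto intro: span_base)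
  have d: "I2 \<in> dirs" "I3 \<in> dirs" "Ix j \<in> dirs" for j :: 'j by simp_all
  have H: "(H2 :: 'j gmat) = Rot I2 I3" by (simp add: H2_def Rot_def eps_def)
  have Zp: "Zp j = Rot I2 (Ix j) + Rot I3 (Ix j)" for j :: 'j by (simp add: Zp_def Rot_def eps_def)
  have Zm: "Zm j = Rot I2 (Ix j) - Rot I3 (Ix j)" for j :: 'j
    by (simp add: Zm_def Zp_def Rot_def eps_def mat_simps)
  have Mr: "Mrot i j = Rot (Ix i) (Ix j)" for i j :: 'j by (simp add: Mrot_def Rot_def eps_def)
  have gens: "{H2} \<union> range Zp \<union> range Zm \<union> {Mrot i j | i j. True} \<subseteq> span ?R"
    unfolding H Zp Zm Mr using R d by (auto intro!: span_add span_diff)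
  have "H2 \<in> ?L" "Zp j \<in> ?L" "Zm j \<in> ?L" "Mrot i j \<in> ?L" for i j :: 'j
    unfolding lie_m_def by (auto intro!: span_base)
  then have "Rot I2 I3 \<in> ?L"
    and M: "\<And>i j. Rot (Ix i) (Ix j) \<in> ?L"
    and P: "\<And>j. Rot I2 (Ix j) + Rot I3 (Ix j) \<in> ?L"
    and Q: "\<And>j. Rot I2 (Ix j) - Rot I3 (Ix j) \<in> ?L"
    by (simp_all only: H Zp Zm Mr)
  show "?L \<subseteq> span ?R" unfolding lie_m_def by (rule span_minimal[OF gens subspace_span])
  have sub: "subspace ?L" by (simp add: lie_m_def)
  have anti: "Rot b a = - Rot a b" for a b :: "'j idx" by (simp add: Rot_def)
  have A: "Rot I2 (Ix j) \<in> ?L" for j :: 'j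
  proof -
    have "Rot I2 (Ix j) = (1 / 2) *\<^sub>R ((Rot I2 (Ix j) + Rot I3 (Ix j)) + (Rot I2 (Ix j) - Rot I3 (Ix j)))"
      by (simp flip: scaleR_2)
    then show ?thesis using subspace_scale[OF sub subspace_add[OF sub P Q]] by metis
  qed
  have B: "Rot I3 (Ix j) \<in> ?L" for j :: 'j
    using subspace_diff[OF sub P A, of j j] by simp
  have half: "Rot b a \<in> ?L" if "Rot a b \<in> ?L" for a b :: "'j idx"
    using subspace_neg[OF sub that] by (simp add: anti[of b a])
  have "Rot a b \<in> ?L" if "a \<in> dirs" "b \<in> dirs" for a b :: "'j idx"
    using that A B M \<open>Rot I2 I3 \<in> ?L\<close> subspace_0[OF sub]
      half[OF A] half[OF B] half[OF \<open>Rot I2 I3 \<in> ?L\<close>]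
    unfolding dirs_eq by (elim insertE imageE; simp)
  then have "?R \<subseteq> ?L" by blast
  then show "span ?R \<subseteq> ?L" by (rule span_minimal[OF _ sub])
qed

lemma lie_m_o2: "lie_m \<subseteq> o2"
  unfolding lie_m_eq by (rule span_minimal[OF _ subspace_o2]) (auto intro: o2_Rot)

lemma lie_n_plus_o2: "lie_n_plus \<subseteq> o2"
  unfolding lie_n_plus_eq by (rule span_minimal[OF _ subspace_o2]) (auto intro: o2_Xn)

lemma lie_n_minus_o2: "lie_n_minus \<subseteq> o2"
  unfolding lie_n_minus_eq by (rule span_minimal[OF _ subspace_o2]) (auto intro: o2_Yn)

lemma lie_n_minus_abelian:
  assumes "X \<in> lie_n_minus" "Y \<in> lie_n_minus"
  shows "mbracket X Y = 0"
proof -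
  have 1: "mbracket (Yn a) Y = 0" if "a \<in> dirs" for a
  proof -
    have "span (Yn ` dirs) \<subseteq> {Y. mbracket (Yn a) Y = 0}"
      by (intro span_minimal linear_subspace_kernel[OF linear_mbracket(1)])
        (use that in \<open>auto simp: br_Yn_Yn\<close>)
    then show ?thesis using assms(2) by (auto simp: lie_n_minus_eq)
  qed
  have "span (Yn ` dirs) \<subseteq> {X. mbracket X Y = 0}"
    by (intro span_minimal linear_subspace_kernel[OF linear_mbracket(2)]) (use 1 in auto)
  then show ?thesis using assms(1) by (auto simp: lie_n_minus_eq)
qed

section \<open>The embedding of the smaller group\<close>

text \<open>
  The embedding of groups is an affine map; this is its linear part, the embedding of Lie algebras.
\<close>

definition embL :: "('j::finite) gmat \<Rightarrow> ('j option) gmat" where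
  "embL g = (\<chi> a b. if a = Ix None \<or> b = Ix None then 0 else g $ (map_idx the a) $ (map_idx the b))"

abbreviation up :: "'j idx \<Rightarrow> 'j option idx" where
  "up \<equiv> map_idx Some"

lemma the_up [simp]: "map_idx the (up a) = a"
  by (simp add: idx.map_comp o_def idx.map_ident)

lemma up_eq_iff [simp]: "up a = up b \<longleftrightarrow> a = b"
  by (metis the_up)

lemma up_None [simp]: "up a \<noteq> Ix None" "Ix None \<noteq> up a"
  by (cases a; simp)+

lemma idx_option_cases:
  obtains (None) "a = Ix None" | (up) b where "a = up b"
proof (cases a)
  case (Ix j)
  then show ?thesis by (cases j) (auto intro: that(1) that(2)[of "Ix _"])
qed (auto intro: that(2)[of I1] that(2)[of I2] that(2)[of I3] that(2)[of I4])

lemma UNIV_idx_option: "(UNIV :: ('j::finite) option idx set) = insert (Ix None) (range up)"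
proof -
  have "x \<in> insert (Ix None) (range up)" for x :: "'j option idx"
    by (rule idx_option_cases[of x]) auto
  then show ?thesis by blast
qed

lemma sum_idx_option:
  "sum f (UNIV :: ('j::finite) option idx set) = f (Ix None) + (\<Sum>a\<in>UNIV. f (up a))"
proof -
  have "sum f (range (up :: 'j idx \<Rightarrow> _)) = (\<Sum>a\<in>UNIV. f (up a))"
    by (subst sum.reindex) (auto simp: inj_def)
  then show ?thesis by (subst UNIV_idx_option) (simp add: image_iff)
qed

text \<open>
  A matrix over the larger index type consists of the block over the smaller type, a last row, a last
  column and a corner entry.  Equations that involve the embedding are checked block by block.
\<close>

lemma mat_option_eqI:
  fixes A B :: "('j::finite) option gmat"
  assumes "A $ Ix None $ Ix None = B $ Ix None $ Ix None"
    and "\<And>a. A $ up a $ Ix None = B $ up a $ Ix None" "\<And>a. A $ Ix None $ up a = B $ Ix None $ up a"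
    and "\<And>a b. A $ up a $ up b = B $ up a $ up b"
  shows "A = B"
proof -
  have "A $ i $ j = B $ i $ j" for i j
    using assms by (cases i rule: idx_option_cases; cases j rule: idx_option_cases) auto
  then show ?thesis by (simp add: vec_eq_iff)
qed

lemma emb_nth [simp]:
  "emb g $ Ix None $ Ix None = 1" "emb g $ up a $ Ix None = 0" "emb g $ Ix None $ up a = 0"
  "emb g $ up a $ up b = g $ a $ b"
  by (simp_all add: emb_def)

lemma embL_nth [simp]:
  "embL g $ Ix None $ Ix None = 0" "embL g $ up a $ Ix None = 0" "embL g $ Ix None $ up a = 0"
  "embL g $ up a $ up b = g $ a $ b"
  by (simp_all add: embL_def)

lemma emb_eq: "emb g = embL g + Emat (Ix None) (Ix None)"
  by (rule mat_option_eqI) auto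

lemma emb_mult: "emb (g ** h) = emb g ** emb h"
  by (rule mat_option_eqI) (simp_all add: matrix_matrix_mult_def sum_idx_option)

lemma emb_one [simp]: "emb (mat 1) = mat 1"
  by (rule mat_option_eqI) (simp_all add: mat_def)

lemma emb_Smat [simp]: "emb Smat = Smat"
proof -
  have "sg (up a) = sg a" for a :: "'a idx" by (cases a) (auto simp: sg_def)
  then show ?thesis by (intro mat_option_eqI) (auto simp: Smat_def sg_def)
qed

lemma emb_transpose: "emb (transpose g) = transpose (emb g)"
  by (rule mat_option_eqI) (simp_all add: transpose_def)

lemma emb_O2: "g \<in> O2 \<Longrightarrow> emb g \<in> O2"
  unfolding O2_iff by (metis emb_Smat emb_mult emb_transpose)

lemma embL_mult: "embL (X ** Y) = embL X ** emb Y"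
  by (rule mat_option_eqI) (simp_all add: matrix_matrix_mult_def sum_idx_option)

lemma bounded_linear_embL: "bounded_linear embL"
  by (intro linear_conv_bounded_linear[THEN iffD1] linearI; rule mat_option_eqI) auto

text \<open>
  Both sides solve the same differential equation, because the linear part of the embedding annihilates
  the corner entry.
\<close>

lemma emb_mexp: "emb (mexp (t *\<^sub>R X)) = mexp (t *\<^sub>R embL X)"
proof -
  have "((\<lambda>t. emb (mexp (t *\<^sub>R X))) has_vector_derivative (embL X ** emb (mexp (t *\<^sub>R X)))) (at t)" for t
  proof -
    have "((\<lambda>t. embL (mexp (t *\<^sub>R X)) + Emat (Ix None) (Ix None)) has_vector_derivative
        embL (X ** mexp (t *\<^sub>R X)) + 0) (at t)"
      by (intro has_vector_derivative_add has_vector_derivative_const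
          bounded_linear.has_vector_derivative[OF bounded_linear_embL] mexp_deriv)
    then show ?thesis by (simp only: emb_eq[symmetric] embL_mult add_0_right)
  qed
  from mexp_unique[OF this refl, of t] show ?thesis by simp
qed

lemma emb_mexp': "emb (mexp X) = mexp (embL X)"
  using emb_mexp[of 1 X] by simp

lemma embL_Emat [simp]: "embL (Emat a b) = Emat (up a) (up b)"
  by (rule mat_option_eqI) auto

lemma linear_embL: "linear embL"
  using bounded_linear_embL by (rule bounded_linear.linear)

lemmas embL_simps = linear_add[OF linear_embL] linear_diff[OF linear_embL] linear_cmul[OF linear_embL]

lemma eps_up [simp]: "eps (up a) = eps a"
  by (cases a) (auto simp: eps_def)

lemma up_dirs [simp]: "up a \<in> dirs \<longleftrightarrow> a \<in> dirs"
  by (cases a) simp_all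

lemma embL_Hmat: "embL Hmat = Hmat"
  by (simp add: Hmat_def embL_simps)

lemma embL_Xn: "embL (Xn a) = Xn (up a)"
  by (simp add: Xn_eq embL_simps)

lemma embL_Rot: "embL (Rot a b) = Rot (up a) (up b)"
  by (simp add: Rot_def embL_simps)

section \<open>Exponentials of particular elements\<close>

text \<open>
  The closed form rests on \<open>H\<^sup>3 = H\<close>.
\<close>

lemma mexp_Hmat: "mexp (t *\<^sub>R Hmat) = mat 1 + sinh t *\<^sub>R Hmat + (cosh t - 1) *\<^sub>R (Hmat ** Hmat)"
proof -
  let ?F = "\<lambda>t. mat 1 + sinh t *\<^sub>R Hmat + (cosh t - 1) *\<^sub>R (Hmat ** Hmat) :: 'a gmat"
  have cube: "Hmat ** (Hmat ** Hmat) = (Hmat :: 'a gmat)" by (simp add: Hmat_def mat_simps)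
  have "(?F has_vector_derivative (Hmat ** ?F t)) (at t)" for t
    by (auto intro!: derivative_eq_intros simp: mat_simps cube has_real_derivative_iff_has_vector_derivative[symmetric] algebra_simps)
  from mexp_unique[OF this refl, of t] show ?thesis by simp
qed

lemma mexp_Hmat_entry: "(mexp (t *\<^sub>R Hmat) :: ('j::finite) gmat) $ I1 $ I4 = sinh t"
  unfolding mexp_Hmat by (simp add: Hmat_def mat_simps mat_def)

lemma mexp_Hmat_inj: "mexp (s *\<^sub>R Hmat) = (mexp (t *\<^sub>R Hmat) :: ('j::finite) gmat) \<longleftrightarrow> s = t"
  by (metis mexp_Hmat_entry sinh_real_eq_iff)

lemma xi_mexp: "xi lam (mexp (t *\<^sub>R Hmat)) = exp (lam * of_real t)"
  by (simp add: xi_def mexp_Hmat_inj)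

text \<open>
  A half turn.  A plane of mixed signature would lead to hyperbolic functions instead.
\<close>

lemma mexp_Rot_pi:
  assumes "a \<noteq> b" "eps a = 1" "eps b = 1"
  shows "mexp (pi *\<^sub>R Rot a b) = mat 1 - 2 *\<^sub>R (Emat a a + Emat b b)"
proof -
  let ?R = "Rot a b :: 'a gmat"
  let ?F = "\<lambda>t. mat 1 + sin t *\<^sub>R ?R + (1 - cos t) *\<^sub>R (?R ** ?R)"
  have sq: "?R ** ?R = - (Emat a a + Emat b b)" using assms by (simp add: Rot_def mat_simps)
  \<comment> \<open>so the exponential series is that of a rotation: \<open>1 + sin t R + (1 - cos t) R\<^sup>2\<close>\<close>
  have cube: "?R ** (?R ** ?R) = - ?R" unfolding sq using assms by (simp add: Rot_def mat_simps)
  have "(?F has_vector_derivative (?R ** ?F t)) (at t)" for t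
    by (auto intro!: derivative_eq_intros simp: mat_simps cube has_real_derivative_iff_has_vector_derivative[symmetric] algebra_simps)
  from mexp_unique[OF this refl, of pi]
  have "mexp (pi *\<^sub>R ?R) = mat 1 + 2 *\<^sub>R (?R ** ?R)" by simp
  then show ?thesis unfolding sq by (simp only: scaleR_minus_right add_uminus_conv_diff)
qed

text \<open>
  The embedded \<open>J\<close> of the smaller group is \<open>J\<close> of the larger group times the reflection in the last
  coordinate, and this reflection is \<open>w2\<close> followed by a half turn of the plane of \<open>I3\<close> and the last
  coordinate.  So it belongs to \<open>M\<close> of the larger group, and functions induced from the trivial character
  are invariant under it.
\<close>

lemma emb_Jmat: "emb (Jmat :: ('j::finite) gmat) = Jmat ** (w2 ** mexp (pi *\<^sub>R Rot I3 (Ix None)))"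
proof -
  have [simp]: "eps I3 = 1" "eps (Ix j) = 1" for j :: "'j option" by (auto simp: eps_def)
  have w2: "(w2 :: 'j option gmat) = mat 1 - 2 *\<^sub>R Emat I3 I3" by (auto simp: vec_eq_iff w2_def mat_def)
  have J: "emb (Jmat :: 'j gmat) = 2 *\<^sub>R Emat (Ix None) (Ix None) - mat 1"
    by (rule mat_option_eqI) (auto simp: Jmat_def mat_def)
  show ?thesis
  proof -
    let ?E = "Emat I3 I3 :: 'j option gmat" and ?F = "Emat (Ix None) (Ix None) :: 'j option gmat"
    have "(mat 1 - 2 *\<^sub>R ?E) ** (mat 1 - 2 *\<^sub>R (?E + ?F)) = mat 1 - 2 *\<^sub>R ?F"
      by (simp add: mat_simps) (simp add: vec_eq_iff)
    then show ?thesis unfolding J w2 by (simp add: mexp_Rot_pi Jmat_def matrix_mult.minus_left)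
  qed
qed

lemma up_eq_base [simp]: "up a = I2 \<longleftrightarrow> a = I2" "up a = I3 \<longleftrightarrow> a = I3"
  by (cases a; simp)+

lemma emb_w1: "emb w1 = w1"
  by (rule mat_option_eqI) (auto simp: w1_def)

lemma emb_w2: "emb w2 = w2"
  by (rule mat_option_eqI) (auto simp: w2_def)

section \<open>Calculus of \<open>C\<^sup>k\<close> functions\<close>

text \<open>
  For an open set the derivatives are determined by the values on the set.
\<close>

lemma Ck_on_cong:
  assumes "open S" "\<And>x. x \<in> S \<Longrightarrow> f x = g x" "Ck_on k S f"
  shows "Ck_on k S g"
  using assms(2,3)
proof (induction k arbitrary: f g)
  case 0
  then show ?case by (simp cong: continuous_on_cong)
next
  case (Suc k)
  let ?f' = "\<lambda>x. frechet_derivative f (at x)"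
  have d: "(g has_derivative ?f' x) (at x)" if x: "x \<in> S" for x
  proof -
    have "(f has_derivative ?f' x) (at x)"
      using Suc.prems(2) x frechet_derivative_works by auto
    then show ?thesis
      by (rule has_derivative_transform_within_open[OF _ \<open>open S\<close> x]) (rule Suc.prems(1))
  qed
  have "Ck_on k S (\<lambda>x. frechet_derivative g (at x) v)" for v
    by (rule Suc.IH[of "\<lambda>x. ?f' x v"]) (use Suc.prems(2) frechet_derivative_at[OF d] in auto)
  then show ?case using d by (auto simp: differentiable_def)
qed

lemma Ck_on_derivI:
  assumes "open S" and f': "\<And>x. x \<in> S \<Longrightarrow> (f has_derivative f' x) (at x)"
    and "\<And>v. Ck_on k S (\<lambda>x. f' x v)"
  shows "Ck_on (Suc k) S f"
proof -
  have "Ck_on k S (\<lambda>x. frechet_derivative f (at x) v)" for v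
    by (rule Ck_on_cong[OF \<open>open S\<close> _ assms(3)[of v]]) (simp add: frechet_derivative_at[OF f', symmetric])
  then show ?thesis using f' by (auto simp: differentiable_def)
qed

lemma Ck_on_has_derivative:
  assumes "Ck_on (Suc k) S f" "x \<in> S"
  shows "(f has_derivative frechet_derivative f (at x)) (at x)"
  using assms frechet_derivative_works by auto

lemma Ck_on_frechet: "Ck_on (Suc k) S f \<Longrightarrow> Ck_on k S (\<lambda>x. frechet_derivative f (at x) v)"
  by simp

declare Ck_on.simps(2) [simp del]

lemma Ck_on_Suc_imp: "Ck_on (Suc k) S f \<Longrightarrow> Ck_on k S f"
proof (induction k arbitrary: f)
  case 0
  then show ?case
    by (auto intro!: continuous_at_imp_continuous_on has_derivative_continuous dest: Ck_on_has_derivative)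
next
  case (Suc k)
  show ?case unfolding Ck_on.simps(2)[of k]
    using Suc.IH[OF Ck_on_frechet[OF Suc.prems]] Suc.prems by (simp add: Ck_on.simps(2)[of "Suc k"])
qed

lemma Ck_on_subset: "Ck_on k S f \<Longrightarrow> T \<subseteq> S \<Longrightarrow> Ck_on k T f"
  by (induction k arbitrary: f) (auto simp: Ck_on.simps(2) intro: continuous_on_subset)

lemma Ck_on_const: "open S \<Longrightarrow> Ck_on k S (\<lambda>x. c)"
proof (induction k arbitrary: c)
  case (Suc k)
  then show ?case by (intro Ck_on_derivI[where f' = "\<lambda>_ _. 0"]) auto
qed simp

lemma Ck_on_add:
  assumes "open S"
  shows "Ck_on k S f \<Longrightarrow> Ck_on k S g \<Longrightarrow> Ck_on k S (\<lambda>x. f x + g x)"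
proof (induction k arbitrary: f g)
  case (Suc k)
  let ?f' = "\<lambda>x. frechet_derivative f (at x)" and ?g' = "\<lambda>x. frechet_derivative g (at x)"
  show ?case
  proof (rule Ck_on_derivI[where f' = "\<lambda>x v. ?f' x v + ?g' x v"])
    show "((\<lambda>x. f x + g x) has_derivative (\<lambda>v. ?f' x v + ?g' x v)) (at x)" if "x \<in> S" for x
      using Suc.prems that by (intro has_derivative_add Ck_on_has_derivative)
  qed (intro assms Suc.IH Ck_on_frechet Suc.prems)+
qed (simp add: continuous_on_add)

lemma Ck_on_sum:
  assumes "open S" "\<And>i. i \<in> I \<Longrightarrow> Ck_on k S (f i)"
  shows "Ck_on k S (\<lambda>x. \<Sum>i\<in>I. f i x)"
  using assms(2)
  by (induction I rule: infinite_finite_induct) (auto intro: Ck_on_const Ck_on_add assms(1))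

lemma Ck_on_bounded_linear:
  assumes "open S" "bounded_linear L"
  shows "Ck_on k S f \<Longrightarrow> Ck_on k S (\<lambda>x. L (f x))"
proof (induction k arbitrary: f)
  case 0
  then show ?case using bounded_linear.continuous_on[OF assms(2)] by simp
next
  case (Suc k)
  let ?f' = "\<lambda>x. frechet_derivative f (at x)"
  show ?case
  proof (rule Ck_on_derivI[where f' = "\<lambda>x v. L (?f' x v)"])
    show "((\<lambda>x. L (f x)) has_derivative (\<lambda>v. L (?f' x v))) (at x)" if "x \<in> S" for x
      using Suc.prems that by (intro bounded_linear.has_derivative[OF assms(2)] Ck_on_has_derivative)
  qed (intro assms Suc.IH Ck_on_frechet Suc.prems)+
qed

text \<open>
  The products that occur are of this kind, because the vector field \<open>y \<mapsto> y X\<close> depends linearly on \<open>y\<close>.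
\<close>

lemma Ck_on_scaleR_linear:
  assumes "open S" and l: "bounded_linear l"
  shows "Ck_on k S f \<Longrightarrow> Ck_on k S (\<lambda>x. l x *\<^sub>R f x)"
proof (induction k arbitrary: f)
  case 0
  then show ?case by (simp, intro continuous_on_scaleR linear_continuous_on[OF l])
next
  case (Suc k)
  let ?f' = "\<lambda>x. frechet_derivative f (at x)"
  show ?case
  proof (rule Ck_on_derivI[where f' = "\<lambda>x v. l x *\<^sub>R ?f' x v + l v *\<^sub>R f x"])
    show "((\<lambda>x. l x *\<^sub>R f x) has_derivative (\<lambda>v. l x *\<^sub>R ?f' x v + l v *\<^sub>R f x)) (at x)" if "x \<in> S" for x
      by (rule has_derivative_scaleR[OF bounded_linear_imp_has_derivative[OF l]
            Ck_on_has_derivative[OF Suc.prems that]])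
    show "Ck_on k S (\<lambda>x. l x *\<^sub>R ?f' x v + l v *\<^sub>R f x)" for v
      by (rule Ck_on_add[OF \<open>open S\<close> Suc.IH[OF Ck_on_frechet[OF Suc.prems]]
            Ck_on_bounded_linear[OF \<open>open S\<close> bounded_linear_scaleR_right Ck_on_Suc_imp[OF Suc.prems]]])
  qed (fact \<open>open S\<close>)
qed

lemma Ck_on_affine:
  fixes L :: "'a::real_normed_vector \<Rightarrow> 'b::real_normed_vector"
  assumes "open S" and L: "bounded_linear L" and h: "h = (\<lambda>x. c + L x)"
  shows "Ck_on k S f \<Longrightarrow> Ck_on k (h -` S) (\<lambda>x. f (h x))"
proof (induction k arbitrary: f)
  case 0
  have "continuous_on UNIV h"
    unfolding h by (rule continuous_on_add[OF continuous_on_const linear_continuous_on[OF L]])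
  then have "continuous_on (h -` S) h" by (rule continuous_on_subset) simp
  then show ?case using 0 continuous_on_compose2[of S f "h -` S" h] by simp
next
  case (Suc k)
  let ?f' = "\<lambda>x. frechet_derivative f (at x)"
  have dh: "(h has_derivative L) (at x)" for x
    using has_derivative_add[OF has_derivative_const bounded_linear_imp_has_derivative[OF L], of c "at x"]
    by (simp add: h)
  have "continuous_on UNIV h"
    unfolding h by (rule continuous_on_add[OF continuous_on_const linear_continuous_on[OF L]])
  then have "open (h -` S)" by (rule open_vimage[OF \<open>open S\<close>])
  then show ?case
  proof (rule Ck_on_derivI[where f' = "\<lambda>x v. ?f' (h x) (L v)"])
    show "((\<lambda>x. f (h x)) has_derivative (\<lambda>v. ?f' (h x) (L v))) (at x)" if "x \<in> h -` S" for x
      using diff_chain_at[OF dh Ck_on_has_derivative[OF Suc.prems vimageD[OF that]]] by (simp only: o_def)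
    show "Ck_on k (h -` S) (\<lambda>x. ?f' (h x) (L v))" for v
      using Suc.IH[OF Ck_on_frechet[OF Suc.prems]] .
  qed
qed

section \<open>Symmetry of second derivatives\<close>

text \<open>
  The mean value theorem, applied in direction \<open>v\<close> to the difference in direction \<open>w\<close>, and then in
  direction \<open>w\<close> to the derivative in direction \<open>v\<close>.
\<close>

lemma second_difference:
  fixes f :: "'a::real_normed_vector \<Rightarrow> real"
  assumes h: "h > 0"
    and U: "\<And>s t. 0 \<le> s \<Longrightarrow> s \<le> h \<Longrightarrow> 0 \<le> t \<Longrightarrow> t \<le> h \<Longrightarrow> x + s *\<^sub>R v + t *\<^sub>R w \<in> U"
    and f: "\<And>y. y \<in> U \<Longrightarrow> (f has_derivative f' y) (at y)"
    and g: "\<And>y. y \<in> U \<Longrightarrow> ((\<lambda>y. f' y v) has_derivative g y) (at y)"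
  shows "\<exists>s t. 0 \<le> s \<and> s \<le> h \<and> 0 \<le> t \<and> t \<le> h \<and>
    f (x + h *\<^sub>R v + h *\<^sub>R w) - f (x + h *\<^sub>R v) - f (x + h *\<^sub>R w) + f x
      = h * h * g (x + s *\<^sub>R v + t *\<^sub>R w) w"
proof -
  let ?p = "\<lambda>s. f (x + s *\<^sub>R v + h *\<^sub>R w) - f (x + s *\<^sub>R v + 0 *\<^sub>R w)"
  let ?p' = "\<lambda>s. f' (x + s *\<^sub>R v + h *\<^sub>R w) v - f' (x + s *\<^sub>R v + 0 *\<^sub>R w) v"
  have d: "DERIV (\<lambda>s. f (x + s *\<^sub>R v + t *\<^sub>R w)) s :> f' (x + s *\<^sub>R v + t *\<^sub>R w) v"
    if "0 \<le> s" "s \<le> h" "0 \<le> t" "t \<le> h" for s t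
  proof -
    have "((\<lambda>s. x + s *\<^sub>R v + t *\<^sub>R w) has_vector_derivative v) (at s)"
      by (auto intro!: derivative_eq_intros)
    from vector_derivative_diff_chain_within[OF this, of f "f' (x + s *\<^sub>R v + t *\<^sub>R w)"]
    have "((\<lambda>s. f (x + s *\<^sub>R v + t *\<^sub>R w)) has_vector_derivative f' (x + s *\<^sub>R v + t *\<^sub>R w) v) (at s)"
      using f[OF U[OF that]] by (simp add: o_def has_derivative_at_withinI)
    then show ?thesis by (simp add: has_real_derivative_iff_has_vector_derivative)
  qed
  have "\<exists>s>0. s < h \<and> ?p h - ?p 0 = (h - 0) * ?p' s"
    using h by (intro MVT2 DERIV_diff d) auto
  then obtain s where s: "0 < s" "s < h" "?p h - ?p 0 = h * ?p' s" by auto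
  let ?q = "\<lambda>t. f' (x + s *\<^sub>R v + t *\<^sub>R w) v"
  have "DERIV ?q t :> g (x + s *\<^sub>R v + t *\<^sub>R w) w" if "0 \<le> t" "t \<le> h" for t
  proof -
    have "((\<lambda>t. x + s *\<^sub>R v + t *\<^sub>R w) has_vector_derivative w) (at t)"
      by (auto intro!: derivative_eq_intros)
    from vector_derivative_diff_chain_within[OF this, of "\<lambda>y. f' y v" "g (x + s *\<^sub>R v + t *\<^sub>R w)"]
    have "(?q has_vector_derivative g (x + s *\<^sub>R v + t *\<^sub>R w) w) (at t)"
      using g[OF U[of s t]] that s by (simp add: o_def has_derivative_at_withinI)
    then show ?thesis by (simp add: has_real_derivative_iff_has_vector_derivative)
  qed
  then have "\<exists>t>0. t < h \<and> ?q h - ?q 0 = (h - 0) * g (x + s *\<^sub>R v + t *\<^sub>R w) w"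
    using h by (intro MVT2) auto
  then obtain t where t: "0 < t" "t < h" "?q h - ?q 0 = h * g (x + s *\<^sub>R v + t *\<^sub>R w) w" by auto
  show ?thesis
    using s t by (intro exI[of _ s] exI[of _ t]) (simp add: algebra_simps)
qed

text \<open>
  The second difference is symmetric in \<open>v\<close> and \<open>w\<close>.  By the preceding lemma it equals \<open>h\<^sup>2\<close> times either
  mixed derivative at suitable points close to \<open>x\<close>, so by continuity the two agree at \<open>x\<close>.
\<close>

lemma second_derivative_symmetric_real:
  fixes f :: "'a::real_normed_vector \<Rightarrow> real"
  assumes U: "open U" "x \<in> U"
    and f: "\<And>y. y \<in> U \<Longrightarrow> (f has_derivative f' y) (at y)"
    and gv: "\<And>y. y \<in> U \<Longrightarrow> ((\<lambda>y. f' y v) has_derivative gv y) (at y)"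
    and gw: "\<And>y. y \<in> U \<Longrightarrow> ((\<lambda>y. f' y w) has_derivative gw y) (at y)"
    and c: "continuous_on U (\<lambda>y. gv y w)" "continuous_on U (\<lambda>y. gw y v)"
  shows "gv x w = gw x v"
proof (rule ccontr)
  assume ne: "gv x w \<noteq> gw x v"
  let ?e = "dist (gv x w) (gw x v) / 2"
  have e: "?e > 0" using ne by simp
  have "isCont (\<lambda>y. gv y w) x" "isCont (\<lambda>y. gw y v) x"
    using c U by (auto simp: continuous_on_eq_continuous_at)
  then obtain d1 d2 where d1: "d1 > 0" "\<And>y. dist y x < d1 \<Longrightarrow> dist (gv y w) (gv x w) < ?e"
    and d2: "d2 > 0" "\<And>y. dist y x < d2 \<Longrightarrow> dist (gw y v) (gw x v) < ?e"
    using e unfolding continuous_at_eps_delta by metis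
  obtain d3 where d3: "d3 > 0" "ball x d3 \<subseteq> U" using U openE by blast
  define d where "d = min d1 (min d2 d3)"
  \<comment> \<open>so small that the parallelogram with sides \<open>h v\<close> and \<open>h w\<close> lies within distance \<open>d\<close> of \<open>x\<close>\<close>
  define h where "h = d / (2 * (norm v + norm w + 1))"
  have d: "d > 0" using d1(1) d2(1) d3(1) by (simp add: d_def)
  have n: "norm v + norm w + 1 > 0" by (simp add: add_nonneg_pos)
  have h: "h > 0" using d n by (simp add: h_def)
  have near: "dist (x + s *\<^sub>R v + t *\<^sub>R w) x < d" if "0 \<le> s" "s \<le> h" "0 \<le> t" "t \<le> h" for s t
  proof -
    have "dist (x + s *\<^sub>R v + t *\<^sub>R w) x \<le> s * norm v + t * norm w"
      using norm_triangle_ineq[of "s *\<^sub>R v" "t *\<^sub>R w"] that by (simp add: dist_norm)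
    also have "\<dots> \<le> h * norm v + h * norm w"
      using that by (intro add_mono mult_right_mono) auto
    also have "\<dots> \<le> h * (norm v + norm w + 1)" using h by (simp add: algebra_simps)
    also have "\<dots> = d / 2" using n by (simp add: h_def field_simps)
    finally show ?thesis using d by simp
  qed
  have inU: "x + s *\<^sub>R v + t *\<^sub>R w \<in> U" if "0 \<le> s" "s \<le> h" "0 \<le> t" "t \<le> h" for s t
    using near[OF that] d3(2) by (auto simp: d_def dist_commute)
  from second_difference[OF h inU f gv]
  obtain s t where st: "0 \<le> s" "s \<le> h" "0 \<le> t" "t \<le> h"
    "f (x + h *\<^sub>R v + h *\<^sub>R w) - f (x + h *\<^sub>R v) - f (x + h *\<^sub>R w) + f x
      = h * h * gv (x + s *\<^sub>R v + t *\<^sub>R w) w" by blast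
  have inU': "x + t *\<^sub>R w + s *\<^sub>R v \<in> U" if "0 \<le> t" "t \<le> h" "0 \<le> s" "s \<le> h" for s t
    using inU[OF that(3,4,1,2)] by (simp add: add.commute add.left_commute add.assoc)
  from second_difference[OF h inU' f gw]
  obtain t' s' where st': "0 \<le> s'" "s' \<le> h" "0 \<le> t'" "t' \<le> h"
    "f (x + h *\<^sub>R w + h *\<^sub>R v) - f (x + h *\<^sub>R w) - f (x + h *\<^sub>R v) + f x
      = h * h * gw (x + t' *\<^sub>R w + s' *\<^sub>R v) v" by blast
  have "h * h * gv (x + s *\<^sub>R v + t *\<^sub>R w) w = h * h * gw (x + t' *\<^sub>R w + s' *\<^sub>R v) v"
    unfolding st(5)[symmetric] st'(5)[symmetric] by (simp add: algebra_simps)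
  then have eq: "gv (x + s *\<^sub>R v + t *\<^sub>R w) w = gw (x + s' *\<^sub>R v + t' *\<^sub>R w) v"
    using h by (simp add: add.commute add.left_commute add.assoc)
  have "dist (gv (x + s *\<^sub>R v + t *\<^sub>R w) w) (gv x w) < ?e" "dist (gw (x + s' *\<^sub>R v + t' *\<^sub>R w) v) (gw x v) < ?e"
    using near[OF st(1-4)] near[OF st'(1-4)] by (intro d1(2) d2(2); simp add: d_def)+
  then show False unfolding eq
    using dist_triangle2[of "gv x w" "gw x v" "gw (x + s' *\<^sub>R v + t' *\<^sub>R w) v"]
    by (simp add: dist_commute)
qed

lemma second_derivative_symmetric:
  fixes F :: "'a::real_normed_vector \<Rightarrow> complex"
  assumes U: "open U" "x \<in> U" and F: "Ck_on 2 U F"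
  shows "frechet_derivative (\<lambda>y. frechet_derivative F (at y) v) (at x) w
       = frechet_derivative (\<lambda>y. frechet_derivative F (at y) w) (at x) v"
proof -
  let ?F' = "\<lambda>y. frechet_derivative F (at y)"
  let ?G = "\<lambda>v y. frechet_derivative (\<lambda>y. ?F' y v) (at y)"
  have C: "Ck_on (Suc (Suc 0)) U F" using F by (simp add: numeral_2_eq_2)
  have "L (?G v x w) = L (?G w x v)" if L: "bounded_linear L" for L :: "complex \<Rightarrow> real"
  proof (rule second_derivative_symmetric_real[OF U, of "\<lambda>y. L (F y)" "\<lambda>y v. L (?F' y v)" v
        "\<lambda>y u. L (?G v y u)" w "\<lambda>y u. L (?G w y u)"])
    have D: "((\<lambda>y. ?F' y v) has_derivative ?G v y) (at y)" if "y \<in> U" for y v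
      by (rule Ck_on_has_derivative[OF Ck_on_frechet[OF C] that])
    show "((\<lambda>y. L (F y)) has_derivative (\<lambda>v. L (?F' y v))) (at y)" if "y \<in> U" for y
      by (intro bounded_linear.has_derivative[OF L] Ck_on_has_derivative[OF C] that)
    show "((\<lambda>y. L (?F' y v)) has_derivative (\<lambda>u. L (?G v y u))) (at y)"
      "((\<lambda>y. L (?F' y w)) has_derivative (\<lambda>u. L (?G w y u))) (at y)" if "y \<in> U" for y
      by (intro bounded_linear.has_derivative[OF L] D that)+
    have c: "continuous_on U (\<lambda>y. ?G v y w)" for v w
      using Ck_on_frechet[OF Ck_on_frechet[OF C]] by simp
    show "continuous_on U (\<lambda>y. L (?G v y w))" "continuous_on U (\<lambda>y. L (?G w y v))"
      by (rule bounded_linear.continuous_on[OF L c])+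
  qed
  from this[OF bounded_linear_Re] this[OF bounded_linear_Im] show ?thesis
    by (simp add: complex_eq_iff)
qed

section \<open>Smooth functions on the group\<close>

text \<open>
  Membership in \<open>smooth_fun O2\<close> leaves the values outside the group unspecified.  Requiring them to be \<open>0\<close>
  is preserved by differentiation along the group and makes identities between operators hold as
  equations between functions on the whole matrix space.
\<close>

definition smooth_O2 :: "(('k::finite) gmat \<Rightarrow> complex) set" where
  "smooth_O2 = {u \<in> smooth_fun O2. \<forall>x. x \<notin> O2 \<longrightarrow> u x = 0}"

definition smul :: "complex \<Rightarrow> ('a \<Rightarrow> complex) \<Rightarrow> 'a \<Rightarrow> complex" where
  "smul c u = (\<lambda>x. c * u x)"

lemma smul_apply [simp]: "smul c u x = c * u x"
  by (simp add: smul_def)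

lemma smooth_funE:
  assumes "u \<in> smooth_fun S" "x \<in> S"
  obtains U F where "open U" "x \<in> U" "\<And>k. Ck_on k U F" "\<And>y. y \<in> U \<Longrightarrow> y \<in> S \<Longrightarrow> F y = u y"
  using assms unfolding smooth_fun_def by blast

lemma smooth_funI:
  assumes "\<And>x. x \<in> S \<Longrightarrow> \<exists>U F. open U \<and> x \<in> U \<and> (\<forall>k. Ck_on k U F) \<and> (\<forall>y\<in>U \<inter> S. F y = u y)"
  shows "u \<in> smooth_fun S"
  using assms unfolding smooth_fun_def by blast

lemma smooth_fun_add:
  assumes "u \<in> smooth_fun S" "v \<in> smooth_fun S"
  shows "u + v \<in> smooth_fun S"
proof (rule smooth_funI)
  fix x assume x: "x \<in> S"
  obtain U F
    where U: "open U" "x \<in> U" "\<And>k. Ck_on k U F" "\<And>y. y \<in> U \<Longrightarrow> y \<in> S \<Longrightarrow> F y = u y"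
    by (rule smooth_funE[OF assms(1) x], rule that)
  obtain V G
    where V: "open V" "x \<in> V" "\<And>k. Ck_on k V G" "\<And>y. y \<in> V \<Longrightarrow> y \<in> S \<Longrightarrow> G y = v y"
    by (rule smooth_funE[OF assms(2) x], rule that)
  have "Ck_on k (U \<inter> V) (\<lambda>y. F y + G y)" for k
    using U V by (intro Ck_on_add open_Int) (auto intro: Ck_on_subset)
  then show "\<exists>W H. open W \<and> x \<in> W \<and> (\<forall>k. Ck_on k W H) \<and> (\<forall>y\<in>W \<inter> S. H y = (u + v) y)"
    using U V by (intro exI[of _ "U \<inter> V"] exI[of _ "\<lambda>y. F y + G y"]) auto
qed

lemma smooth_fun_smul:
  assumes "u \<in> smooth_fun S"
  shows "smul c u \<in> smooth_fun S"
proof (rule smooth_funI)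
  fix x assume x: "x \<in> S"
  obtain U F
    where U: "open U" "x \<in> U" "\<And>k. Ck_on k U F" "\<And>y. y \<in> U \<Longrightarrow> y \<in> S \<Longrightarrow> F y = u y"
    by (rule smooth_funE[OF assms(1) x], rule that)
  have "Ck_on k U (\<lambda>y. c * F y)" for k
    by (rule Ck_on_bounded_linear[OF U(1) bounded_linear_mult_right U(3)])
  then show "\<exists>W H. open W \<and> x \<in> W \<and> (\<forall>k. Ck_on k W H) \<and> (\<forall>y\<in>W \<inter> S. H y = smul c u y)"
    using U by (intro exI[of _ U] exI[of _ "\<lambda>y. c * F y"]) auto
qed

lemma smooth_fun_cong:
  assumes "\<And>x. x \<in> S \<Longrightarrow> u x = v x" "u \<in> smooth_fun S"
  shows "v \<in> smooth_fun S"
  using assms unfolding smooth_fun_def by auto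

text \<open>
  Right translation and restriction along the embedding are both of this form.
\<close>

lemma smooth_fun_affine:
  assumes u: "u \<in> smooth_fun T" and h: "h = (\<lambda>x. c + L x)" "bounded_linear L"
    and ST: "\<And>x. x \<in> S \<Longrightarrow> h x \<in> T"
  shows "(\<lambda>x. u (h x)) \<in> smooth_fun S"
proof (rule smooth_funI)
  fix x assume x: "x \<in> S"
  obtain U F
    where U: "open U" "h x \<in> U" "\<And>k. Ck_on k U F" "\<And>y. y \<in> U \<Longrightarrow> y \<in> T \<Longrightarrow> F y = u y"
    by (rule smooth_funE[OF u ST[OF x]], rule that)
  have "continuous_on UNIV h"
    unfolding h(1) by (rule continuous_on_add[OF continuous_on_const linear_continuous_on[OF h(2)]])
  then have "open (h -` U)" by (rule open_vimage[OF U(1)])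
  moreover have "Ck_on k (h -` U) (\<lambda>x. F (h x))" for k
    by (rule Ck_on_affine[OF U(1) h(2,1) U(3)])
  ultimately show "\<exists>W H. open W \<and> x \<in> W \<and> (\<forall>k. Ck_on k W H) \<and> (\<forall>y\<in>W \<inter> S. H y = u (h y))"
    using U ST by (intro exI[of _ "h -` U"] exI[of _ "\<lambda>x. F (h x)"]) auto
qed

lemma smooth_O2_add: "u \<in> smooth_O2 \<Longrightarrow> v \<in> smooth_O2 \<Longrightarrow> u + v \<in> smooth_O2"
  by (simp add: smooth_O2_def smooth_fun_add)

lemma smooth_O2_smul: "u \<in> smooth_O2 \<Longrightarrow> smul c u \<in> smooth_O2"
  by (simp add: smooth_O2_def smooth_fun_smul)

lemma smooth_O2_zero: "0 \<in> smooth_O2"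
proof -
  have "(0 :: 'a gmat \<Rightarrow> complex) \<in> smooth_fun O2"
    by (rule smooth_funI) (auto intro!: exI[of _ UNIV] exI[of _ "\<lambda>_. 0"] Ck_on_const)
  then show ?thesis by (simp add: smooth_O2_def)
qed

lemma smooth_O2_sum: "(\<And>i. i \<in> I \<Longrightarrow> f i \<in> smooth_O2) \<Longrightarrow> sum f I \<in> smooth_O2"
  by (induction I rule: infinite_finite_induct) (auto simp: smooth_O2_zero smooth_O2_add)

lemma smooth_O2_smooth: "u \<in> smooth_O2 \<Longrightarrow> u \<in> smooth_fun O2"
  by (simp add: smooth_O2_def)

lemma smooth_O2_outside: "u \<in> smooth_O2 \<Longrightarrow> x \<notin> O2 \<Longrightarrow> u x = 0"
  by (simp add: smooth_O2_def)

lemma O2_mult_iff: "h \<in> O2 \<Longrightarrow> x ** h \<in> O2 \<longleftrightarrow> x \<in> O2"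
proof
  assume h: "h \<in> O2" and xh: "x ** h \<in> O2"
  have "x = (x ** h) ** matrix_inv h"
    using O2_matrix_inv(2)[OF h] by (simp flip: matrix_mul_assoc)
  then show "x \<in> O2" using O2_mult[OF xh O2_matrix_inv(3)[OF h]] by simp
qed (simp add: O2_mult)

lemma O2_mexp_iff: "X \<in> o2 \<Longrightarrow> x ** mexp (t *\<^sub>R X) \<in> O2 \<longleftrightarrow> x \<in> O2"
  by (intro O2_mult_iff mexp_O2)

section \<open>Differentiation along one-parameter groups\<close>

text \<open>
  The chain rule.  The curve stays in the group, so the local extension may replace the function.
\<close>

lemma R_vec_local:
  assumes X: "X \<in> o2" and U: "open U" "x \<in> U" "x \<in> O2"
    and F: "\<And>k. Ck_on k U F" "\<And>y. y \<in> U \<Longrightarrow> y \<in> O2 \<Longrightarrow> F y = u y"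
  shows "((\<lambda>t. u (x ** mexp (t *\<^sub>R X))) has_vector_derivative frechet_derivative F (at x) (x ** X)) (at 0)"
proof -
  let ?c = "\<lambda>t. x ** mexp (t *\<^sub>R X)"
  have dc: "(?c has_vector_derivative x ** (X ** mexp (t *\<^sub>R X))) (at t)" for t
    by (rule bounded_linear.has_vector_derivative[OF matrix_mult.bounded_linear_right mexp_deriv])
  then have "continuous_on UNIV ?c"
    by (intro continuous_at_imp_continuous_on) (auto intro: has_vector_derivative_continuous)
  then have op: "open (?c -` U)" by (rule open_vimage[OF U(1)])
  have "(F has_derivative frechet_derivative F (at x)) (at (?c 0))"
    using Ck_on_has_derivative[OF F(1) U(2)] by simp
  from vector_derivative_diff_chain_within[OF dc[of 0] has_derivative_at_withinI[OF this]]
  have "((\<lambda>t. F (?c t)) has_vector_derivative frechet_derivative F (at x) (x ** X)) (at 0)"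
    by (simp add: o_def)
  then show ?thesis
    by (rule has_vector_derivative_transform_within_open[OF _ op])
      (use U F(2) O2_mexp_iff[OF X] in auto)
qed

lemma R_vec_eq:
  assumes X: "X \<in> o2" and U: "open U" "x \<in> U" "x \<in> O2"
    and F: "\<And>k. Ck_on k U F" "\<And>y. y \<in> U \<Longrightarrow> y \<in> O2 \<Longrightarrow> F y = u y"
  shows "R_vec X u x = frechet_derivative F (at x) (x ** X)"
  unfolding R_vec_def by (rule vector_derivative_at[OF R_vec_local[OF assms]])

lemma R_vec_deriv0:
  assumes X: "X \<in> o2" and u: "u \<in> smooth_O2"
  shows "((\<lambda>t. u (x ** mexp (t *\<^sub>R X))) has_vector_derivative R_vec X u x) (at 0)"
proof (cases "x \<in> O2")
  case True
  obtain U F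
    where U: "open U" "x \<in> U" "\<And>k. Ck_on k U F" "\<And>y. y \<in> U \<Longrightarrow> y \<in> O2 \<Longrightarrow> F y = u y"
    by (rule smooth_funE[OF smooth_O2_smooth[OF u] True], rule that)
  show ?thesis
    using R_vec_local[OF X U(1,2) True U(3,4)] R_vec_eq[OF X U(1,2) True U(3,4)] by simp
next
  case False
  then have "(\<lambda>t. u (x ** mexp (t *\<^sub>R X))) = (\<lambda>t. 0)"
    using smooth_O2_outside[OF u] O2_mexp_iff[OF X] by auto
  then show ?thesis by (simp add: R_vec_def)
qed

text \<open>
  The group law of the curve reduces the derivative at \<open>t\<close> to the derivative at \<open>0\<close>.
\<close>

lemma R_vec_deriv:
  assumes X: "X \<in> o2" and u: "u \<in> smooth_O2"
  shows "((\<lambda>t. u (x ** mexp (t *\<^sub>R X))) has_vector_derivative R_vec X u (x ** mexp (t *\<^sub>R X))) (at t)"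
proof -
  let ?y = "x ** mexp (t *\<^sub>R X)"
  have "((\<lambda>s. s - t) has_vector_derivative 1) (at t)"
    by (auto intro!: derivative_eq_intros)
  moreover have "((\<lambda>s. u (?y ** mexp (s *\<^sub>R X))) has_vector_derivative R_vec X u ?y) (at (t - t))"
    using R_vec_deriv0[OF assms, of ?y] by simp
  ultimately have "((\<lambda>s. u (?y ** mexp ((s - t) *\<^sub>R X))) has_vector_derivative R_vec X u ?y) (at t)"
    using vector_diff_chain_at by (fastforce simp: o_def)
  moreover have "?y ** mexp ((s - t) *\<^sub>R X) = x ** mexp (s *\<^sub>R X)" for s
    by (simp add: matrix_mul_assoc[symmetric] mexp_add[symmetric])
  ultimately show ?thesis by simp
qed

lemma R_vec_add: "X \<in> o2 \<Longrightarrow> u \<in> smooth_O2 \<Longrightarrow> v \<in> smooth_O2 \<Longrightarrow> R_vec X (u + v) = R_vec X u + R_vec X v"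
proof
  fix x assume a: "X \<in> o2" "u \<in> smooth_O2" "v \<in> smooth_O2"
  show "R_vec X (u + v) x = (R_vec X u + R_vec X v) x"
    using vector_derivative_at[OF has_vector_derivative_add[OF R_vec_deriv0[OF a(1,2)] R_vec_deriv0[OF a(1,3)]]]
    by (simp add: R_vec_def)
qed

lemma R_vec_smul: "X \<in> o2 \<Longrightarrow> u \<in> smooth_O2 \<Longrightarrow> R_vec X (smul c u) = smul c (R_vec X u)"
proof
  fix x assume a: "X \<in> o2" "u \<in> smooth_O2"
  show "R_vec X (smul c u) x = smul c (R_vec X u) x"
    using vector_derivative_at[OF bounded_linear.has_vector_derivative[OF bounded_linear_mult_right R_vec_deriv0[OF a]]]
    by (simp add: R_vec_def)
qed

lemma R_vec_outside: "X \<in> o2 \<Longrightarrow> u \<in> smooth_O2 \<Longrightarrow> x \<notin> O2 \<Longrightarrow> R_vec X u x = 0"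
  by (simp add: R_vec_def O2_mexp_iff smooth_O2_outside)

lemma R_vec_0: "R_vec X 0 = (0 :: ('i::finite) sqmat \<Rightarrow> complex)"
  by (rule ext) (simp add: R_vec_def)

lemma frechet_expand:
  fixes F :: "'a::euclidean_space \<Rightarrow> complex"
  assumes "Ck_on (Suc k) U F" "y \<in> U"
  shows "frechet_derivative F (at y) w = (\<Sum>b\<in>Basis. (w \<bullet> b) *\<^sub>R frechet_derivative F (at y) b)"
proof -
  have "linear (frechet_derivative F (at y))"
    using Ck_on_has_derivative[OF assms] has_derivative_linear by blast
  from linear_sum[OF this, of "\<lambda>b. (w \<bullet> b) *\<^sub>R b" Basis] show ?thesis
    by (simp add: euclidean_representation linear_cmul[OF \<open>linear _\<close>])
qed

lemma bounded_linear_entry: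
  fixes X b :: "('i::finite) sqmat"
  shows "bounded_linear (\<lambda>y. (y ** X) \<bullet> b)"
  using bounded_linear_compose[of "\<lambda>z. z \<bullet> b" "\<lambda>y. y ** X"]
    bounded_linear_inner_left[of b] matrix_mult.bounded_linear_left[of X] by blast

lemma Ck_on_R:
  fixes F :: "('i::finite) sqmat \<Rightarrow> complex"
  assumes U: "open U" and F: "\<And>k. Ck_on k U F"
  shows "Ck_on k U (\<lambda>y. frechet_derivative F (at y) (y ** X))"
proof (rule Ck_on_cong[OF U])
  show "(\<Sum>b\<in>Basis. ((y ** X) \<bullet> b) *\<^sub>R frechet_derivative F (at y) b) = frechet_derivative F (at y) (y ** X)"
    if "y \<in> U" for y
    by (rule frechet_expand[OF F that, symmetric])
  show "Ck_on k U (\<lambda>y. \<Sum>b\<in>Basis. ((y ** X) \<bullet> b) *\<^sub>R frechet_derivative F (at y) b)"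
    by (intro Ck_on_sum Ck_on_scaleR_linear U bounded_linear_entry Ck_on_frechet F)
qed

lemma R_vec_smooth_O2:
  assumes X: "X \<in> o2" and u: "u \<in> smooth_O2"
  shows "R_vec X u \<in> smooth_O2"
proof -
  have "R_vec X u \<in> smooth_fun O2"
  proof (rule smooth_funI)
    fix x :: "'a gmat" assume x: "x \<in> O2"
    obtain U F
    where U: "open U" "x \<in> U" "\<And>k. Ck_on k U F" "\<And>y. y \<in> U \<Longrightarrow> y \<in> O2 \<Longrightarrow> F y = u y"
    by (rule smooth_funE[OF smooth_O2_smooth[OF u] x], rule that)
    have "R_vec X u y = frechet_derivative F (at y) (y ** X)" if "y \<in> U \<inter> O2" for y
      using R_vec_eq[OF X U(1) _ _ U(3,4)] that by auto
    then show "\<exists>U F. open U \<and> x \<in> U \<and> (\<forall>k. Ck_on k U F) \<and> (\<forall>y\<in>U \<inter> O2. F y = R_vec X u y)"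
      using U Ck_on_R[OF U(1,3)]
      by (intro exI[of _ U] exI[of _ "\<lambda>y. frechet_derivative F (at y) (y ** X)"]) auto
  qed
  then show ?thesis using R_vec_outside[OF assms] by (simp add: smooth_O2_def)
qed

text \<open>
  The Leibniz rule for \<open>y \<mapsto> F'(y) (y X)\<close>.  Expanding the argument in an orthonormal basis writes this
  function as a sum of products of linear functions with partial derivatives of \<open>F\<close>.
\<close>

lemma frechet_R:
  fixes F :: "('i::finite) sqmat \<Rightarrow> complex"
  assumes U: "open U" "x \<in> U" and F: "\<And>k. Ck_on k U F"
  shows "frechet_derivative (\<lambda>y. frechet_derivative F (at y) (y ** X)) (at x) v
    = frechet_derivative F (at x) (v ** X)
      + frechet_derivative (\<lambda>y. frechet_derivative F (at y) (x ** X)) (at x) v"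
proof -
  let ?F' = "\<lambda>y. frechet_derivative F (at y)"
  let ?H = "\<lambda>w. frechet_derivative (\<lambda>y. ?F' y w) (at x)"
  let ?l = "\<lambda>b y. (y ** X) \<bullet> b"
  have H: "((\<lambda>y. ?F' y w) has_derivative ?H w) (at x)" for w
    by (rule Ck_on_has_derivative[OF Ck_on_frechet[OF F] U(2)])
  have "((\<lambda>y. \<Sum>b\<in>Basis. ?l b y *\<^sub>R ?F' y b) has_derivative
      (\<lambda>v. \<Sum>b\<in>Basis. ?l b x *\<^sub>R ?H b v + ?l b v *\<^sub>R ?F' x b)) (at x)"
    by (intro has_derivative_sum has_derivative_scaleR[OF bounded_linear_imp_has_derivative[OF bounded_linear_entry] H])
  then have "((\<lambda>y. ?F' y (y ** X)) has_derivative
      (\<lambda>v. \<Sum>b\<in>Basis. ?l b x *\<^sub>R ?H b v + ?l b v *\<^sub>R ?F' x b)) (at x)"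
    by (rule has_derivative_transform_within_open[OF _ U]) (rule frechet_expand[OF F, symmetric])
  from frechet_derivative_at[OF this, symmetric]
  have 1: "frechet_derivative (\<lambda>y. ?F' y (y ** X)) (at x) v
      = (\<Sum>b\<in>Basis. ?l b x *\<^sub>R ?H b v) + (\<Sum>b\<in>Basis. ?l b v *\<^sub>R ?F' x b)"
    by (simp add: sum.distrib)
  have "((\<lambda>y. \<Sum>b\<in>Basis. ?l b x *\<^sub>R ?F' y b) has_derivative
      (\<lambda>v. \<Sum>b\<in>Basis. ?l b x *\<^sub>R ?H b v)) (at x)"
    by (intro has_derivative_sum has_derivative_scaleR_right H)
  then have "((\<lambda>y. ?F' y (x ** X)) has_derivative (\<lambda>v. \<Sum>b\<in>Basis. ?l b x *\<^sub>R ?H b v)) (at x)"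
    by (rule has_derivative_transform_within_open[OF _ U]) (rule frechet_expand[OF F, symmetric])
  from frechet_derivative_at[OF this, symmetric]
  have 2: "?H (x ** X) v = (\<Sum>b\<in>Basis. ?l b x *\<^sub>R ?H b v)" by simp
  show ?thesis unfolding 1 2 frechet_expand[OF F U(2), of "v ** X"] by simp
qed

lemma o2_bracket: "X \<in> o2 \<Longrightarrow> Y \<in> o2 \<Longrightarrow> mbracket X Y \<in> o2"
proof -
  assume a: "X \<in> o2" "Y \<in> o2"
  have t: "transpose Z ** Smat = - (Smat ** Z)" if "Z \<in> o2" for Z :: "'a gmat"
    using that by (simp add: o2_def eq_neg_iff_add_eq_0)
  have "transpose (X ** Y) ** Smat = Smat ** (Y ** X)" if "X \<in> o2" "Y \<in> o2" for X Y :: "'a gmat"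
  proof -
    have "transpose (X ** Y) ** Smat = transpose Y ** (transpose X ** Smat)"
      by (simp add: matrix_transpose_mul matrix_mul_assoc)
    also have "\<dots> = - ((transpose Y ** Smat) ** X)"
      by (simp add: t[OF that(1)] mat_simps matrix_mul_assoc)
    also have "\<dots> = Smat ** (Y ** X)" by (simp add: t[OF that(2)] mat_simps matrix_mul_assoc)
    finally show ?thesis .
  qed
  from this[OF a] this[OF a(2,1)] show ?thesis by (simp add: o2_def mbracket_def mat_simps)
qed

text \<open>
  With a local extension \<open>F\<close>, the value of \<open>R(X) R(Y) u\<close> at \<open>x\<close> is \<open>F''(x) (x X, x Y) + F'(x) (x X Y)\<close>.  The
  first term is symmetric in \<open>X\<close> and \<open>Y\<close>, and the second ones differ by \<open>F'(x) (x [X, Y])\<close>.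
\<close>

lemma R_vec_bracket:
  assumes X: "X \<in> o2" and Y: "Y \<in> o2" and u: "u \<in> smooth_O2"
  shows "R_vec X (R_vec Y u) = R_vec Y (R_vec X u) + R_vec (mbracket X Y) u"
proof
  fix x
  show "R_vec X (R_vec Y u) x = (R_vec Y (R_vec X u) + R_vec (mbracket X Y) u) x"
  proof (cases "x \<in> O2")
    case False
    then show ?thesis using assms by (simp add: R_vec_outside R_vec_smooth_O2 o2_bracket)
  next
    case True
    obtain U F
    where U: "open U" "x \<in> U" "\<And>k. Ck_on k U F" "\<And>y. y \<in> U \<Longrightarrow> y \<in> O2 \<Longrightarrow> F y = u y"
    by (rule smooth_funE[OF smooth_O2_smooth[OF u] True], rule that)
    let ?F' = "\<lambda>y. frechet_derivative F (at y)"
    have 2: "R_vec X (R_vec Y u) x = ?F' x ((x ** X) ** Y)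
        + frechet_derivative (\<lambda>y. ?F' y (x ** Y)) (at x) (x ** X)" if X: "X \<in> o2" and Y: "Y \<in> o2" for X Y
    proof -
      have "R_vec X (R_vec Y u) x = frechet_derivative (\<lambda>y. ?F' y (y ** Y)) (at x) (x ** X)"
      proof (rule R_vec_eq[OF X U(1,2) True])
        show "Ck_on k U (\<lambda>y. ?F' y (y ** Y))" for k by (rule Ck_on_R[OF U(1,3)])
        show "?F' y (y ** Y) = R_vec Y u y" if "y \<in> U" "y \<in> O2" for y
          by (rule R_vec_eq[OF Y U(1) that U(3,4), symmetric])
      qed
      then show ?thesis by (simp only: frechet_R[OF U(1,2,3)])
    qed
    have "linear (?F' x)" using Ck_on_has_derivative[OF U(3,2)] has_derivative_linear by blast
    then have "?F' x ((x ** X) ** Y) = ?F' x ((x ** Y) ** X) + ?F' x (x ** mbracket X Y)"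
      by (simp add: mbracket_def mat_simps matrix_mul_assoc linear_diff)
    moreover have "R_vec (mbracket X Y) u x = ?F' x (x ** mbracket X Y)"
      by (rule R_vec_eq[OF o2_bracket[OF X Y] U(1,2) True U(3,4)])
    ultimately show ?thesis
      using second_derivative_symmetric[OF U(1,2,3), of "x ** X" "x ** Y"] 2[OF X Y] 2[OF Y X] by simp
  qed
qed

lemma R_vec_linear:
  assumes X: "X \<in> o2" and Y: "Y \<in> o2" and u: "u \<in> smooth_O2"
  shows "R_vec (X + Y) u = R_vec X u + R_vec Y u" and "R_vec (c *\<^sub>R X) u = smul (of_real c) (R_vec X u)"
proof -
  have XY: "X + Y \<in> o2" "c *\<^sub>R X \<in> o2"
    using subspace_add[OF subspace_o2 X Y] subspace_scale[OF subspace_o2 X] by auto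
  have "R_vec (X + Y) u x = R_vec X u x + R_vec Y u x \<and> R_vec (c *\<^sub>R X) u x = c *\<^sub>R R_vec X u x" for x
  proof (cases "x \<in> O2")
    case False
    then show ?thesis using assms XY by (simp add: R_vec_outside)
  next
    case True
    obtain U F
    where U: "open U" "x \<in> U" "\<And>k. Ck_on k U F" "\<And>y. y \<in> U \<Longrightarrow> y \<in> O2 \<Longrightarrow> F y = u y"
    by (rule smooth_funE[OF smooth_O2_smooth[OF u] True], rule that)
    have "linear (frechet_derivative F (at x))"
      using Ck_on_has_derivative[OF U(3,2)] has_derivative_linear by blast
    then show ?thesis
      using R_vec_eq[OF X U(1,2) True U(3,4)] R_vec_eq[OF Y U(1,2) True U(3,4)]
        R_vec_eq[OF XY(1) U(1,2) True U(3,4)] R_vec_eq[OF XY(2) U(1,2) True U(3,4)]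
      by (simp add: mat_simps linear_add linear_cmul)
  qed
  then show "R_vec (X + Y) u = R_vec X u + R_vec Y u" "R_vec (c *\<^sub>R X) u = smul (of_real c) (R_vec X u)"
    by (auto simp: fun_eq_iff scaleR_conv_of_real)
qed

lemma R_vec_scaleR: "X \<in> o2 \<Longrightarrow> u \<in> smooth_O2 \<Longrightarrow> R_vec (c *\<^sub>R X) u = smul (of_real c) (R_vec X u)"
  using R_vec_linear(2)[of X X u c] by blast

lemma R_vec_ltrans: "R_vec X (ltrans g u) = ltrans g (R_vec X u)"
  by (simp add: R_vec_def ltrans_def matrix_mul_assoc)

lemma emb_smooth: "u \<in> smooth_fun O2 \<Longrightarrow> u \<circ> emb \<in> smooth_fun O2"
proof -
  assume u: "u \<in> smooth_fun O2"
  have "emb = (\<lambda>x. Emat (Ix None) (Ix None) + embL x)" by (simp add: fun_eq_iff emb_eq add.commute)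
  from smooth_fun_affine[OF u this bounded_linear_embL emb_O2] show ?thesis by (simp add: o_def)
qed

text \<open>
  The function \<open>t \<mapsto> e\<^sup>-\<^sup>c\<^sup>t v (x exp (t X))\<close> has derivative \<open>0\<close>.
\<close>

lemma R_vec_eigen_curve:
  assumes X: "X \<in> o2" and v: "v \<in> smooth_O2" and e: "R_vec X v = smul c v"
  shows "v (x ** mexp (t *\<^sub>R X)) = exp (c * of_real t) * v x"
proof -
  let ?f = "\<lambda>t. exp (- c * of_real t) * v (x ** mexp (t *\<^sub>R X))"
  have "(?f has_vector_derivative 0) (at t)" for t
  proof -
    have "((\<lambda>t::real. exp (- c * of_real t)) has_vector_derivative exp (- c * of_real t) * - c) (at t)"
      using has_vector_derivative_real_field[of "\<lambda>z. exp (- c * z)" "exp (- c * of_real t) * - c" t UNIV]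
      by (force intro!: derivative_eq_intros)
    from has_vector_derivative_mult[OF this R_vec_deriv[OF X v, of x t]] show ?thesis
      by (simp add: e algebra_simps)
  qed
  from vector_derivative_zero_const[OF this, of t] have "?f t = v x" by simp
  then show ?thesis by (simp add: exp_minus field_simps)
qed

section \<open>The free algebra acts on smooth functions\<close>

definition word_op :: "('i::finite) sqmat word \<Rightarrow> ('i sqmat \<Rightarrow> complex) \<Rightarrow> ('i sqmat \<Rightarrow> complex)" where
  "word_op w u = foldr R_vec (letters w) u"

lemma word_op_simps: "word_op 0 u = u" "word_op (v + w) u = word_op v (word_op w u)" "word_op (Word [X]) u = R_vec X u"
  by (simp_all add: word_op_def zero_word_def plus_word_def)

lemma foldr_R_vec_smooth_O2: "set Xs \<subseteq> o2 \<Longrightarrow> u \<in> smooth_O2 \<Longrightarrow> foldr R_vec Xs u \<in> smooth_O2"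
  by (induction Xs) (auto simp: R_vec_smooth_O2)

lemma word_op_smooth_O2: "set (letters w) \<subseteq> o2 \<Longrightarrow> u \<in> smooth_O2 \<Longrightarrow> word_op w u \<in> smooth_O2"
  by (simp add: word_op_def foldr_R_vec_smooth_O2)

lemma word_op_add:
  assumes "set (letters w) \<subseteq> o2" "u \<in> smooth_O2" "v \<in> smooth_O2"
  shows "word_op w (u + v) = word_op w u + word_op w v"
proof -
  have "set Xs \<subseteq> o2 \<Longrightarrow> foldr R_vec Xs (u + v) = foldr R_vec Xs u + foldr R_vec Xs v" for Xs
    by (induction Xs) (simp_all add: R_vec_add foldr_R_vec_smooth_O2 assms(2,3))
  with assms show ?thesis by (simp add: word_op_def)
qed

lemma word_op_smul:
  assumes "set (letters w) \<subseteq> o2" "u \<in> smooth_O2"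
  shows "word_op w (smul c u) = smul c (word_op w u)"
proof -
  have "set Xs \<subseteq> o2 \<Longrightarrow> foldr R_vec Xs (smul c u) = smul c (foldr R_vec Xs u)" for Xs
    by (induction Xs) (simp_all add: R_vec_smul foldr_R_vec_smooth_O2 assms(2))
  with assms show ?thesis by (simp add: word_op_def)
qed

lemma word_op_zero: "word_op w 0 = (0 :: ('i::finite) sqmat \<Rightarrow> complex)"
proof -
  have "foldr R_vec Xs 0 = (0 :: 'i sqmat \<Rightarrow> complex)" for Xs :: "'i sqmat list"
    by (induction Xs) (simp_all only: foldr.simps id_apply o_apply R_vec_0)
  then show ?thesis by (simp only: word_op_def)
qed

lemma word_op_sum:
  assumes "set (letters w) \<subseteq> o2" "\<And>i. i \<in> I \<Longrightarrow> f i \<in> smooth_O2"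
  shows "word_op w (sum f I) = (\<Sum>i\<in>I. word_op w (f i))"
  using assms(2)
  by (induction I rule: infinite_finite_induct) (auto simp: word_op_zero word_op_add[OF assms(1)] smooth_O2_sum)

lemma sum_fun_apply: "(sum f I) x = (\<Sum>i\<in>I. f i x)" for f :: "'i \<Rightarrow> 'a \<Rightarrow> 'b::comm_monoid_add"
  by (induction I rule: infinite_finite_induct) auto

text \<open>
  The sum over the support may be extended to any larger finite set, which allows sums for different
  elements to be compared.
\<close>

lemma R_free_superset:
  assumes "finite K" "Poly_Mapping.keys p \<subseteq> K"
  shows "R_free p u = (\<Sum>w\<in>K. smul (Poly_Mapping.lookup p w) (word_op w u))"
proof
  fix x
  have "R_free p u x = (\<Sum>w\<in>Poly_Mapping.keys p. Poly_Mapping.lookup p w * word_op w u x)"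
    by (simp add: R_free_def word_op_def)
  also have "\<dots> = (\<Sum>w\<in>K. Poly_Mapping.lookup p w * word_op w u x)"
    using assms by (intro sum.mono_neutral_left) (auto simp: in_keys_iff)
  finally show "R_free p u x = (\<Sum>w\<in>K. smul (Poly_Mapping.lookup p w) (word_op w u)) x" by (simp add: sum_fun_apply)
qed

lemma R_free_eq: "R_free p u = (\<Sum>w\<in>Poly_Mapping.keys p. smul (Poly_Mapping.lookup p w) (word_op w u))"
  by (rule R_free_superset) auto

lemma R_free_add: "R_free (p + q) u = R_free p u + R_free q u"
proof -
  let ?K = "Poly_Mapping.keys p \<union> Poly_Mapping.keys q"
  have "R_free r u = (\<Sum>w\<in>?K. smul (Poly_Mapping.lookup r w) (word_op w u))" if "r \<in> {p + q, p, q}" for r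
    using that Poly_Mapping.keys_add[of p q] by (intro R_free_superset) auto
  then show ?thesis
    by (simp add: sum_fun_apply fun_eq_iff lookup_add algebra_simps sum.distrib)
qed

lemma R_free_uminus: "R_free (- p) u = - R_free p u"
proof -
  have "Poly_Mapping.keys (- p) \<subseteq> Poly_Mapping.keys p" by (auto simp: in_keys_iff)
  from R_free_superset[OF _ this, of u] show ?thesis
    by (simp add: sum_fun_apply R_free_eq fun_eq_iff sum_negf)
qed

lemma R_free_zero [simp]: "R_free 0 u = 0"
  by (simp add: R_free_eq)

lemma R_free_diff: "R_free (p - q) u = R_free p u - R_free q u"
  using R_free_add[of p "- q" u] by (simp add: R_free_uminus)

lemma R_free_sum: "R_free (sum p I) u = (\<Sum>i\<in>I. R_free (p i) u)"
  by (induction I rule: infinite_finite_induct) (auto simp: R_free_add)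

lemma R_free_single: "R_free (Poly_Mapping.single w c) u = smul c (word_op w u)"
proof -
  have "R_free (Poly_Mapping.single w c) u = (\<Sum>v\<in>{w}. smul (Poly_Mapping.lookup (Poly_Mapping.single w c) v) (word_op v u))"
    by (rule R_free_superset) auto
  then show ?thesis by simp
qed

lemma poly_mapping_eq_sum_single:
  "p = (\<Sum>w\<in>Poly_Mapping.keys p. Poly_Mapping.single w (Poly_Mapping.lookup p w))"
proof (rule poly_mapping_eqI)
  fix k
  have "(\<Sum>w\<in>Poly_Mapping.keys p. Poly_Mapping.lookup (Poly_Mapping.single w (Poly_Mapping.lookup p w)) k)
      = (\<Sum>w\<in>Poly_Mapping.keys p. if w = k then Poly_Mapping.lookup p k else 0)"
    by (intro sum.cong) (auto simp: lookup_single)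
  also have "\<dots> = Poly_Mapping.lookup p k" by (simp add: in_keys_iff)
  finally show "Poly_Mapping.lookup p k
      = Poly_Mapping.lookup (\<Sum>w\<in>Poly_Mapping.keys p. Poly_Mapping.single w (Poly_Mapping.lookup p w)) k"
    by (simp add: lookup_sum)
qed

lemma carrier_free_alg: "p \<in> carrier (free_alg L) \<longleftrightarrow> (\<forall>w\<in>Poly_Mapping.keys p. set (letters w) \<subseteq> L)"
  by (simp add: free_alg_def)

lemma free_alg_simps [simp]:
  "monoid.mult (free_alg L) = (*)" "one (free_alg L) = 1" "ring.zero (free_alg L) = 0" "add (free_alg L) = (+)"
  by (simp_all add: free_alg_def)

lemma free_alg_closed:
  "0 \<in> carrier (free_alg L)" "1 \<in> carrier (free_alg L)"
  "p \<in> carrier (free_alg L) \<Longrightarrow> - p \<in> carrier (free_alg L)"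
  "p \<in> carrier (free_alg L) \<Longrightarrow> q \<in> carrier (free_alg L) \<Longrightarrow> p + q \<in> carrier (free_alg L)"
  "p \<in> carrier (free_alg L) \<Longrightarrow> q \<in> carrier (free_alg L) \<Longrightarrow> p - q \<in> carrier (free_alg L)"
  "p \<in> carrier (free_alg L) \<Longrightarrow> q \<in> carrier (free_alg L) \<Longrightarrow> p * q \<in> carrier (free_alg L)"
  "free_const c \<in> carrier (free_alg L)" "X \<in> L \<Longrightarrow> free_gen X \<in> carrier (free_alg L)"
proof -
  show 1: "0 \<in> carrier (free_alg L)" "1 \<in> carrier (free_alg L)" "free_const c \<in> carrier (free_alg L)"
    "X \<in> L \<Longrightarrow> free_gen X \<in> carrier (free_alg L)"
    by (auto simp: carrier_free_alg free_const_def free_gen_def zero_word_def in_keys_iff lookup_single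
        simp flip: single_one split: if_splits)
  show m: "- p \<in> carrier (free_alg L)" if "p \<in> carrier (free_alg L)" for p
    using that by (simp add: carrier_free_alg in_keys_iff)
  show a: "p + q \<in> carrier (free_alg L)" if "p \<in> carrier (free_alg L)" "q \<in> carrier (free_alg L)" for p q
    using that Poly_Mapping.keys_add[of p q] unfolding carrier_free_alg by blast
  show "p - q \<in> carrier (free_alg L)" if "p \<in> carrier (free_alg L)" "q \<in> carrier (free_alg L)"
    using a[OF that(1) m[OF that(2)]] by simp
  show "p * q \<in> carrier (free_alg L)" if "p \<in> carrier (free_alg L)" "q \<in> carrier (free_alg L)"
    using that keys_mult[of p q] unfolding carrier_free_alg
    by (fastforce simp: plus_word_def)
qed

lemma R_free_smooth_O2:
  assumes "L \<subseteq> o2" "p \<in> carrier (free_alg L)" "u \<in> smooth_O2"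
  shows "R_free p u \<in> smooth_O2"
  using assms unfolding R_free_eq carrier_free_alg by (intro smooth_O2_sum smooth_O2_smul word_op_smooth_O2) auto

text \<open>
  On single words this is the definition of concatenation; the general case follows from bilinearity,
  where linearity of the operators is available only on smooth functions.
\<close>

lemma R_free_mult:
  assumes "L \<subseteq> o2" "p \<in> carrier (free_alg L)" "q \<in> carrier (free_alg L)" "u \<in> smooth_O2"
  shows "R_free (p * q) u = R_free p (R_free q u)"
proof -
  let ?s = Poly_Mapping.single and ?l = Poly_Mapping.lookup and ?k = Poly_Mapping.keys
  have o: "set (letters v) \<subseteq> o2" if "v \<in> ?k p \<or> v \<in> ?k q" for v
    using assms(1-3) that unfolding carrier_free_alg by blast
  have "p * q = (\<Sum>v\<in>?k p. \<Sum>w\<in>?k q. ?s v (?l p v) * ?s w (?l q w))"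
    by (subst (1) poly_mapping_eq_sum_single[of p], subst (1) poly_mapping_eq_sum_single[of q])
      (simp only: sum_product)
  then have "R_free (p * q) u = (\<Sum>v\<in>?k p. \<Sum>w\<in>?k q. smul (?l p v * ?l q w) (word_op v (word_op w u)))"
    by (simp add: R_free_sum mult_single R_free_single word_op_simps)
  also have "\<dots> = (\<Sum>v\<in>?k p. smul (?l p v) (\<Sum>w\<in>?k q. smul (?l q w) (word_op v (word_op w u))))"
    by (simp add: sum_fun_apply fun_eq_iff sum_distrib_left mult.assoc)
  also have "\<dots> = (\<Sum>v\<in>?k p. smul (?l p v) (word_op v (\<Sum>w\<in>?k q. smul (?l q w) (word_op w u))))"
    using o assms(4) by (intro sum.cong refl arg_cong[where f = "smul _"])
      (simp add: word_op_sum word_op_smul word_op_smooth_O2 smooth_O2_smul)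
  also have "\<dots> = R_free p (R_free q u)"
    by (simp add: R_free_eq)
  finally show ?thesis .
qed

lemma ring_free_alg: "ring (free_alg L)"
proof (rule ringI)
  show "abelian_group (free_alg L)"
  proof (rule abelian_groupI)
    show "\<exists>y\<in>carrier (free_alg L). y \<oplus>\<^bsub>free_alg L\<^esub> x = \<zero>\<^bsub>free_alg L\<^esub>" if "x \<in> carrier (free_alg L)" for x
      using that by (intro bexI[of _ "- x"]) (auto simp: free_alg_closed)
  qed (auto simp: free_alg_closed add_ac)
  show "Group.monoid (free_alg L)"
    by (rule monoidI) (auto simp: free_alg_closed mult.assoc)
qed (auto simp: algebra_simps)

lemma free_alg_a_inv:
  assumes "p \<in> carrier (free_alg L)"
  shows "\<ominus>\<^bsub>free_alg L\<^esub> p = - p"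
proof -
  interpret ring "free_alg L" by (rule ring_free_alg)
  show ?thesis by (rule minus_equality) (use assms in \<open>auto simp: free_alg_closed\<close>)
qed

lemma R_free_arg_zero: "R_free p 0 = 0"
  unfolding R_free_eq by (rule sum.neutral) (simp add: word_op_zero fun_eq_iff)

section \<open>The enveloping algebra acts on smooth functions\<close>

locale o2_subalgebra =
  fixes L :: "(('k::finite) gmat) set"
  assumes subspace_L: "subspace L" and L_o2: "L \<subseteq> o2"
    and bracket: "\<And>X Y. X \<in> L \<Longrightarrow> Y \<in> L \<Longrightarrow> mbracket X Y \<in> L"
begin

lemma relations_closed: "lie_relations L \<subseteq> carrier (free_alg L)"
  using subspace_add[OF subspace_L] subspace_scale[OF subspace_L] bracket
  by (auto simp: lie_relations_def intro!: free_alg_closed)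

lemma R_free_gen: "R_free (free_gen X) u = R_vec X u"
  by (simp add: free_gen_def R_free_single word_op_simps fun_eq_iff)

lemma R_free_const: "R_free (free_const c) u = smul c u"
  by (simp add: free_const_def R_free_single word_op_simps)

text \<open>
  Each of the three kinds of relations is one property of \<open>R\<close>: additivity, homogeneity and the
  commutator formula.
\<close>

lemma R_free_relations:
  assumes "p \<in> lie_relations L" "u \<in> smooth_O2"
  shows "R_free p u = 0"
proof -
  have o: "X \<in> o2" if "X \<in> L" for X using that L_o2 by blast
  note m = R_free_mult[OF L_o2 free_alg_closed(8) free_alg_closed(8) assms(2)]
    R_free_mult[OF L_o2 free_alg_closed(7) free_alg_closed(8) assms(2)]
  have br: "R_free (free_gen X * free_gen Y - free_gen Y * free_gen X - free_gen (mbracket X Y)) u = 0"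
    if "X \<in> L" "Y \<in> L" for X Y
    using R_vec_bracket[OF o[OF that(1)] o[OF that(2)] assms(2)] that
    by (simp add: R_free_diff R_free_gen m)
  show ?thesis using assms(1) unfolding lie_relations_def
    by (elim UnE CollectE exE conjE; simp add: br)
      (simp_all add: R_free_diff R_free_gen R_free_const m R_vec_linear(1) R_vec_scaleR o assms(2))
qed

definition annihilator where
  "annihilator = {p \<in> carrier (free_alg L). \<forall>u\<in>smooth_O2. R_free p u = 0}"

text \<open>
  The annihilator is a two-sided ideal because every element of the free algebra maps smooth functions
  to smooth functions.
\<close>

lemma ideal_annihilator: "ideal annihilator (free_alg L)"
proof (rule idealI[OF ring_free_alg])
  show "subgroup annihilator (add_monoid (free_alg L))"
  proof (rule group.subgroupI)
    show "group (add_monoid (free_alg L))"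
      using ring_free_alg ring.is_abelian_group abelian_group.a_group by blast
    show "inv\<^bsub>add_monoid (free_alg L)\<^esub> a \<in> annihilator" if "a \<in> annihilator" for a
      using that free_alg_a_inv[of a L]
      by (auto simp: annihilator_def a_inv_def free_alg_closed R_free_uminus)
  qed (auto simp: annihilator_def R_free_add free_alg_closed intro: free_alg_closed(1))
next
  fix a x assume "a \<in> annihilator" and x: "x \<in> carrier (free_alg L)"
  then have a: "a \<in> carrier (free_alg L)" "\<And>u. u \<in> smooth_O2 \<Longrightarrow> R_free a u = 0"
    by (simp_all add: annihilator_def)
  have "R_free (x * a) u = 0" "R_free (a * x) u = 0" if u: "u \<in> smooth_O2" for u
    unfolding R_free_mult[OF L_o2 x a(1) u] R_free_mult[OF L_o2 a(1) x u]
    by (simp_all only: a(2) u R_free_smooth_O2[OF L_o2 x u] R_free_arg_zero)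
  then show "x \<otimes>\<^bsub>free_alg L\<^esub> a \<in> annihilator" "a \<otimes>\<^bsub>free_alg L\<^esub> x \<in> annihilator"
    using a(1) x by (simp_all add: annihilator_def free_alg_closed)
qed

lemma ideal_uea: "ideal (uea_ideal L) (free_alg L)"
  unfolding uea_ideal_def by (rule ring.genideal_ideal[OF ring_free_alg relations_closed])

lemma uea_ideal_annihilates: "p \<in> uea_ideal L \<Longrightarrow> u \<in> smooth_O2 \<Longrightarrow> R_free p u = 0"
proof -
  assume p: "p \<in> uea_ideal L" and u: "u \<in> smooth_O2"
  have "uea_ideal L \<subseteq> annihilator"
    unfolding uea_ideal_def
    using R_free_relations relations_closed
    by (intro ring.genideal_minimal[OF ring_free_alg ideal_annihilator]) (auto simp: annihilator_def)
  with p u show ?thesis by (auto simp: annihilator_def)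
qed

definition uea_proj where "uea_proj p = uea_ideal L +>\<^bsub>free_alg L\<^esub> p"

lemma uea_proj_hom: "ring_hom_ring (free_alg L) (uea L) uea_proj"
  using ideal.rcos_ring_hom_ring[OF ideal_uea] unfolding uea_proj_def[abs_def] uea_def .

lemma some_in_uea_proj:
  assumes p: "p \<in> carrier (free_alg L)"
  shows "\<exists>i\<in>uea_ideal L. (SOME q. q \<in> uea_proj p) = i + p"
proof -
  have eq: "uea_proj p = {i + p | i. i \<in> uea_ideal L}" by (auto simp: uea_proj_def a_r_coset_def')
  have "0 \<in> uea_ideal L"
    using additive_subgroup.zero_closed[OF ideal.axioms(1)[OF ideal_uea]] by simp
  then have "\<exists>q. q \<in> uea_proj p" unfolding eq by blast
  from someI_ex[OF this] show ?thesis unfolding eq by blast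
qed

text \<open>
  The member of the coset that the definition of \<open>R_act\<close> picks differs from \<open>p\<close> by an element of the
  ideal, which acts by \<open>0\<close>.
\<close>

lemma R_act_uea_proj:
  assumes "p \<in> carrier (free_alg L)" "u \<in> smooth_O2"
  shows "R_act (uea_proj p) u = R_free p u"
proof -
  obtain i where "i \<in> uea_ideal L" "(SOME q. q \<in> uea_proj p) = i + p" using some_in_uea_proj[OF assms(1)] by blast
  then show ?thesis by (simp add: R_act_def R_free_add uea_ideal_annihilates assms(2))
qed

text \<open>
  The relation is compatible with all ring operations, so the operator of a compound element of the
  enveloping algebra can be read off from the expression that defines it.
\<close>

definition acts where
  "acts d f \<longleftrightarrow> (\<exists>p\<in>carrier (free_alg L). d = uea_proj p \<and> (\<forall>u\<in>smooth_O2. R_free p u = f u))"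

lemma acts_carrier: "acts d f \<Longrightarrow> d \<in> carrier (uea L)"
proof -
  interpret ring_hom_ring "free_alg L" "uea L" uea_proj by (rule uea_proj_hom)
  show "acts d f \<Longrightarrow> d \<in> carrier (uea L)" by (auto simp: acts_def)
qed

lemma acts_R_act: "acts d f \<Longrightarrow> u \<in> smooth_O2 \<Longrightarrow> R_act d u = f u"
  by (auto simp: acts_def R_act_uea_proj)

lemma acts_smooth_O2: "acts d f \<Longrightarrow> u \<in> smooth_O2 \<Longrightarrow> f u \<in> smooth_O2"
  by (auto simp: acts_def) (metis R_free_smooth_O2[OF L_o2])

lemma acts_gen: "X \<in> L \<Longrightarrow> acts (uea_gen L X) (R_vec X)"
  by (auto simp: acts_def uea_gen_def uea_proj_def R_free_gen free_alg_closed)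

lemma acts_const: "acts (uea_const L c) (smul c)"
  by (auto simp: acts_def uea_const_def uea_proj_def R_free_const free_alg_closed)

lemma acts_mult:
  assumes "acts d f" "acts e g"
  shows "acts (d \<otimes>\<^bsub>uea L\<^esub> e) (\<lambda>u. f (g u))"
proof -
  interpret ring_hom_ring "free_alg L" "uea L" uea_proj by (rule uea_proj_hom)
  obtain p q where p: "p \<in> carrier (free_alg L)" "d = uea_proj p" "\<And>u. u \<in> smooth_O2 \<Longrightarrow> R_free p u = f u"
    and q: "q \<in> carrier (free_alg L)" "e = uea_proj q" "\<And>u. u \<in> smooth_O2 \<Longrightarrow> R_free q u = g u"
    using assms unfolding acts_def by blast
  show ?thesis unfolding acts_def
    using p q hom_mult[OF p(1) q(1)] acts_smooth_O2[OF assms(2)]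
    by (intro bexI[of _ "p * q"]) (auto simp: free_alg_closed R_free_mult[OF L_o2])
qed

lemma acts_add:
  assumes "acts d f" "acts e g"
  shows "acts (d \<oplus>\<^bsub>uea L\<^esub> e) (\<lambda>u. f u + g u)"
proof -
  interpret ring_hom_ring "free_alg L" "uea L" uea_proj by (rule uea_proj_hom)
  obtain p q where p: "p \<in> carrier (free_alg L)" "d = uea_proj p" "\<And>u. u \<in> smooth_O2 \<Longrightarrow> R_free p u = f u"
    and q: "q \<in> carrier (free_alg L)" "e = uea_proj q" "\<And>u. u \<in> smooth_O2 \<Longrightarrow> R_free q u = g u"
    using assms unfolding acts_def by blast
  show ?thesis unfolding acts_def
    using p q hom_add[OF p(1) q(1)]
    by (intro bexI[of _ "p + q"]) (auto simp: free_alg_closed R_free_add)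
qed

lemma acts_minus:
  assumes "acts d f"
  shows "acts (\<ominus>\<^bsub>uea L\<^esub> d) (\<lambda>u. - f u)"
proof -
  interpret ring_hom_ring "free_alg L" "uea L" uea_proj by (rule uea_proj_hom)
  obtain p where p: "p \<in> carrier (free_alg L)" "d = uea_proj p" "\<And>u. u \<in> smooth_O2 \<Longrightarrow> R_free p u = f u"
    using assms unfolding acts_def by blast
  have "uea_proj (- p) \<oplus>\<^bsub>uea L\<^esub> uea_proj p = \<zero>\<^bsub>uea L\<^esub>"
    using hom_add[of "- p" p] hom_zero p(1) by (simp add: free_alg_closed)
  then have "\<ominus>\<^bsub>uea L\<^esub> uea_proj p = uea_proj (- p)"
    using p(1) by (intro S.minus_equality) (auto simp: free_alg_closed)
  then show ?thesis unfolding acts_def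
    using p by (intro bexI[of _ "- p"]) (auto simp: free_alg_closed R_free_uminus)
qed

lemma acts_one: "acts \<one>\<^bsub>uea L\<^esub> (\<lambda>u. u)"
proof -
  interpret ring_hom_ring "free_alg L" "uea L" uea_proj by (rule uea_proj_hom)
  have "R_free 1 u = u" for u :: "'k gmat \<Rightarrow> complex"
    using R_free_single[of 0 1 u] by (simp add: word_op_simps fun_eq_iff)
  moreover have "\<one>\<^bsub>uea L\<^esub> = uea_proj 1" using hom_one by simp
  ultimately show ?thesis unfolding acts_def by (intro bexI[of _ 1]) (simp_all add: free_alg_closed)
qed

lemma acts_zero: "acts \<zero>\<^bsub>uea L\<^esub> (\<lambda>u. 0)"
proof -
  interpret ring_hom_ring "free_alg L" "uea L" uea_proj by (rule uea_proj_hom)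
  have "\<zero>\<^bsub>uea L\<^esub> = uea_proj 0" using hom_zero by simp
  then show ?thesis unfolding acts_def by (intro bexI[of _ 0]) (simp_all add: free_alg_closed)
qed

lemma acts_pow: "acts d f \<Longrightarrow> acts (d [^]\<^bsub>uea L\<^esub> (n::nat)) (f ^^ n)"
proof (induction n)
  case 0
  then show ?case using acts_one by (simp add: id_def)
next
  case (Suc n)
  from acts_mult[OF Suc.IH[OF Suc.prems] Suc.prems] show ?case
    by (simp add: funpow_Suc_right o_def del: funpow.simps)
qed

lemma acts_finsum:
  assumes "finite I" "\<And>i. i \<in> I \<Longrightarrow> acts (d i) (f i)"
  shows "acts (\<Oplus>\<^bsub>uea L\<^esub>i\<in>I. d i) (\<lambda>u. \<Sum>i\<in>I. f i u)"
  using assms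
proof (induction I)
  interpret ring_hom_ring "free_alg L" "uea L" uea_proj by (rule uea_proj_hom)
  case empty
  show ?case by (simp only: S.finsum_empty sum.empty acts_zero)
next
  interpret ring_hom_ring "free_alg L" "uea L" uea_proj by (rule uea_proj_hom)
  case (insert i I)
  have "(\<Oplus>\<^bsub>uea L\<^esub>i\<in>insert i I. d i) = d i \<oplus>\<^bsub>uea L\<^esub> (\<Oplus>\<^bsub>uea L\<^esub>i\<in>I. d i)"
    using insert by (intro S.finsum_insert) (auto intro: acts_carrier)
  then show ?case using acts_add[OF insert.prems[of i] insert.IH] insert
    by (simp only: sum.insert insert_iff simp_thms not_False_eq_True)
qed

end

section \<open>Commutators with the root vectors\<close>

lemma smul_simps:
  "smul c (u + v) = smul c u + smul c v" "smul c (smul d u) = smul (c * d) u"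
  "smul (c + d) u = smul c u + smul d u" "smul 1 u = u" "smul c 0 = 0" "smul 0 u = 0"
  by (simp_all add: fun_eq_iff algebra_simps)

lemma smul_sum: "smul c (sum f I) = (\<Sum>i\<in>I. smul c (f i))"
  by (simp add: fun_eq_iff sum_fun_apply sum_distrib_left)

lemma R_vec_sum:
  assumes "X \<in> o2" "\<And>i. i \<in> I \<Longrightarrow> f i \<in> smooth_O2"
  shows "R_vec X (sum f I) = (\<Sum>i\<in>I. R_vec X (f i))"
  using assms(2)
proof (induction I rule: infinite_finite_induct)
  case (insert i I)
  have "R_vec X (f i + sum f I) = R_vec X (f i) + R_vec X (sum f I)"
    using insert.prems by (intro R_vec_add assms(1) smooth_O2_sum) auto
  also have "R_vec X (sum f I) = (\<Sum>i\<in>I. R_vec X (f i))"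
    using insert.IH insert.prems by blast
  finally show ?case unfolding sum.insert[OF insert.hyps(1,2)] .
next
  case empty
  show ?case unfolding sum.empty by (rule R_vec_0)
next
  case (infinite A)
  show ?case unfolding sum.infinite[OF infinite(1)] by (rule R_vec_0)
qed

lemma smooth_O2_R [simp]: "X \<in> o2 \<Longrightarrow> u \<in> smooth_O2 \<Longrightarrow> R_vec X u \<in> smooth_O2"
  by (rule R_vec_smooth_O2)

lemmas smooth_O2_intros [simp] = smooth_O2_smul smooth_O2_add
lemmas o2_mem [simp] = o2_Hmat o2_Yn o2_Xn o2_Rot

lemma R_vec_zero_mat: "u \<in> smooth_O2 \<Longrightarrow> R_vec 0 u = 0"
  using R_vec_scaleR[of Hmat u 0] by (simp add: smul_simps o2_Hmat)

lemma R_vec_neg: "X \<in> o2 \<Longrightarrow> u \<in> smooth_O2 \<Longrightarrow> R_vec (- X) u = - R_vec X u"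
  using R_vec_scaleR[of X u "-1"] by (simp add: fun_eq_iff)

lemma H_Yn:
  assumes "a \<in> dirs" "u \<in> smooth_O2" "R_vec Hmat u = smul \<mu> u"
  shows "R_vec Hmat (R_vec (Yn a) u) = smul (\<mu> - 1) (R_vec (Yn a) u)"
proof -
  have "R_vec Hmat (R_vec (Yn a) u) = R_vec (Yn a) (smul \<mu> u) + R_vec (- Yn a) u"
    using R_vec_bracket[OF o2_Hmat o2_Yn[OF assms(1)] assms(2)] assms by (simp add: br_H_Yn)
  also have "\<dots> = smul (\<mu> - 1) (R_vec (Yn a) u)"
    using assms by (simp add: R_vec_smul R_vec_neg fun_eq_iff algebra_simps)
  finally show ?thesis .
qed

lemma Yn_Yn:
  assumes "a \<in> dirs" "b \<in> dirs" "u \<in> smooth_O2"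
  shows "R_vec (Yn a) (R_vec (Yn b) u) = R_vec (Yn b) (R_vec (Yn a) u)"
  using R_vec_bracket[OF o2_Yn[OF assms(1)] o2_Yn[OF assms(2)] assms(3)] assms
  by (simp add: br_Yn_Yn R_vec_zero_mat)

abbreviation ce :: "'j idx \<Rightarrow> complex" where
  "ce a \<equiv> complex_of_real (eps a)"

lemma ce_square [simp]: "ce a * ce a = 1" "ce a * (ce a * z) = z"
  by (auto simp: eps_def)

lemma Xn_Yn_same:
  assumes "a \<in> dirs" "u \<in> smooth_O2"
  shows "R_vec (Xn a) (R_vec (Yn a) u) = R_vec (Yn a) (R_vec (Xn a) u) + smul 2 (R_vec Hmat u)"
  using R_vec_bracket[OF o2_Xn[OF assms(1)] o2_Yn[OF assms(1)] assms(2)] assms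
  by (simp add: br_Xn_Yn R_vec_scaleR)

lemma Xn_Yn_other:
  assumes "a \<in> dirs" "b \<in> dirs" "a \<noteq> b" "u \<in> smooth_O2"
  shows "R_vec (Xn a) (R_vec (Yn b) u) = R_vec (Yn b) (R_vec (Xn a) u) + smul (2 * ce a) (R_vec (Rot a b) u)"
  using R_vec_bracket[OF o2_Xn[OF assms(1)] o2_Yn[OF assms(2)] assms(4)] assms
  by (simp add: br_Xn_Yn R_vec_scaleR)

lemma Rot_Yn:
  assumes "a \<in> dirs" "b \<in> dirs" "c \<in> dirs" "u \<in> smooth_O2"
  shows "R_vec (Rot a b) (R_vec (Yn c) u) = R_vec (Yn c) (R_vec (Rot a b) u)
    + (if c = b then smul (ce b) (R_vec (Yn a) u) else 0) + (if c = a then smul (- ce a) (R_vec (Yn b) u) else 0)"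
proof -
  have s: "R_vec (x - y) u = R_vec x u + R_vec (- 1 *\<^sub>R y) u" if "x \<in> o2" "y \<in> o2" for x y
    using R_vec_linear(1)[OF that(1) subspace_neg[OF subspace_o2 that(2)] assms(4)] by simp
  have o0: "0 \<in> o2" by (rule subspace_0[OF subspace_o2])
  have "R_vec (mbracket (Rot a b) (Yn c)) u
    = (if c = b then smul (ce b) (R_vec (Yn a) u) else 0) + (if c = a then smul (- ce a) (R_vec (Yn b) u) else 0)"
    unfolding br_Rot_Yn[OF assms(1-3)]
    using s[of "eps b *\<^sub>R Yn a" "eps a *\<^sub>R Yn b"] assms subspace_scale[OF subspace_o2 o2_Yn]
    by (auto simp: R_vec_zero_mat R_vec_scaleR R_vec_neg fun_eq_iff subspace_scale[OF subspace_o2])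
  then show ?thesis
    using R_vec_bracket[OF o2_Rot[OF assms(1,2)] o2_Yn[OF assms(3)] assms(4)] by (simp only: add.assoc)
qed

section \<open>The Laplacian in the tangential directions\<close>

text \<open>
  The directions of the larger group that come from the smaller one; the normal direction is \<open>Ix None\<close>.
\<close>

definition tangential :: "('j::finite) option idx set" where
  "tangential = up ` dirs"

lemma tangential_dirs [simp]: "a \<in> tangential \<Longrightarrow> a \<in> dirs"
  by (auto simp: tangential_def)

lemma tangential_None [simp]: "a \<in> tangential \<Longrightarrow> a \<noteq> Ix None" "a \<in> tangential \<Longrightarrow> Ix None \<noteq> a"
  by (auto simp: tangential_def)

lemma dirs_None [simp]: "Ix None \<in> dirs"
  by simp

lemma card_tangential: "card (tangential :: ('j::finite) option idx set) = CARD('j) + 2"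
proof -
  have "card (tangential :: 'j option idx set) = card (dirs :: 'j idx set)"
    unfolding tangential_def by (rule card_image) (auto simp: inj_on_def)
  also have "card (dirs :: 'j idx set) = Suc (Suc (card (range (Ix :: 'j \<Rightarrow> _))))"
    unfolding dirs_eq by (subst card_insert_disjoint; auto)+
  also have "card (range (Ix :: 'j \<Rightarrow> _)) = CARD('j)"
    by (rule card_image) (auto simp: inj_on_def)
  finally show ?thesis by simp
qed

text \<open>
  The operator of \<open>\<Delta>\<close>; see \<open>acts_Lap\<close>.
\<close>

definition Lap_op :: "(('j::finite) option gmat \<Rightarrow> complex) \<Rightarrow> ('j option gmat \<Rightarrow> complex)" where
  "Lap_op u = (\<Sum>a\<in>tangential. smul (ce a) (R_vec (Yn a) (R_vec (Yn a) u)))"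

abbreviation T_op :: "(('j::finite) option gmat \<Rightarrow> complex) \<Rightarrow> ('j option gmat \<Rightarrow> complex)" where
  "T_op \<equiv> R_vec (Yn (Ix None))"

lemma Lap_op_smooth_O2 [simp]: "u \<in> smooth_O2 \<Longrightarrow> Lap_op u \<in> smooth_O2"
  unfolding Lap_op_def by (intro smooth_O2_sum) simp

lemma Lap_op_add: "u \<in> smooth_O2 \<Longrightarrow> v \<in> smooth_O2 \<Longrightarrow> Lap_op (u + v) = Lap_op u + Lap_op v"
  unfolding Lap_op_def sum.distrib[symmetric] by (intro sum.cong) (simp_all add: R_vec_add smul_simps)

lemma Lap_op_smul: "u \<in> smooth_O2 \<Longrightarrow> Lap_op (smul c u) = smul c (Lap_op u)"
  unfolding Lap_op_def smul_sum by (intro sum.cong) (simp_all add: R_vec_smul smul_simps mult.commute)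

lemma Lap_op_zero: "Lap_op 0 = 0"
  unfolding Lap_op_def by (rule sum.neutral) (simp only: R_vec_0 smul_simps, blast)

lemma Lap_op_pow_smooth_O2 [simp]: "u \<in> smooth_O2 \<Longrightarrow> (Lap_op ^^ j) u \<in> smooth_O2"
  by (induction j) simp_all

lemma T_op_pow_smooth_O2 [simp]: "u \<in> smooth_O2 \<Longrightarrow> (T_op ^^ j) u \<in> smooth_O2"
  by (induction j) simp_all

lemma Lap_op_Yn:
  assumes "c \<in> dirs" "u \<in> smooth_O2"
  shows "R_vec (Yn c) (Lap_op u) = Lap_op (R_vec (Yn c) u)"
proof -
  have "R_vec (Yn c) (Lap_op u) = (\<Sum>a\<in>tangential. R_vec (Yn c) (smul (ce a) (R_vec (Yn a) (R_vec (Yn a) u))))"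
    unfolding Lap_op_def using assms by (intro R_vec_sum) simp_all
  also have "\<dots> = Lap_op (R_vec (Yn c) u)"
    unfolding Lap_op_def
  proof (intro sum.cong refl)
    fix a :: "'a option idx" assume "a \<in> tangential"
    then show "R_vec (Yn c) (smul (ce a) (R_vec (Yn a) (R_vec (Yn a) u)))
        = smul (ce a) (R_vec (Yn a) (R_vec (Yn a) (R_vec (Yn c) u)))"
      using assms Yn_Yn[of c a "R_vec (Yn a) u"] Yn_Yn[of c a u] by (simp add: R_vec_smul)
  qed
  finally show ?thesis .
qed

lemma Lap_op_pow_Yn: "c \<in> dirs \<Longrightarrow> u \<in> smooth_O2 \<Longrightarrow> R_vec (Yn c) ((Lap_op ^^ j) u) = (Lap_op ^^ j) (R_vec (Yn c) u)"
  by (induction j) (simp_all add: Lap_op_Yn)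

lemma H_Lap_op:
  assumes "u \<in> smooth_O2" "R_vec Hmat u = smul \<mu> u"
  shows "R_vec Hmat (Lap_op u) = smul (\<mu> - 2) (Lap_op u)"
proof -
  have "R_vec Hmat (Lap_op u) = (\<Sum>a\<in>tangential. R_vec Hmat (smul (ce a) (R_vec (Yn a) (R_vec (Yn a) u))))"
    unfolding Lap_op_def using assms by (intro R_vec_sum) simp_all
  also have "\<dots> = smul (\<mu> - 2) (Lap_op u)"
    unfolding Lap_op_def smul_sum
  proof (intro sum.cong refl)
    fix a :: "'a option idx" assume a: "a \<in> tangential"
    have "R_vec Hmat (R_vec (Yn a) (R_vec (Yn a) u)) = smul (\<mu> - 1 - 1) (R_vec (Yn a) (R_vec (Yn a) u))"
      by (intro H_Yn) (use a assms in simp_all)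
    then show "R_vec Hmat (smul (ce a) (R_vec (Yn a) (R_vec (Yn a) u)))
        = smul (\<mu> - 2) (smul (ce a) (R_vec (Yn a) (R_vec (Yn a) u)))"
      using a assms by (simp add: R_vec_smul smul_simps mult.commute)
  qed
  finally show ?thesis .
qed

lemma H_T_op_pow:
  assumes "u \<in> smooth_O2" "R_vec Hmat u = smul \<mu> u"
  shows "R_vec Hmat ((T_op ^^ b) u) = smul (\<mu> - of_nat b) ((T_op ^^ b) u)"
proof (induction b)
  case (Suc b)
  then show ?case using H_Yn[OF dirs_None T_op_pow_smooth_O2[OF assms(1)] Suc.IH] by (simp add: algebra_simps)
qed (simp add: assms)

lemma H_Lap_op_pow:
  assumes "u \<in> smooth_O2" "R_vec Hmat u = smul \<mu> u"
  shows "R_vec Hmat ((Lap_op ^^ j) u) = smul (\<mu> - 2 * of_nat j) ((Lap_op ^^ j) u)"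
proof (induction j)
  case (Suc b)
  then show ?case using H_Lap_op[OF Lap_op_pow_smooth_O2[OF assms(1)] Suc.IH] by (simp add: algebra_simps)
qed (simp add: assms)

text \<open>
  The Laplacian is invariant: the contributions of \<open>c = a\<close> and \<open>c = b\<close> cancel because the lowering vectors
  commute.
\<close>

lemma Rot_Lap_op:
  assumes "a \<in> tangential" "b \<in> tangential" "u \<in> smooth_O2"
  shows "R_vec (Rot a b) (Lap_op u) = Lap_op (R_vec (Rot a b) u)"
proof -
  let ?Y = "\<lambda>a. R_vec (Yn a)" and ?R = "R_vec (Rot a b)"
  have step: "?R (?Y c (?Y c u)) = ?Y c (?Y c (?R u))
      + (if c = b then smul (2 * ce b) (?Y a (?Y b u)) else 0)
      + (if c = a then smul (- 2 * ce a) (?Y a (?Y b u)) else 0)" if c: "c \<in> tangential" for c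
  proof (cases "c = b"; cases "c = a")
    show ?thesis if "c = b" "c = a"
      using that assms by (simp add: R_vec_zero_mat R_vec_0 fun_eq_iff)
    show ?thesis if h: "c = b" "c \<noteq> a"
    proof -
      have "?R (?Y b u) = ?Y b (?R u) + smul (ce b) (?Y a u)"
        using Rot_Yn[of a b b u] h assms by simp
      moreover have "?R (?Y b (?Y b u)) = ?Y b (?R (?Y b u)) + smul (ce b) (?Y a (?Y b u))"
        using Rot_Yn[of a b b "?Y b u"] h assms by simp
      ultimately have "?R (?Y b (?Y b u)) = ?Y b (?Y b (?R u)) + smul (ce b) (?Y b (?Y a u)) + smul (ce b) (?Y a (?Y b u))"
        using assms by (simp add: R_vec_add R_vec_smul)
      then show ?thesis
        using h assms Yn_Yn[of a b u] by (simp add: fun_eq_iff algebra_simps)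
    qed
    show ?thesis if h: "c \<noteq> b" "c = a"
    proof -
      have "?R (?Y a u) = ?Y a (?R u) + smul (- ce a) (?Y b u)"
        using Rot_Yn[of a b a u] h assms by simp
      moreover have "?R (?Y a (?Y a u)) = ?Y a (?R (?Y a u)) + smul (- ce a) (?Y b (?Y a u))"
        using Rot_Yn[of a b a "?Y a u"] h assms by simp
      ultimately have "?R (?Y a (?Y a u)) = ?Y a (?Y a (?R u)) + smul (- ce a) (?Y a (?Y b u)) + smul (- ce a) (?Y b (?Y a u))"
        using assms by (simp add: R_vec_add R_vec_smul)
      then show ?thesis
        using h assms Yn_Yn[of a b u] by (simp add: fun_eq_iff algebra_simps)
    qed
    show ?thesis if "c \<noteq> b" "c \<noteq> a"
      using that assms c Rot_Yn[of a b c u] Rot_Yn[of a b c "?Y c u"] by simp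
  qed
  have "?R (Lap_op u) = (\<Sum>c\<in>tangential. ?R (smul (ce c) (?Y c (?Y c u))))"
    unfolding Lap_op_def using assms by (intro R_vec_sum) simp_all
  also have "\<dots> = (\<Sum>c\<in>tangential. smul (ce c) (?Y c (?Y c (?R u)))
      + (if c = b then smul 2 (?Y a (?Y b u)) else 0) + (if c = a then smul (- 2) (?Y a (?Y b u)) else 0))"
  proof (intro sum.cong refl)
    fix c :: "'a option idx" assume c: "c \<in> tangential"
    have "?R (smul (ce c) (?Y c (?Y c u))) = smul (ce c) (?R (?Y c (?Y c u)))"
      using assms c by (simp add: R_vec_smul)
    then show "?R (smul (ce c) (?Y c (?Y c u))) = smul (ce c) (?Y c (?Y c (?R u)))
      + (if c = b then smul 2 (?Y a (?Y b u)) else 0) + (if c = a then smul (- 2) (?Y a (?Y b u)) else 0)"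
      unfolding step[OF c] by (auto simp: fun_eq_iff algebra_simps)
  qed
  also have "\<dots> = Lap_op (?R u)"
    using assms by (simp only: sum.distrib sum.delta finite) (simp add: Lap_op_def fun_eq_iff)
  finally show ?thesis .
qed

text \<open>
  The summand \<open>c = a\<close> of the Laplacian contributes through \<open>H\<close>, and each other summand through the
  rotation of the plane \<open>(a, c)\<close>; this is where the dimension enters.
\<close>

lemma Xn_Lap_op:
  assumes a: "a \<in> tangential" and u: "u \<in> smooth_O2" and H: "R_vec Hmat u = smul \<mu> u"
    and R: "\<And>c. c \<in> tangential \<Longrightarrow> R_vec (Rot a c) u = 0"
  shows "R_vec (Xn a) (Lap_op u) = Lap_op (R_vec (Xn a) u)
    + smul (ce a * (4 * \<mu> - 4 + 2 * of_nat (card (tangential :: ('j::finite) option idx set)))) (R_vec (Yn a) (u :: 'j option gmat \<Rightarrow> complex))"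
proof -
  let ?Y = "\<lambda>a. R_vec (Yn a)" and ?X = "R_vec (Xn a)"
  have same: "?X (?Y a (?Y a u)) = ?Y a (?Y a (?X u)) + smul (4 * \<mu> - 2) (?Y a u)"
  proof -
    have "?X (?Y a (?Y a u)) = ?Y a (?X (?Y a u)) + smul (2 * (\<mu> - 1)) (?Y a u)"
      using Xn_Yn_same[of a "?Y a u"] H_Yn[of a u \<mu>] a u H by (simp add: smul_simps)
    moreover have "?X (?Y a u) = ?Y a (?X u) + smul (2 * \<mu>) u"
      using Xn_Yn_same[of a u] a u H by (simp add: smul_simps)
    ultimately show ?thesis
      using a u by (simp add: R_vec_add R_vec_smul fun_eq_iff algebra_simps)
  qed
  have other: "?X (?Y c (?Y c u)) = ?Y c (?Y c (?X u)) + smul (2 * ce a * ce c) (?Y a u)"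
    if c: "c \<in> tangential" "c \<noteq> a" for c
  proof -
    have "R_vec (Rot a c) (?Y c u) = smul (ce c) (?Y a u)"
      using Rot_Yn[of a c c u] a c u R[OF c(1)] R_vec_0[of "Yn c"] by (simp add: fun_eq_iff)
    then have "?X (?Y c (?Y c u)) = ?Y c (?X (?Y c u)) + smul (2 * ce a * ce c) (?Y a u)"
      using Xn_Yn_other[of a c "?Y c u"] a c u by (simp add: smul_simps)
    moreover have "?X (?Y c u) = ?Y c (?X u)"
      using Xn_Yn_other[of a c u] a c u R[OF c(1)] by (simp add: fun_eq_iff)
    ultimately show ?thesis by simp
  qed
  have "?X (Lap_op u) = (\<Sum>c\<in>tangential. ?X (smul (ce c) (?Y c (?Y c u))))"
    unfolding Lap_op_def using a u by (intro R_vec_sum) simp_all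
  also have "\<dots> = (\<Sum>c\<in>tangential. smul (ce c) (?Y c (?Y c (?X u))) + smul (2 * ce a) (?Y a u)
      + (if c = a then smul (ce a * (4 * \<mu> - 4)) (?Y a u) else 0))"
  proof (intro sum.cong refl)
    fix c :: "'j option idx" assume c: "c \<in> tangential"
    have "?X (smul (ce c) (?Y c (?Y c u))) = smul (ce c) (?X (?Y c (?Y c u)))"
      using a u c by (simp add: R_vec_smul)
    then show "?X (smul (ce c) (?Y c (?Y c u))) = smul (ce c) (?Y c (?Y c (?X u))) + smul (2 * ce a) (?Y a u)
      + (if c = a then smul (ce a * (4 * \<mu> - 4)) (?Y a u) else 0)"
      using same other[OF c] by (cases "c = a") (auto simp: fun_eq_iff algebra_simps)
  qed
  also have "\<dots> = Lap_op (?X u) + smul (2 * ce a * of_nat (card (tangential :: 'j option idx set))) (?Y a u)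
      + smul (ce a * (4 * \<mu> - 4)) (?Y a u)"
  proof -
    have "(\<Sum>c\<in>(tangential :: 'j option idx set). smul (2 * ce a) (?Y a u))
        = smul (2 * ce a * of_nat (card (tangential :: 'j option idx set))) (?Y a u)"
      by (simp add: fun_eq_iff sum_fun_apply mult_ac)
    then show ?thesis using a by (simp only: sum.distrib sum.delta finite Lap_op_def if_True)
  qed
  finally show ?thesis by (simp add: fun_eq_iff algebra_simps)
qed

lemma Rot_T_op_pow:
  assumes "a \<in> tangential" "b \<in> tangential" "u \<in> smooth_O2" "R_vec (Rot a b) u = 0"
  shows "R_vec (Rot a b) ((T_op ^^ j) u) = 0"
proof (induction j)
  case 0
  then show ?case using assms(4) by (simp only: funpow_0)
next
  case (Suc j)
  have "R_vec (Rot a b) (T_op ((T_op ^^ j) u)) = T_op (R_vec (Rot a b) ((T_op ^^ j) u))"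
    using Rot_Yn[of a b "Ix None" "(T_op ^^ j) u"] assms by simp
  then show ?case by (simp only: Suc.IH R_vec_0 funpow.simps o_apply)
qed

lemma Rot_Lap_op_pow:
  assumes "a \<in> tangential" "b \<in> tangential" "u \<in> smooth_O2" "R_vec (Rot a b) u = 0"
  shows "R_vec (Rot a b) ((Lap_op ^^ j) u) = 0"
proof (induction j)
  case 0
  then show ?case using assms(4) by (simp only: funpow_0)
next
  case (Suc j)
  then show ?case
    by (simp only: funpow.simps o_apply Rot_Lap_op[OF assms(1,2) Lap_op_pow_smooth_O2[OF assms(3)]] Lap_op_zero)
qed

text \<open>
  The rotation of the plane of \<open>a\<close> and the normal direction turns each of the \<open>j\<close> factors \<open>T\<close> into \<open>Y\<^sub>a\<close> in
  turn.
\<close>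

lemma Rot_normal_T_op_pow:
  assumes a: "a \<in> tangential" and u: "u \<in> smooth_O2" and R: "R_vec (Rot a (Ix None)) u = 0"
  shows "R_vec (Rot a (Ix None)) ((T_op ^^ j) u) = smul (of_nat j) (R_vec (Yn a) ((T_op ^^ (j - 1)) u))"
proof (induction j)
  case 0
  then show ?case using R by (simp add: smul_simps)
next
  case (Suc j)
  let ?R = "R_vec (Rot a (Ix None))"
  have [simp]: "eps (Ix None) = 1" by (simp add: eps_def)
  have "?R (T_op ((T_op ^^ j) u)) = T_op (?R ((T_op ^^ j) u)) + R_vec (Yn a) ((T_op ^^ j) u)"
    using Rot_Yn[of a "Ix None" "Ix None" "(T_op ^^ j) u"] a u by (simp add: smul_simps)
  also have "T_op (?R ((T_op ^^ j) u)) = smul (of_nat j) (R_vec (Yn a) (T_op ((T_op ^^ (j - 1)) u)))"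
    unfolding Suc.IH using a u by (subst R_vec_smul) (simp_all add: Yn_Yn[of "Ix None" a])
  also have "\<dots> = smul (of_nat j) (R_vec (Yn a) ((T_op ^^ j) u))"
    by (cases j) (simp_all add: smul_simps)
  finally show ?case by (simp add: fun_eq_iff algebra_simps)
qed

text \<open>
  Each step of the induction adds a rotation applied to \<open>T\<^sup>j u\<close>, and \<open>2 (0 + 1 + \<dots> + (j - 1)) = j (j - 1)\<close>.
  The exponent \<open>j - 2\<close> is truncated only where the factor in front is \<open>0\<close>.
\<close>

lemma Xn_T_op_pow:
  assumes a: "a \<in> tangential" and u: "u \<in> smooth_O2" and R: "R_vec (Rot a (Ix None)) u = 0"
    and X: "R_vec (Xn a) u = 0"
  shows "R_vec (Xn a) ((T_op ^^ j) u) = smul (ce a * of_nat (j * (j - 1))) (R_vec (Yn a) ((T_op ^^ (j - 2)) u))"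
proof (induction j)
  case 0
  then show ?case using X by (simp add: smul_simps)
next
  case (Suc j)
  have "R_vec (Xn a) (T_op ((T_op ^^ j) u)) = T_op (R_vec (Xn a) ((T_op ^^ j) u))
      + smul (2 * ce a) (smul (of_nat j) (R_vec (Yn a) ((T_op ^^ (j - 1)) u)))"
    using Xn_Yn_other[of a "Ix None" "(T_op ^^ j) u"] a u Rot_normal_T_op_pow[OF a u R] by simp
  also have "T_op (R_vec (Xn a) ((T_op ^^ j) u)) = smul (ce a * of_nat (j * (j - 1))) (R_vec (Yn a) (T_op ((T_op ^^ (j - 2)) u)))"
    unfolding Suc.IH using a u by (subst R_vec_smul) (simp_all add: Yn_Yn[of "Ix None" a])
  also have "\<dots> = smul (ce a * of_nat (j * (j - 1))) (R_vec (Yn a) ((T_op ^^ (j - 1)) u))"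
  proof (cases "j \<ge> 2")
    case True
    then have "j - 1 = Suc (j - 2)" by simp
    then show ?thesis by (simp only: funpow.simps o_apply)
  next
    case False
    then have "j * (j - 1) = 0" by (cases j) auto
    then show ?thesis by (simp only: of_nat_0 mult_zero_right smul_simps)
  qed
  finally show ?case
    by (cases j) (simp_all add: fun_eq_iff algebra_simps)
qed

text \<open>
  The factor is the sum of the contributions of the single steps, in which the weight drops by 2 each time.
  The exponent \<open>j - 1\<close> is truncated only for \<open>j = 0\<close>, where the factor in front is \<open>0\<close>.
\<close>

lemma Xn_Lap_op_pow:
  assumes a: "a \<in> tangential" and u: "u \<in> smooth_O2" and H: "R_vec Hmat u = smul \<mu> u"
    and R: "\<And>c. c \<in> tangential \<Longrightarrow> R_vec (Rot a c) u = 0"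
  shows "R_vec (Xn a) ((Lap_op ^^ j) u) = (Lap_op ^^ j) (R_vec (Xn a) u)
    + smul (ce a * of_nat j * (4 * \<mu> - 4 * of_nat j + 2 * of_nat (card (tangential :: ('j::finite) option idx set))))
        (R_vec (Yn a) ((Lap_op ^^ (j - 1)) (u :: 'j option gmat \<Rightarrow> complex)))"
proof (induction j)
  case 0
  then show ?case by (simp add: smul_simps)
next
  case (Suc j)
  let ?m = "of_nat (card (tangential :: 'j option idx set)) :: complex"
  let ?c = "ce a * of_nat j * (4 * \<mu> - 4 * of_nat j + 2 * ?m)"
  let ?d = "ce a * (4 * (\<mu> - 2 * of_nat j) - 4 + 2 * ?m)"
  have "R_vec (Xn a) (Lap_op ((Lap_op ^^ j) u)) = Lap_op (R_vec (Xn a) ((Lap_op ^^ j) u)) + smul ?d (R_vec (Yn a) ((Lap_op ^^ j) u))"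
    by (rule Xn_Lap_op[OF a Lap_op_pow_smooth_O2[OF u] H_Lap_op_pow[OF u H] Rot_Lap_op_pow[OF a _ u R]])
  also have "Lap_op (R_vec (Xn a) ((Lap_op ^^ j) u)) = Lap_op ((Lap_op ^^ j) (R_vec (Xn a) u)) + smul ?c (Lap_op (R_vec (Yn a) ((Lap_op ^^ (j - 1)) u)))"
    unfolding Suc.IH using a u by (simp add: Lap_op_add Lap_op_smul)
  also have "smul ?c (Lap_op (R_vec (Yn a) ((Lap_op ^^ (j - 1)) u))) = smul ?c (R_vec (Yn a) ((Lap_op ^^ j) u))"
    using a u Lap_op_Yn[of a "(Lap_op ^^ (j - 1)) u"] by (cases j) (simp_all add: smul_simps)
  finally show ?case by (simp add: fun_eq_iff algebra_simps)
qed

section \<open>The intertwining family\<close>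

text \<open>
  The operator of \<open>\<D>\<^sub>N\<^sup>0(\<lambda>)\<close> with coefficients \<open>c\<close>; see \<open>acts_D0\<close>.
\<close>

definition D_op :: "(nat \<Rightarrow> complex) \<Rightarrow> nat \<Rightarrow> (('j::finite) option gmat \<Rightarrow> complex) \<Rightarrow> ('j option gmat \<Rightarrow> complex)" where
  "D_op c N u = (\<Sum>j\<in>{0..N div 2}. smul (c j) ((Lap_op ^^ j) ((T_op ^^ (N - 2 * j)) u)))"

lemma D_op_smooth_O2: "u \<in> smooth_O2 \<Longrightarrow> D_op c N u \<in> smooth_O2"
  unfolding D_op_def by (intro smooth_O2_sum) simp

lemma R_vec_D_op:
  assumes "X \<in> o2" "u \<in> smooth_O2"
  shows "R_vec X (D_op c N u) = (\<Sum>j\<in>{0..N div 2}. smul (c j) (R_vec X ((Lap_op ^^ j) ((T_op ^^ (N - 2 * j)) u))))"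
proof -
  have "R_vec X (D_op c N u) = (\<Sum>j\<in>{0..N div 2}. R_vec X (smul (c j) ((Lap_op ^^ j) ((T_op ^^ (N - 2 * j)) u))))"
    unfolding D_op_def using assms by (intro R_vec_sum) simp_all
  then show ?thesis using assms by (simp only: R_vec_smul Lap_op_pow_smooth_O2 T_op_pow_smooth_O2)
qed

lemma H_D_op:
  assumes u: "u \<in> smooth_O2" and H: "R_vec Hmat u = smul lam u"
  shows "R_vec Hmat (D_op c N u) = smul (lam - of_nat N) (D_op c N u)"
  unfolding R_vec_D_op[OF o2_Hmat u] unfolding D_op_def smul_sum
proof (intro sum.cong refl)
  fix j assume "j \<in> {0..N div 2}"
  then have j: "2 * j \<le> N" by auto
  have "lam - of_nat (N - 2 * j) - 2 * of_nat j = lam - of_nat N"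
    using j by (simp add: of_nat_diff)
  with H_Lap_op_pow[OF T_op_pow_smooth_O2[OF u] H_T_op_pow[OF u H], of j "N - 2 * j"]
  have "R_vec Hmat ((Lap_op ^^ j) ((T_op ^^ (N - 2 * j)) u)) = smul (lam - of_nat N) ((Lap_op ^^ j) ((T_op ^^ (N - 2 * j)) u))"
    by simp
  then show "smul (c j) (R_vec Hmat ((Lap_op ^^ j) ((T_op ^^ (N - 2 * j)) u)))
      = smul (lam - of_nat N) (smul (c j) ((Lap_op ^^ j) ((T_op ^^ (N - 2 * j)) u)))"
    by (simp add: smul_simps mult.commute)
qed

lemma Rot_D_op:
  assumes ab: "a \<in> tangential" "b \<in> tangential" and u: "u \<in> smooth_O2" and R: "R_vec (Rot a b) u = 0"
  shows "R_vec (Rot a b) (D_op c N u) = 0"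
  unfolding R_vec_D_op[OF o2_Rot[OF tangential_dirs[OF ab(1)] tangential_dirs[OF ab(2)]] u]
  by (rule sum.neutral)
    (simp only: Rot_Lap_op_pow[OF ab T_op_pow_smooth_O2[OF u] Rot_T_op_pow[OF ab u R]] smul_simps, blast)

text \<open>
  Moving the raising vector through \<open>\<Delta>\<^sup>j T\<^sup>N\<^sup>-\<^sup>2\<^sup>j u\<close> produces one term from \<open>T\<close>, with
  \<open>\<Delta>\<^sup>j\<close> and two factors \<open>T\<close> less, and one term from \<open>\<Delta>\<close>, with \<open>\<Delta>\<^sup>j\<^sup>-\<^sup>1\<close> and as many factors \<open>T\<close> as before.
  The first term for \<open>j - 1\<close> and the second term for \<open>j\<close> are multiples of the same function, and the
  recursion says that they cancel.
\<close>

lemma Xn_D_op: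
  fixes u :: "('j::finite) option gmat \<Rightarrow> complex"
  assumes a: "a \<in> tangential" and u: "u \<in> smooth_O2" and H: "R_vec Hmat u = smul lam u"
    and R: "\<And>c. c \<in> dirs \<Longrightarrow> R_vec (Rot a c) u = 0" and X: "R_vec (Xn a) u = 0"
    and rec: "\<And>j. 1 \<le> j \<Longrightarrow> j \<le> N div 2 \<Longrightarrow>
      of_nat ((N - 2 * j + 2) * (N - 2 * j + 1)) * c (j - 1)
      + 2 * of_nat j * (of_nat (card (tangential :: 'j option idx set)) + 2 * lam - 2 * of_nat N + 2 * of_nat j) * c j = 0"
  shows "R_vec (Xn a) (D_op c N u) = 0"
proof -
  let ?k = "N div 2" and ?m = "of_nat (card (tangential :: 'j option idx set)) :: complex"
  let ?W = "\<lambda>j. R_vec (Yn a) ((Lap_op ^^ j) ((T_op ^^ (N - 2 * j - 2)) u))"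
  let ?p = "\<lambda>j. of_nat ((N - 2 * j) * (N - 2 * j - 1)) :: complex"
  let ?q = "\<lambda>j. of_nat j * (4 * (lam - of_nat (N - 2 * j)) - 4 * of_nat j + 2 * ?m)"
  have expand: "R_vec (Xn a) ((Lap_op ^^ j) ((T_op ^^ (N - 2 * j)) u))
      = smul (ce a * ?p j) (?W j) + smul (ce a * ?q j) (R_vec (Yn a) ((Lap_op ^^ (j - 1)) ((T_op ^^ (N - 2 * j)) u)))" for j
  proof -
    let ?v = "(T_op ^^ (N - 2 * j)) u"
    have "R_vec (Xn a) ((Lap_op ^^ j) ?v) = (Lap_op ^^ j) (R_vec (Xn a) ?v)
        + smul (ce a * of_nat j * (4 * (lam - of_nat (N - 2 * j)) - 4 * of_nat j + 2 * ?m)) (R_vec (Yn a) ((Lap_op ^^ (j - 1)) ?v))"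
      by (rule Xn_Lap_op_pow[OF a T_op_pow_smooth_O2[OF u] H_T_op_pow[OF u H] Rot_T_op_pow[OF a _ u R[OF tangential_dirs]]])
    moreover have "(Lap_op ^^ j) (R_vec (Xn a) ?v) = smul (ce a * ?p j) (?W j)"
    proof -
      have L: "(Lap_op ^^ j) (smul d v) = smul d ((Lap_op ^^ j) v)" if "v \<in> smooth_O2" for d and v :: "'j option gmat \<Rightarrow> complex"
        using that by (induction j) (simp_all add: Lap_op_smul)
      show ?thesis
        using a u by (simp add: Xn_T_op_pow[OF a u R[OF dirs_None] X] L Lap_op_pow_Yn)
    qed
    ultimately show ?thesis by (simp add: mult.assoc)
  qed
  have "R_vec (Xn a) (D_op c N u) x = 0" for x
  proof -
    have "R_vec (Xn a) (D_op c N u) x = (\<Sum>j\<in>{0..?k}. c j * (ce a * ?p j) * ?W j x)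
        + (\<Sum>j\<in>{0..?k}. c j * (ce a * ?q j) * R_vec (Yn a) ((Lap_op ^^ (j - 1)) ((T_op ^^ (N - 2 * j)) u)) x)"
      unfolding R_vec_D_op[OF o2_Xn[OF tangential_dirs[OF a]] u] expand
      unfolding sum_fun_apply sum.distrib[symmetric]
      by (intro sum.cong refl) (simp only: smul_apply plus_fun_apply ring_distribs mult.assoc)
    \<comment> \<open>the top term vanishes, since \<open>N - 2 (N div 2)\<close> is \<open>0\<close> or \<open>1\<close>\<close>
    also have "(\<Sum>j\<in>{0..?k}. c j * (ce a * ?p j) * ?W j x) = (\<Sum>j\<in>{0..<?k}. c j * (ce a * ?p j) * ?W j x)"
    proof -
      have "(N - 2 * ?k) * (N - 2 * ?k - 1) = 0" by (cases "even N") (auto elim: oddE)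
      then have "?p ?k = 0" by (simp only: of_nat_0)
      moreover have "{0..?k} = insert ?k {0..<?k}" by auto
      ultimately show ?thesis by simp
    qed
    also have "\<dots> = (\<Sum>j\<in>{1..?k}. c (j - 1) * (ce a * ?p (j - 1)) * ?W (j - 1) x)"
      by (rule sum.reindex_bij_witness[of _ "\<lambda>j. j - 1" Suc]) auto
    also have "(\<Sum>j\<in>{0..?k}. c j * (ce a * ?q j) * R_vec (Yn a) ((Lap_op ^^ (j - 1)) ((T_op ^^ (N - 2 * j)) u)) x)
        = (\<Sum>j\<in>{1..?k}. c j * (ce a * ?q j) * R_vec (Yn a) ((Lap_op ^^ (j - 1)) ((T_op ^^ (N - 2 * j)) u)) x)"
      by (rule sum.mono_neutral_right) (auto simp: not_le)
    also have "(\<Sum>j\<in>{1..?k}. c (j - 1) * (ce a * ?p (j - 1)) * ?W (j - 1) x) + \<dots> = 0"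
      unfolding sum.distrib[symmetric]
    proof (rule sum.neutral, intro ballI)
      fix j assume "j \<in> {1..?k}"
      then have j: "1 \<le> j" "j \<le> ?k" "2 * j \<le> N" by auto
      have e: "N - 2 * (j - 1) - 2 = N - 2 * j" "N - 2 * (j - 1) = N - 2 * j + 2" "N - 2 * j + 2 - 1 = N - 2 * j + 1"
        using j by auto
      have q: "?q j = 2 * of_nat j * (?m + 2 * lam - 2 * of_nat N + 2 * of_nat j)"
        using j(3) by (simp add: of_nat_diff algebra_simps)
      let ?w = "R_vec (Yn a) ((Lap_op ^^ (j - 1)) ((T_op ^^ (N - 2 * j)) u)) x"
      have "c (j - 1) * (ce a * ?p (j - 1)) * ?W (j - 1) x + c j * (ce a * ?q j) * ?w
          = ce a * ?w * (of_nat ((N - 2 * j + 2) * (N - 2 * j + 1)) * c (j - 1)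
              + 2 * of_nat j * (?m + 2 * lam - 2 * of_nat N + 2 * of_nat j) * c j)"
      proof -
        have gen: "c1 * (e * p) * w + c2 * (e * q) * w = e * w * (p * c1 + q * c2)" for c1 c2 e p q w :: complex
          by (simp add: algebra_simps)
        have "?p (j - 1) = of_nat ((N - 2 * j + 2) * (N - 2 * j + 1))" "?W (j - 1) x = ?w"
          by (simp_all only: e diff_add_inverse2)
        then show ?thesis unfolding q by (simp only: gen)
      qed
      also have "\<dots> = 0" unfolding rec[OF j(1,2)] by simp
      finally show "c (j - 1) * (ce a * ?p (j - 1)) * ?W (j - 1) x + c j * (ce a * ?q j) * ?w = 0" .
    qed
    finally show ?thesis .
  qed
  then show ?thesis by (simp add: fun_eq_iff)
qed

section \<open>Right translation by diagonal involutions\<close>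

definition rtrans :: "('i::finite) sqmat \<Rightarrow> ('i sqmat \<Rightarrow> complex) \<Rightarrow> ('i sqmat \<Rightarrow> complex)" where
  "rtrans \<kappa> u = (\<lambda>x. u (x ** \<kappa>))"

text \<open>
  The adjoint action: an element that is its own inverse moves past \<open>exp (t X)\<close> by conjugation of \<open>X\<close>.
\<close>

lemma rtrans_R_vec:
  fixes \<kappa> X :: "('i::finite) sqmat"
  assumes "\<kappa> ** \<kappa> = mat 1"
  shows "rtrans \<kappa> (R_vec X u) = R_vec (\<kappa> ** X ** \<kappa>) (rtrans \<kappa> u)"
proof
  fix x :: "'i sqmat"
  have "x ** \<kappa> ** mexp (t *\<^sub>R X) = x ** mexp (t *\<^sub>R (\<kappa> ** X ** \<kappa>)) ** \<kappa>" for t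
  proof -
    have "x ** mexp (t *\<^sub>R (\<kappa> ** X ** \<kappa>)) ** \<kappa> = x ** \<kappa> ** mexp (t *\<^sub>R X) ** (\<kappa> ** \<kappa>)"
      by (simp only: mexp_conj[OF assms] matrix_mul_assoc)
    then show ?thesis by (simp add: assms)
  qed
  then show "rtrans \<kappa> (R_vec X u) x = R_vec (\<kappa> ** X ** \<kappa>) (rtrans \<kappa> u) x"
    by (simp add: rtrans_def R_vec_def)
qed

lemma rtrans_smooth_O2:
  assumes k: "\<kappa> \<in> O2" and u: "u \<in> smooth_O2"
  shows "rtrans \<kappa> u \<in> smooth_O2"
proof -
  have "(\<lambda>x. u (x ** \<kappa>)) \<in> smooth_fun O2"
    by (rule smooth_fun_affine[OF smooth_O2_smooth[OF u], where c = 0 and L = "\<lambda>x. x ** \<kappa>"])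
      (use k in \<open>simp_all add: matrix_mult.bounded_linear_left O2_mult\<close>)
  then show ?thesis
    using u O2_mult_iff[OF k] by (simp add: smooth_O2_def rtrans_def)
qed

definition diag_mat :: "('i \<Rightarrow> real) \<Rightarrow> ('i::finite) sqmat" where
  "diag_mat \<delta> = (\<chi> a b. if a = b then \<delta> a else 0)"

lemma diag_mat_nth:
  fixes X :: "('i::finite) sqmat"
  shows "(diag_mat \<delta> ** X) $ i $ j = \<delta> i * X $ i $ j" "(X ** diag_mat \<delta>) $ i $ j = X $ i $ j * \<delta> j"
  by (simp_all add: matrix_matrix_mult_def diag_mat_def if_distrib [of "\<lambda>x. x * _"] if_distrib [of "\<lambda>x. _ * x"]
      cong: if_cong)

lemma diag_mat_Emat: "diag_mat \<delta> ** Emat a b ** diag_mat \<delta> = (\<delta> a * \<delta> b) *\<^sub>R Emat a b"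
  by (auto simp: vec_eq_iff diag_mat_nth)

lemma diag_mat_square:
  assumes "\<And>a. \<delta> a * \<delta> a = 1"
  shows "diag_mat \<delta> ** diag_mat \<delta> = mat 1"
  by (simp add: vec_eq_iff diag_mat_nth) (simp add: diag_mat_def mat_def assms)

lemma diag_mat_Yn:
  assumes "\<delta> I1 = \<delta> I4"
  shows "diag_mat \<delta> ** Yn a ** diag_mat \<delta> = (\<delta> a * \<delta> I4) *\<^sub>R Yn a"
  using assms by (simp add: Yn_def mat_simps diag_mat_Emat scaleR_add_right scaleR_diff_right mult.commute)

text \<open>
  Conjugation by the diagonal matrix multiplies each lowering vector by a sign.  The Laplacian is quadratic in
  each of them and does not notice the signs, whereas each factor \<open>T\<close> contributes its sign; \<open>N - 2 j\<close> and
  \<open>N\<close> have the same parity.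
\<close>

lemma rtrans_D_op:
  fixes u :: "('j::finite) option gmat \<Rightarrow> complex"
  assumes sq: "\<And>a. \<delta> a * \<delta> a = 1" and d14: "\<delta> I1 = \<delta> I4" and O: "diag_mat \<delta> \<in> O2"
    and u: "u \<in> smooth_O2" and inv: "rtrans (diag_mat \<delta>) u = u"
  shows "rtrans (diag_mat \<delta>) (D_op c N u) = smul (of_real (\<delta> (Ix None) * \<delta> I4) ^ N) (D_op c N u)"
proof -
  let ?k = "diag_mat \<delta>" and ?s = "\<lambda>a. complex_of_real (\<delta> a * \<delta> I4)"
  have s2: "?s a * ?s a = 1" for a
  proof -
    have "(\<delta> a * \<delta> I4) * (\<delta> a * \<delta> I4) = (\<delta> a * \<delta> a) * (\<delta> I4 * \<delta> I4)" by (simp only: mult_ac)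
    then have "(\<delta> a * \<delta> I4) * (\<delta> a * \<delta> I4) = 1" by (simp only: sq)
    then show ?thesis by (metis of_real_1 of_real_mult)
  qed
  have Y: "rtrans ?k (R_vec (Yn a) v) = smul (?s a) (R_vec (Yn a) (rtrans ?k v))" if "a \<in> dirs" "v \<in> smooth_O2" for a and v :: "'j option gmat \<Rightarrow> complex"
    unfolding rtrans_R_vec[OF diag_mat_square[OF sq]] diag_mat_Yn[OF d14]
    by (rule R_vec_scaleR[OF o2_Yn[OF that(1)] rtrans_smooth_O2[OF O that(2)]])
  have sm: "rtrans ?k (smul d v) = smul d (rtrans ?k v)" for d and v :: "'j option gmat \<Rightarrow> complex"
    by (simp add: rtrans_def smul_def)
  have su: "rtrans ?k (sum f I) = (\<Sum>i\<in>I. rtrans ?k (f i))" for I and f :: "nat \<Rightarrow> 'j option gmat \<Rightarrow> complex"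
    by (simp add: fun_eq_iff sum_fun_apply rtrans_def)
  have su': "rtrans ?k (sum f I) = (\<Sum>i\<in>I. rtrans ?k (f i))" for I and f :: "'j option idx \<Rightarrow> 'j option gmat \<Rightarrow> complex"
    by (simp add: fun_eq_iff sum_fun_apply rtrans_def)
  have L: "rtrans ?k (Lap_op v) = Lap_op (rtrans ?k v)" if v: "v \<in> smooth_O2" for v
    unfolding Lap_op_def su'
  proof (intro sum.cong refl)
    fix a :: "'j option idx" assume a: "a \<in> tangential"
    have "rtrans ?k (R_vec (Yn a) (R_vec (Yn a) v)) = smul (?s a) (R_vec (Yn a) (smul (?s a) (R_vec (Yn a) (rtrans ?k v))))"
      using a v by (simp add: Y)
    also have "\<dots> = smul (?s a * ?s a) (R_vec (Yn a) (R_vec (Yn a) (rtrans ?k v)))"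
      using a rtrans_smooth_O2[OF O v] by (simp add: R_vec_smul smul_simps)
    finally have "rtrans ?k (R_vec (Yn a) (R_vec (Yn a) v)) = R_vec (Yn a) (R_vec (Yn a) (rtrans ?k v))"
      unfolding s2 by (simp only: smul_simps)
    then show "rtrans ?k (smul (ce a) (R_vec (Yn a) (R_vec (Yn a) v))) = smul (ce a) (R_vec (Yn a) (R_vec (Yn a) (rtrans ?k v)))"
      by (simp only: sm)
  qed
  have Lj: "rtrans ?k ((Lap_op ^^ j) v) = (Lap_op ^^ j) (rtrans ?k v)" if "v \<in> smooth_O2" for j v
    using that by (induction j) (simp_all add: L)
  have Tj: "rtrans ?k ((T_op ^^ j) u) = smul (?s (Ix None) ^ j) ((T_op ^^ j) u)" for j
  proof (induction j)
    case 0
    show ?case by (simp add: inv smul_simps)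
  next
    case (Suc j)
    show ?case
      by (simp only: funpow.simps o_apply Y[OF dirs_None T_op_pow_smooth_O2[OF u]] Suc.IH
          R_vec_smul[OF o2_Yn[OF dirs_None] T_op_pow_smooth_O2[OF u]] smul_simps power_Suc)
  qed
  have Ls: "(Lap_op ^^ j) (smul d v) = smul d ((Lap_op ^^ j) v)" if "v \<in> smooth_O2" for d j and v :: "'j option gmat \<Rightarrow> complex"
    using that by (induction j) (simp_all add: Lap_op_smul)
  show ?thesis unfolding D_op_def su smul_sum
  proof (intro sum.cong refl)
    fix j assume "j \<in> {0..N div 2}"
    then have "N = N - 2 * j + (j + j)" by auto
    then have "?s (Ix None) ^ N = ?s (Ix None) ^ (N - 2 * j) * (?s (Ix None) ^ j * ?s (Ix None) ^ j)"
      by (metis power_add)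
    also have "?s (Ix None) ^ j * ?s (Ix None) ^ j = 1"
      unfolding power_mult_distrib[symmetric] s2 by simp
    finally have p: "?s (Ix None) ^ N = ?s (Ix None) ^ (N - 2 * j)" by simp
    show "rtrans ?k (smul (c j) ((Lap_op ^^ j) ((T_op ^^ (N - 2 * j)) u)))
        = smul (?s (Ix None) ^ N) (smul (c j) ((Lap_op ^^ j) ((T_op ^^ (N - 2 * j)) u)))"
      unfolding p using u by (simp add: sm Lj Tj Ls smul_simps mult.commute del: of_real_mult)
  qed
qed

section \<open>The operator induced by an element of the enveloping algebra\<close>

definition zero_ext :: "(('k::finite) gmat \<Rightarrow> complex) \<Rightarrow> ('k gmat \<Rightarrow> complex)" where
  "zero_ext u = (\<lambda>x. if x \<in> O2 then u x else 0)"

lemma zero_ext_smooth_O2: "u \<in> smooth_fun O2 \<Longrightarrow> zero_ext u \<in> smooth_O2"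
  using smooth_fun_cong[of O2 u "zero_ext u"] by (simp add: smooth_O2_def zero_ext_def)

lemma zero_ext_apply: "x \<in> O2 \<Longrightarrow> zero_ext u x = u x"
  by (simp add: zero_ext_def)

lemma R_vec_cong:
  "(\<And>t. u (x ** mexp (t *\<^sub>R X)) = v (x ** mexp (t *\<^sub>R X))) \<Longrightarrow> R_vec X u x = R_vec X v x"
  by (simp add: R_vec_def)

text \<open>
  Curves that start in the group stay in it.
\<close>

lemma foldr_R_vec_cong:
  assumes "set Xs \<subseteq> o2" "\<And>y. y \<in> O2 \<Longrightarrow> u y = v y" "x \<in> O2"
  shows "foldr R_vec Xs u x = foldr R_vec Xs v x"
  using assms(1,3)
proof (induction Xs arbitrary: x)
  case (Cons X Xs)
  then have "foldr R_vec Xs u (x ** mexp (t *\<^sub>R X)) = foldr R_vec Xs v (x ** mexp (t *\<^sub>R X))" for t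
    by (simp add: O2_mexp_iff)
  then show ?case unfolding foldr.simps o_apply by (rule R_vec_cong)
qed (simp add: assms(2))

lemma foldr_R_vec_ltrans: "foldr R_vec Xs (ltrans g u) = ltrans g (foldr R_vec Xs u)"
  by (induction Xs) (simp_all add: R_vec_ltrans)

lemma R_free_ltrans: "R_free p (ltrans g u) = ltrans g (R_free p u)"
  unfolding R_free_def foldr_R_vec_ltrans by (simp add: ltrans_def)

context o2_subalgebra
begin

lemma acts_cong: "acts d f \<Longrightarrow> (\<And>u. u \<in> smooth_O2 \<Longrightarrow> f u = g u) \<Longrightarrow> acts d g"
  by (auto simp: acts_def)

lemma acts_linear:
  assumes "acts d f"
  shows "u \<in> smooth_O2 \<Longrightarrow> v \<in> smooth_O2 \<Longrightarrow> f (u + v) = f u + f v" "u \<in> smooth_O2 \<Longrightarrow> f (smul c u) = smul c (f u)"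
proof -
  obtain p where p: "p \<in> carrier (free_alg L)" "\<And>u. u \<in> smooth_O2 \<Longrightarrow> R_free p u = f u"
    using assms unfolding acts_def by blast
  have o: "set (letters w) \<subseteq> o2" if "w \<in> Poly_Mapping.keys p" for w
    using p(1) L_o2 that unfolding carrier_free_alg by blast
  show "f (u + v) = f u + f v" if u: "u \<in> smooth_O2" and v: "v \<in> smooth_O2"
  proof -
    have "R_free p (u + v) = R_free p u + R_free p v"
      unfolding R_free_eq sum.distrib[symmetric]
      by (intro sum.cong refl) (simp only: word_op_add[OF o u v] smul_simps)
    then show ?thesis by (simp only: p(2) u v smooth_O2_add)
  qed
  show "f (smul c u) = smul c (f u)" if u: "u \<in> smooth_O2"
  proof -
    have "R_free p (smul c u) = smul c (R_free p u)"
      unfolding R_free_eq smul_sum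
      by (intro sum.cong refl) (simp only: word_op_smul[OF o u] smul_simps mult.commute)
    then show ?thesis by (simp only: p(2) u smooth_O2_smul)
  qed
qed

lemma some_in_carrier:
  assumes "acts d f"
  shows "(SOME p. p \<in> d) \<in> carrier (free_alg L)"
proof -
  obtain p where p: "p \<in> carrier (free_alg L)" "d = uea_proj p" using assms unfolding acts_def by blast
  obtain i where "i \<in> uea_ideal L" "(SOME q. q \<in> d) = i + p"
    using some_in_uea_proj[OF p(1)] p(2) by blast
  moreover have "uea_ideal L \<subseteq> carrier (free_alg L)"
    using ideal.Icarr[OF ideal_uea] by blast
  ultimately show ?thesis using p(1) by (auto simp: free_alg_closed)
qed

text \<open>
  Any smooth function on the group may be replaced by its extension by zero, to which the algebraic
  computations apply.
\<close>

lemma R_act_eq: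
  assumes "acts d f" "u \<in> smooth_fun O2" "x \<in> O2"
  shows "R_act d u x = f (zero_ext u) x"
proof -
  let ?p = "SOME p. p \<in> d"
  have o: "set (letters w) \<subseteq> o2" if "w \<in> Poly_Mapping.keys ?p" for w
    using some_in_carrier[OF assms(1)] L_o2 that unfolding carrier_free_alg by blast
  have "R_act d u x = R_act d (zero_ext u) x"
    unfolding R_act_def R_free_def
    using o assms(3) by (intro sum.cong refl arg_cong2[where f = "(*)"] foldr_R_vec_cong) (auto simp: zero_ext_apply)
  then show ?thesis using acts_R_act[OF assms(1) zero_ext_smooth_O2[OF assms(2)]] by simp
qed

end

interpretation n_minus: o2_subalgebra "lie_n_minus :: ('k::finite) gmat set"
proof
  show "subspace (lie_n_minus :: 'k gmat set)" by (simp add: lie_n_minus_def)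
  then show "mbracket X Y \<in> lie_n_minus" if "X \<in> lie_n_minus" "Y \<in> lie_n_minus" for X Y :: "'k gmat"
    using lie_n_minus_abelian[OF that] subspace_0 by metis
qed (rule lie_n_minus_o2)

lemma Yn_lie_n_minus: "a \<in> dirs \<Longrightarrow> Yn a \<in> lie_n_minus"
  by (auto simp: lie_n_minus_eq intro: span_base)

lemma tangential_eq: "tangential = insert I2 (insert I3 (range (\<lambda>j. Ix (Some j))))"
  by (simp add: tangential_def dirs_eq image_image)

lemma acts_Lap: "n_minus.acts (Lap :: (('j::finite) option gmat word \<Rightarrow>\<^sub>0 complex) set) Lap_op"
proof -
  have g: "n_minus.acts (uea_gen lie_n_minus (Yn a) [^]\<^bsub>Un_minus\<^esub> (2::nat)) (R_vec (Yn a) ^^ 2)"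
    if "a \<in> dirs" for a :: "'j option idx"
    by (intro n_minus.acts_pow n_minus.acts_gen Yn_lie_n_minus that)
  have "n_minus.acts (Lap :: ('j option gmat word \<Rightarrow>\<^sub>0 complex) set)
    (\<lambda>u. (- (R_vec (Yn I2) ^^ 2) u + (R_vec (Yn I3) ^^ 2) u) + (\<Sum>j\<in>UNIV. (R_vec (Yn (Ix (Some j))) ^^ 2) u))"
    unfolding Lap_def Yn_simps[symmetric]
    by (intro n_minus.acts_add n_minus.acts_minus n_minus.acts_finsum g) simp_all
  then show ?thesis
  proof (rule n_minus.acts_cong)
    fix u :: "'j option gmat \<Rightarrow> complex" assume "u \<in> smooth_O2"
    have inj: "inj (\<lambda>j :: 'j. Ix (Some j))" by (auto intro: injI)
    have "Lap_op u x = - R_vec (Yn I2) (R_vec (Yn I2) u) x + (R_vec (Yn I3) (R_vec (Yn I3) u) x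
        + (\<Sum>j\<in>UNIV. R_vec (Yn (Ix (Some j))) (R_vec (Yn (Ix (Some j))) u) x))" for x
    proof -
      have "Lap_op u x = (\<Sum>a\<in>tangential. ce a * R_vec (Yn a) (R_vec (Yn a) u) x)"
        by (simp only: Lap_op_def sum_fun_apply smul_apply)
      also have "\<dots> = ce (I2 :: 'j option idx) * R_vec (Yn I2) (R_vec (Yn I2) u) x + (ce (I3 :: 'j option idx) * R_vec (Yn I3) (R_vec (Yn I3) u) x
        + (\<Sum>a\<in>range (\<lambda>j :: 'j. Ix (Some j)). ce a * R_vec (Yn a) (R_vec (Yn a) u) x))"
        by (simp add: tangential_eq image_iff)
      also have "(\<Sum>a\<in>range (\<lambda>j :: 'j. Ix (Some j)). ce a * R_vec (Yn a) (R_vec (Yn a) u) x)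
        = (\<Sum>j\<in>UNIV. ce (Ix (Some j)) * R_vec (Yn (Ix (Some j))) (R_vec (Yn (Ix (Some j))) u) x)"
        by (rule sum.reindex_cong[OF inj]) auto
      finally show ?thesis by (simp add: eps_def)
    qed
    then show "(- (R_vec (Yn I2) ^^ 2) u + (R_vec (Yn I3) ^^ 2) u)
      + (\<Sum>j\<in>UNIV. (R_vec (Yn (Ix (Some j))) ^^ 2) u) = Lap_op u"
      by (simp add: fun_eq_iff sum_fun_apply numeral_2_eq_2)
  qed
qed

definition coef :: "nat \<Rightarrow> nat \<Rightarrow> complex \<Rightarrow> nat \<Rightarrow> complex" where
  "coef n N lam = (if even N then a_coef n lam (N div 2) else b_coef n lam (N div 2))"

lemma acts_D0: "n_minus.acts (D0 n N lam :: (('j::finite) option gmat word \<Rightarrow>\<^sub>0 complex) set) (D_op (coef n N lam) N)"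
proof -
  have T: "n_minus.acts (Tlast :: ('j option gmat word \<Rightarrow>\<^sub>0 complex) set) T_op"
    unfolding Tlast_def Yn_simps[symmetric] by (intro n_minus.acts_gen Yn_lie_n_minus dirs_None)
  have S: "n_minus.acts (\<Oplus>\<^bsub>Un_minus\<^esub>j\<in>{0..N div 2}. uea_const lie_n_minus (c j) \<otimes>\<^bsub>Un_minus\<^esub>
            ((Lap [^]\<^bsub>Un_minus\<^esub> j) \<otimes>\<^bsub>Un_minus\<^esub> ((Tlast :: ('j option gmat word \<Rightarrow>\<^sub>0 complex) set) [^]\<^bsub>Un_minus\<^esub> e j)))
          (\<lambda>u. \<Sum>j\<in>{0..N div 2}. smul (c j) ((Lap_op ^^ j) ((T_op ^^ e j) u)))" for c and e :: "nat \<Rightarrow> nat"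
    by (intro n_minus.acts_finsum n_minus.acts_mult n_minus.acts_const n_minus.acts_pow acts_Lap T) simp
  show ?thesis
  proof (cases "even N")
    case True
    show ?thesis
      using S[of "a_coef n lam (N div 2)" "\<lambda>j. 2 * (N div 2) - 2 * j"] True
      by (simp add: D0_def coef_def D_op_def[abs_def] Let_def)
  next
    case False
    then have "2 * (N div 2) - 2 * j + 1 = N - 2 * j" if "j \<in> {0..N div 2}" for j
      using that by (auto elim!: oddE)
    then have "(\<Sum>j\<in>{0..N div 2}. smul (b_coef n lam (N div 2) j) ((Lap_op ^^ j) ((T_op ^^ (2 * (N div 2) - 2 * j + 1)) u)))
      = D_op (coef n N lam) N u" for u :: "'j option gmat \<Rightarrow> complex"
      unfolding D_op_def coef_def using False by (intro sum.cong) simp_all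
    then show ?thesis
      using S[of "b_coef n lam (N div 2)" "\<lambda>j. 2 * (N div 2) - 2 * j + 1"] False
      by (simp add: D0_def Let_def)
  qed
qed

text \<open>
  Expressed through \<open>N\<close> instead of \<open>N div 2\<close>, and up to a factor 2, the recursions of the even and the
  odd family coincide; \<open>n - 1\<close> is the number of tangential directions.
\<close>

lemma coef_rec:
  assumes n: "n \<ge> 4" "CARD('j::finite) = n - 3" and j: "1 \<le> j" "j \<le> N div 2"
  shows "of_nat ((N - 2 * j + 2) * (N - 2 * j + 1)) * coef n N lam (j - 1)
      + 2 * of_nat j * (of_nat (card (tangential :: 'j option idx set)) + 2 * lam - 2 * of_nat N + 2 * of_nat j) * coef n N lam j = 0"
proof -
  have m: "of_nat (card (tangential :: 'j option idx set)) = (of_nat n - 1 :: complex)"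
    using n by (simp add: card_tangential of_nat_diff)
  obtain d where d: "N div 2 = j + d" using le_Suc_ex[OF j(2)] by blast
  have double: "2 * P * A + 2 * J * X * B = 0" if "P * A + J * X * B = 0" for P A J X B :: complex
  proof -
    have "2 * P * A + 2 * J * X * B = 2 * (P * A + J * X * B)" by (simp add: algebra_simps)
    with that show ?thesis by simp
  qed
  show ?thesis
  proof (cases "even N")
    case True
    then have N: "N = 2 * (j + d)" using d by auto
    have "of_nat ((N - 2 * j + 2) * (N - 2 * j + 1)) = 2 * ((of_nat d + 1) * (2 * of_nat d + 1) :: complex)"
      by (simp add: N algebra_simps)
    moreover have "(of_nat n - 1) + 2 * lam - 2 * of_nat N + 2 * of_nat j
        = of_nat n - 1 + 2 * lam - 4 * of_nat (j + d) + 2 * of_nat j"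
      by (simp add: N)
    moreover have "coef n N lam = a_coef n lam (j + d)"
      using True d by (simp add: coef_def)
    moreover have "(of_nat d + 1) * (2 * of_nat d + 1) * a_coef n lam (j + d) (j - 1)
       + of_nat j * (of_nat n - 1 + 2 * lam - 4 * of_nat (j + d) + 2 * of_nat j) * a_coef n lam (j + d) j = 0"
      using a_coef_recurrence[of j "j + d" n lam] j by (simp add: algebra_simps)
    ultimately show ?thesis
      unfolding m by (simp only: double)
  next
    case False
    then have N: "N = 2 * (j + d) + 1" using d by (auto elim!: oddE)
    have "of_nat ((N - 2 * j + 2) * (N - 2 * j + 1)) = 2 * ((of_nat d + 1) * (2 * of_nat d + 3) :: complex)"
      by (simp add: N algebra_simps)
    moreover have "(of_nat n - 1) + 2 * lam - 2 * of_nat N + 2 * of_nat j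
        = of_nat n - 3 + 2 * lam - 4 * of_nat (j + d) + 2 * of_nat j"
      by (simp add: N)
    moreover have "coef n N lam = b_coef n lam (j + d)"
      using False d by (simp add: coef_def)
    moreover have "(of_nat d + 1) * (2 * of_nat d + 3) * b_coef n lam (j + d) (j - 1)
       + of_nat j * (of_nat n - 3 + 2 * lam - 4 * of_nat (j + d) + 2 * of_nat j) * b_coef n lam (j + d) j = 0"
      using b_coef_recurrence[of j "j + d" n lam] j by (simp add: algebra_simps)
    ultimately show ?thesis
      unfolding m by (simp only: double)
  qed
qed

lemma D_prime_eq:
  assumes "u \<in> smooth_fun O2" "x \<in> O2"
  shows "D_prime n N lam u x = D_op (coef n N lam) N (zero_ext u) x"
  unfolding D_prime_def by (rule n_minus.R_act_eq[OF acts_D0 assms])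

text \<open>
  Differentiation on the right commutes with translation on the left.
\<close>

lemma D_prime_ltrans: "D_prime n N lam (ltrans g u) = ltrans g (D_prime n N lam u)"
  by (simp add: D_prime_def R_act_def R_free_ltrans)

lemma D_prime_linear:
  assumes "u \<in> smooth_fun O2" "v \<in> smooth_fun O2" "x \<in> O2"
  shows "D_prime n N lam (\<lambda>y. u y + v y) x = D_prime n N lam u x + D_prime n N lam v x"
    and "D_prime n N lam (\<lambda>y. c * u y) x = c * D_prime n N lam u x"
proof -
  have add: "(\<lambda>y. u y + v y) \<in> smooth_fun O2"
    using smooth_fun_add[OF assms(1,2)] by (simp add: plus_fun_def)
  have sm: "(\<lambda>y. c * u y) \<in> smooth_fun O2"
    using smooth_fun_smul[OF assms(1)] by (simp add: smul_def)
  have "zero_ext (\<lambda>y. u y + v y) = zero_ext u + zero_ext v" "zero_ext (\<lambda>y. c * u y) = smul c (zero_ext u)"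
    by (auto simp: zero_ext_def fun_eq_iff)
  then show "D_prime n N lam (\<lambda>y. u y + v y) x = D_prime n N lam u x + D_prime n N lam v x"
    "D_prime n N lam (\<lambda>y. c * u y) x = c * D_prime n N lam u x"
    unfolding D_prime_eq[OF add assms(3)] D_prime_eq[OF sm assms(3)] D_prime_eq[OF assms(1,3)]
      D_prime_eq[OF assms(2,3)]
    by (simp_all only: n_minus.acts_linear[OF acts_D0] zero_ext_smooth_O2 assms plus_fun_apply smul_apply)
qed

lemmas D_prime_scale = D_prime_linear(2)[OF _ _, of u u for u]

lemma equivariant_D_prime:
  assumes "V \<subseteq> smooth_fun O2" "\<And>u. u \<in> V \<Longrightarrow> D_prime n N lam u \<in> W"
  shows "equivariant_op id V W (D_prime n N lam)"
proof -
  have [simp]: "u \<in> smooth_fun O2" if "u \<in> V" for u using that assms(1) by blast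
  show ?thesis
    unfolding equivariant_op_def using assms(2) by (simp add: D_prime_linear(1) D_prime_scale D_prime_ltrans)
qed

lemma emb_matrix_inv:
  assumes "g \<in> O2"
  shows "matrix_inv (emb g) = emb (matrix_inv g)"
proof -
  have "emb (matrix_inv g) ** emb g = mat 1"
    using O2_matrix_inv(1)[OF assms] by (simp flip: emb_mult)
  then have "emb (matrix_inv g) ** (emb g ** matrix_inv (emb g)) = matrix_inv (emb g)"
    by (simp add: matrix_mul_assoc)
  then show ?thesis by (simp add: O2_matrix_inv(2)[OF emb_O2[OF assms]])
qed

lemma equivariant_D_restr:
  assumes "V \<subseteq> smooth_fun O2" "\<And>u. u \<in> V \<Longrightarrow> D_prime n N lam u \<in> Ind emb M \<sigma> \<mu>"
  shows "equivariant_op emb V (Ind id M \<sigma> \<mu>) (D_restr n N lam)"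
proof -
  have [simp]: "u \<in> smooth_fun O2" if "u \<in> V" for u using that assms(1) by blast
  have "D_restr n N lam u \<in> Ind id M \<sigma> \<mu>" if "u \<in> V" for u
    using assms(2)[OF that] emb_smooth
    by (auto simp: D_restr_def Ind_def emb_mult emb_O2)
  then show ?thesis
    unfolding equivariant_op_def
    by (simp add: D_restr_def D_prime_linear(1) D_prime_scale D_prime_ltrans emb_O2)
      (simp add: ltrans_def emb_matrix_inv emb_mult)
qed

section \<open>Membership in the induced representations\<close>

text \<open>
  The right stabilizer of a function in the smaller group, used to reduce invariance under
  \<open>grp_Mhat\<close> to invariance under generators.
\<close>

definition right_stabilizer :: "(('k::finite) option gmat \<Rightarrow> complex) \<Rightarrow> 'k gmat set" where
  "right_stabilizer w = {m \<in> O2. rtrans (emb m) w = w}"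

lemma O2_grp_simps [simp]:
  "carrier O2_grp = O2" "x \<otimes>\<^bsub>O2_grp\<^esub> y = x ** y" "\<one>\<^bsub>O2_grp\<^esub> = mat 1"
  by (simp_all add: O2_grp_def)

lemma rtrans_mult: "rtrans (A ** B) w = rtrans A (rtrans B w)"
  by (simp add: rtrans_def matrix_mul_assoc)

lemma rtrans_one [simp]: "rtrans (mat 1) w = w"
  by (simp add: rtrans_def)

lemma subgroup_O2I:
  fixes H :: "('j::finite) gmat set"
  assumes "H \<subseteq> O2" "mat 1 \<in> H" "\<And>x y. x \<in> H \<Longrightarrow> y \<in> H \<Longrightarrow> x ** y \<in> H"
    and "\<And>x y. x \<in> H \<Longrightarrow> y \<in> O2 \<Longrightarrow> y ** x = mat 1 \<Longrightarrow> y \<in> H"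
  shows "subgroup H O2_grp"
proof -
  interpret G: group "O2_grp :: 'j gmat monoid" by (rule group_O2)
  show ?thesis
  proof (rule G.subgroupI)
    show "inv\<^bsub>O2_grp\<^esub> a \<in> H" if "a \<in> H" for a
      using assms(1,4) that G.inv_closed[of a] G.l_inv[of a] by auto
  qed (use assms in auto)
qed

lemma subgroup_right_stabilizer: "subgroup (right_stabilizer w) O2_grp"
proof (rule subgroup_O2I)
  fix x y assume a: "x \<in> right_stabilizer w" "y \<in> O2" "y ** x = mat 1"
  then have "rtrans (emb y) w = rtrans (emb y) (rtrans (emb x) w)" by (simp add: right_stabilizer_def)
  also have "\<dots> = w" using a(3) by (simp flip: rtrans_mult emb_mult)
  finally show "y \<in> right_stabilizer w" using a by (simp add: right_stabilizer_def)
qed (auto simp: right_stabilizer_def O2_one O2_mult emb_mult rtrans_mult)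

lemma grp_Mhat_subset:
  assumes H: "subgroup H (O2_grp :: ('j::finite) gmat monoid)"
    and "w1 \<in> H" "w2 \<in> H" "\<And>X. X \<in> lie_m \<Longrightarrow> mexp X \<in> H"
  shows "grp_Mhat \<subseteq> H"
proof -
  interpret G: group "O2_grp :: 'j gmat monoid" by (rule group_O2)
  have "generate O2_grp {w1, w2} \<subseteq> H" "grp_M0 \<subseteq> H"
    unfolding grp_M0_def using assms by (auto intro!: G.generate_subgroup_incl[OF _ H])
  then show ?thesis
    using subgroup.m_closed[OF H] by (auto simp: grp_Mhat_def set_mult_def)
qed

lemma one_generate: "mat 1 \<in> generate O2_grp S"
  using generate.one[of O2_grp S] by simp

lemma grp_Mhat_mem:
  fixes X :: "('j::finite) gmat"
  shows "(mat 1 :: 'j gmat) \<in> grp_Mhat" "(w1 :: 'j gmat) \<in> grp_Mhat" "X \<in> lie_m \<Longrightarrow> mexp X \<in> grp_Mhat"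
  "X \<in> lie_m \<Longrightarrow> w2 ** mexp X \<in> grp_Mhat"
proof -
  have m: "x ** y \<in> grp_Mhat" if "x \<in> generate O2_grp {w1, w2}" "y \<in> generate O2_grp (mexp ` lie_m)"
    for x y :: "'j gmat"
    using that by (auto simp: grp_Mhat_def grp_M0_def set_mult_def)
  show "(mat 1 :: 'j gmat) \<in> grp_Mhat" using m[OF one_generate one_generate] by simp
  show "(w1 :: 'j gmat) \<in> grp_Mhat" using m[OF generate.incl[of w1] one_generate] by simp
  show "mexp X \<in> grp_Mhat" if "X \<in> lie_m"
    using m[OF one_generate generate.incl[of "mexp X"]] that by simp
  show "w2 ** mexp X \<in> grp_Mhat" if "X \<in> lie_m"
    using m[OF generate.incl[of w2] generate.incl[of "mexp X"]] that by simp
qed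

lemma w2_Mhat: "w2 \<in> grp_Mhat"
  using grp_Mhat_mem(4)[of 0] by (simp add: lie_m_def span_zero)

lemma grp_M_eq: "grp_M = grp_Mhat \<union> (**) Jmat ` grp_Mhat"
  by (auto simp: grp_M_def set_mult_def)

lemma grp_A_eq: "grp_A = range (\<lambda>t. mexp (t *\<^sub>R Hmat))"
  by (auto simp: grp_A_def lie_a_def span_singleton)

lemma one_mem: "mat 1 \<in> grp_A" "mat 1 \<in> grp_N_plus"
proof -
  have "mexp (0 *\<^sub>R Hmat) \<in> grp_A" unfolding grp_A_eq by blast
  then show "mat 1 \<in> grp_A" by simp
  have "mexp 0 \<in> grp_N_plus" unfolding grp_N_plus_def lie_n_plus_def by (intro imageI span_zero)
  then show "mat 1 \<in> grp_N_plus" by simp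
qed

lemma xi_one [simp]: "xi lam (mat 1) = 1"
  using xi_mexp[of lam 0] by simp

lemma IndD:
  assumes "u \<in> Ind id M (\<lambda>_. 1) lam" "mat 1 \<in> M" "g \<in> O2"
  shows "m \<in> M \<Longrightarrow> u (g ** m) = u g"
    and "u (g ** mexp (t *\<^sub>R Hmat)) = exp (lam * of_real t) * u g"
    and "X \<in> lie_n_plus \<Longrightarrow> u (g ** mexp X) = u g"
proof -
  have *: "u (g ** (m ** a ** n)) = xi lam a * u g" if "m \<in> M" "a \<in> grp_A" "n \<in> grp_N_plus" for m a n
    using assms(1,3) that by (auto simp: Ind_def)
  show "u (g ** m) = u g" if "m \<in> M" using *[OF that one_mem] by simp
  show "u (g ** mexp (t *\<^sub>R Hmat)) = exp (lam * of_real t) * u g"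
    using *[OF assms(2) _ one_mem(2), of "mexp (t *\<^sub>R Hmat)"] by (simp add: grp_A_eq xi_mexp)
  show "u (g ** mexp X) = u g" if "X \<in> lie_n_plus"
    using *[OF assms(2) one_mem(1), of "mexp X"] that by (simp add: grp_N_plus_def)
qed

lemma Ind_smooth: "Ind \<iota> M \<sigma> lam \<subseteq> smooth_fun O2"
  by (auto simp: Ind_def)

lemma Rot_lie_m: "a \<in> dirs \<Longrightarrow> b \<in> dirs \<Longrightarrow> Rot a b \<in> lie_m"
  unfolding lie_m_eq by (auto intro: span_base)

text \<open>
  The converse of \<open>R_vec_eigen_curve\<close>: it extracts infinitesimal conditions from the transformation law of
  the induced representation.
\<close>

lemma R_vec_of_curve:
  assumes X: "X \<in> o2" and v: "v \<in> smooth_O2"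
    and c: "\<And>x t. x \<in> O2 \<Longrightarrow> v (x ** mexp (t *\<^sub>R X)) = exp (c * of_real t) * v x"
  shows "R_vec X v = smul c v"
proof
  fix x
  show "R_vec X v x = smul c v x"
  proof (cases "x \<in> O2")
    case True
    have "((\<lambda>t::real. exp (c * of_real t) * v x) has_vector_derivative (c * v x)) (at 0)"
    proof -
      have "((\<lambda>z. exp (c * z) * v x) has_field_derivative c * v x) (at (complex_of_real 0))"
        by (auto intro!: derivative_eq_intros)
      from has_vector_derivative_real_field[OF this] show ?thesis .
    qed
    then show ?thesis
      unfolding R_vec_def c[OF True] by (simp add: vector_derivative_at)
  next
    case False
    then show ?thesis using R_vec_outside[OF X v] smooth_O2_outside[OF v] by simp
  qed
qed

lemma R_vec_span_zero:
  assumes "w \<in> smooth_O2" "B \<subseteq> o2" "\<And>X. X \<in> B \<Longrightarrow> R_vec X w = 0" "X \<in> span B"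
  shows "X \<in> o2 \<and> R_vec X w = 0"
proof -
  have "subspace {X \<in> o2. R_vec X w = 0}"
    unfolding subspace_def
    using subspace_add[OF subspace_o2] subspace_scale[OF subspace_o2] subspace_0[OF subspace_o2]
    by (auto simp: R_vec_zero_mat R_vec_linear(1) R_vec_scaleR assms(1) smul_simps)
  from span_minimal[OF _ this, of B] show ?thesis using assms by blast
qed

lemma rtrans_zero_ext:
  assumes "\<kappa> \<in> O2" "\<And>g. g \<in> O2 \<Longrightarrow> u (g ** \<kappa>) = u g"
  shows "rtrans \<kappa> (zero_ext u) = zero_ext u"
  using assms by (auto simp: rtrans_def zero_ext_def O2_mult_iff fun_eq_iff)

lemma diag_mat_O2:
  assumes "\<And>a. \<delta> a * \<delta> a = 1"
  shows "diag_mat \<delta> \<in> O2"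
proof -
  have "transpose (diag_mat \<delta>) = diag_mat \<delta>" by (auto simp: vec_eq_iff transpose_def diag_mat_def)
  moreover have "(diag_mat \<delta> ** Smat ** diag_mat \<delta>) $ i $ j = Smat $ i $ j" for i j
    by (simp add: diag_mat_nth) (simp add: Smat_def assms)
  then have "diag_mat \<delta> ** Smat ** diag_mat \<delta> = Smat" by (simp add: vec_eq_iff)
  ultimately show ?thesis by (simp add: O2_iff)
qed

lemma w_diag_mat: "w1 = diag_mat (\<lambda>a. if a = I2 then -1 else 1)" "w2 = diag_mat (\<lambda>a. if a = I3 then -1 else 1)"
  by (simp_all add: w1_def w2_def diag_mat_def)

lemma emb_Jmat_diag_mat: "emb Jmat = diag_mat (\<lambda>a. if a = Ix None then 1 else -1)"
  by (rule mat_option_eqI) (auto simp: Jmat_def diag_mat_def mat_def)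

lemma w_O2: "w1 \<in> O2" "w2 \<in> O2"
  unfolding w_diag_mat by (rule diag_mat_O2; simp)+

lemma rtrans_mexp_invariant: "R_vec X w = 0 \<Longrightarrow> X \<in> o2 \<Longrightarrow> w \<in> smooth_O2 \<Longrightarrow> rtrans (mexp X) w = w"
  using R_vec_eigen_curve[of X w 0 _ 1] by (simp add: rtrans_def fun_eq_iff smul_def)

text \<open>
  The transformation law for everything but \<open>J\<close>.  The infinitesimal conditions on \<open>u\<close> pass to the image by
  \<open>H_D_op\<close>, \<open>Rot_D_op\<close> and \<open>Xn_D_op\<close>, and are then integrated along one-parameter groups.
\<close>

lemma D_op_symmetry:
  fixes u :: "('j::finite) option gmat \<Rightarrow> complex" and N :: nat
  assumes n: "n \<ge> 4" "CARD('j) = n - 3" and u: "u \<in> Ind id grp_Mhat (\<lambda>_. 1) lam"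
  defines "w \<equiv> D_op (coef n N lam) N (zero_ext u)"
  shows "w \<in> smooth_O2" and "grp_Mhat \<subseteq> right_stabilizer w"
    and "rtrans (mexp (t *\<^sub>R Hmat)) w = smul (exp ((lam - of_nat N) * of_real t)) w"
    and "X \<in> lie_n_plus \<Longrightarrow> rtrans (emb (mexp X)) w = w"
proof -
  let ?v = "zero_ext u"
  have sm: "u \<in> smooth_fun O2" using u Ind_smooth by blast
  have v: "?v \<in> smooth_O2" by (rule zero_ext_smooth_O2[OF sm])
  note D = IndD[OF u grp_Mhat_mem(1)]
  have curve: "R_vec X ?v = smul c ?v" if X: "X \<in> o2"
    and c: "\<And>g t. g \<in> O2 \<Longrightarrow> u (g ** mexp (t *\<^sub>R X)) = exp (c * of_real t) * u g" for X c
    using c by (intro R_vec_of_curve[OF X v]) (simp add: zero_ext_def O2_mexp_iff[OF X])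
  have H: "R_vec Hmat ?v = smul lam ?v" by (rule curve[OF o2_Hmat D(2)])
  have zero: "R_vec X ?v = 0" if X: "X \<in> o2"
    and c: "\<And>g t. g \<in> O2 \<Longrightarrow> u (g ** mexp (t *\<^sub>R X)) = u g" for X
    using curve[OF X, of 0] c by (simp add: smul_def fun_eq_iff)
  have R: "R_vec (Rot a b) ?v = 0" if "a \<in> dirs" "b \<in> dirs" for a b
  proof (rule zero[OF o2_Rot[OF that]])
    have "Rot a b \<in> lie_m" using that by (rule Rot_lie_m)
    then have "t *\<^sub>R Rot a b \<in> lie_m" for t unfolding lie_m_def by (rule span_scale)
    then show "u (g ** mexp (t *\<^sub>R Rot a b)) = u g" if "g \<in> O2" for g t
      using D(1)[OF that] grp_Mhat_mem(3) by blast
  qed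
  have X: "R_vec (Xn a) ?v = 0" if "a \<in> dirs" for a
  proof (rule zero[OF o2_Xn[OF that]])
    have "Xn a \<in> lie_n_plus" unfolding lie_n_plus_eq using that by (auto intro: span_base)
    then have "t *\<^sub>R Xn a \<in> lie_n_plus" for t unfolding lie_n_plus_def by (rule span_scale)
    then show "u (g ** mexp (t *\<^sub>R Xn a)) = u g" if "g \<in> O2" for g t
      using D(3)[OF that] by blast
  qed
  show w: "w \<in> smooth_O2" unfolding w_def by (rule D_op_smooth_O2[OF v])
  have Hw: "R_vec Hmat w = smul (lam - of_nat N) w"
    unfolding w_def by (rule H_D_op[OF v H])
  show "rtrans (mexp (t *\<^sub>R Hmat)) w = smul (exp ((lam - of_nat N) * of_real t)) w"
    using R_vec_eigen_curve[OF o2_Hmat w Hw, of _ t] by (simp add: rtrans_def fun_eq_iff)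
  have Xw: "R_vec (Xn a) w = 0" if "a \<in> tangential" for a
    unfolding w_def
    by (rule Xn_D_op[OF that v H R X]) (use that coef_rec[OF n, of _ N lam] in auto)
  have Rw: "R_vec (Rot a b) w = 0" if "a \<in> tangential" "b \<in> tangential" for a b
    unfolding w_def using that by (intro Rot_D_op v R) auto
  show "rtrans (emb (mexp X)) w = w" if "X \<in> lie_n_plus"
  proof -
    have "embL X \<in> embL ` span (Xn ` dirs)" using that by (simp add: lie_n_plus_eq)
    also have "\<dots> = span (embL ` Xn ` dirs)" by (rule span_linear_image[OF linear_embL, symmetric])
    also have "embL ` Xn ` dirs = Xn ` (tangential :: 'j option idx set)"
      by (simp add: tangential_def image_image embL_Xn)
    finally have "embL X \<in> o2 \<and> R_vec (embL X) w = 0"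
      by (rule R_vec_span_zero[OF w, rotated 2]) (auto intro: Xw o2_Xn)
    then show ?thesis unfolding emb_mexp' using rtrans_mexp_invariant w by blast
  qed
  show "grp_Mhat \<subseteq> right_stabilizer w"
  proof (rule grp_Mhat_subset[OF subgroup_right_stabilizer])
    fix X :: "'j gmat" assume X: "X \<in> lie_m"
    let ?B = "{Rot a b | a b. a \<in> (dirs :: 'j idx set) \<and> b \<in> dirs}"
    have "embL X \<in> embL ` span ?B" using X by (simp add: lie_m_eq)
    also have "\<dots> = span (embL ` ?B)" by (rule span_linear_image[OF linear_embL, symmetric])
    finally have "embL X \<in> o2 \<and> R_vec (embL X) w = 0"
      by (rule R_vec_span_zero[OF w, rotated 2]) (auto simp: embL_Rot tangential_def intro!: Rw o2_Rot)
    then have "rtrans (emb (mexp X)) w = w" unfolding emb_mexp' using rtrans_mexp_invariant w by blast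
    moreover have "mexp X \<in> O2" using X lie_m_o2 mexp_O2' by blast
    ultimately show "mexp X \<in> right_stabilizer w" by (simp add: right_stabilizer_def)
  next
    have "rtrans (w1 :: 'j option gmat) w = w"
    proof -
      have "rtrans w1 ?v = ?v" by (rule rtrans_zero_ext) (auto intro: w_O2 D(1) grp_Mhat_mem(2))
      then show ?thesis
        unfolding w_def w_diag_mat by (subst rtrans_D_op[OF _ _ diag_mat_O2 v]) (auto simp: smul_simps)
    qed
    then show "w1 \<in> right_stabilizer w" by (simp add: right_stabilizer_def emb_w1 w_O2)
    have "rtrans (w2 :: 'j option gmat) w = w"
    proof -
      have "rtrans w2 ?v = ?v" by (rule rtrans_zero_ext) (auto intro: w_O2 D(1) w2_Mhat)
      then show ?thesis
        unfolding w_def w_diag_mat by (subst rtrans_D_op[OF _ _ diag_mat_O2 v]) (auto simp: smul_simps)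
    qed
    then show "w2 \<in> right_stabilizer w" by (simp add: right_stabilizer_def emb_w2 w_O2)
  qed
qed

lemma grp_Mhat_O2: "grp_Mhat \<subseteq> O2"
  by (rule grp_Mhat_subset[OF group.subgroup_self[OF group_O2, simplified]])
    (use w_O2 lie_m_o2 mexp_O2' in auto)

lemma Ind_M_subset: "Ind id grp_M (\<lambda>_. 1) lam \<subseteq> Ind id grp_Mhat (\<lambda>_. 1) lam"
  by (auto simp: Ind_def grp_M_eq)

lemma Jmat_O2: "Jmat \<in> O2"
  by (simp add: O2_iff Jmat_def mat_simps)

text \<open>
  Conjugation by the embedded \<open>J\<close> changes the sign of the normal lowering vector and of no other.
\<close>

lemma D_op_Jmat:
  fixes u :: "('j::finite) option gmat \<Rightarrow> complex"
  assumes u: "u \<in> Ind id grp_M (\<lambda>_. 1) lam"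
  shows "rtrans (emb Jmat) (D_op c N (zero_ext u)) = smul ((-1) ^ N) (D_op c N (zero_ext u))"
proof -
  have v: "zero_ext u \<in> smooth_O2" using u Ind_smooth zero_ext_smooth_O2 by blast
  have "Rot I3 (Ix None) \<in> (lie_m :: 'j option gmat set)"
    by (intro Rot_lie_m) simp_all
  then have "pi *\<^sub>R Rot I3 (Ix None) \<in> (lie_m :: 'j option gmat set)"
    unfolding lie_m_def by (rule span_scale)
  then have "emb (Jmat :: 'j gmat) \<in> grp_M"
    unfolding emb_Jmat grp_M_eq using grp_Mhat_mem(4) by blast
  moreover have "mat 1 \<in> grp_M" unfolding grp_M_eq using grp_Mhat_mem(1) by blast
  ultimately have "rtrans (emb (Jmat :: 'j gmat)) (zero_ext u) = zero_ext u"
    using IndD(1)[OF u] by (intro rtrans_zero_ext emb_O2 Jmat_O2) auto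
  then show ?thesis
    unfolding emb_Jmat_diag_mat by (subst rtrans_D_op[OF _ _ diag_mat_O2 v]) auto
qed

text \<open>
  This separates \<open>grp_Mhat\<close> from its coset by \<open>Jmat\<close>, so that \<open>sigma_minus\<close> takes the value \<open>-1\<close> there.
\<close>

lemma grp_Mhat_fixes_I1:
  assumes "m \<in> (grp_Mhat :: ('j::finite) gmat set)"
  shows "m ** Emat I1 I1 = Emat I1 I1"
proof -
  let ?E = "Emat I1 I1 :: 'j gmat"
  let ?H = "{m \<in> O2. m ** ?E = ?E}"
  have "grp_Mhat \<subseteq> ?H"
  proof (rule grp_Mhat_subset)
    show "subgroup ?H O2_grp"
    proof (rule subgroup_O2I)
      fix x y assume a: "x \<in> ?H" "y \<in> O2" "y ** x = mat 1"
      have "y ** ?E = y ** (x ** ?E)" using a by simp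
      also have "\<dots> = ?E" unfolding matrix_mul_assoc a(3) by simp
      finally show "y \<in> ?H" using a by simp
    next
      show "x ** y \<in> ?H" if "x \<in> ?H" "y \<in> ?H" for x y
        using that by (simp add: O2_mult matrix_mul_assoc[symmetric])
    qed (auto simp: O2_one)
    show "w1 \<in> ?H" "w2 \<in> ?H"
      using w_O2 by (auto simp: w_diag_mat diag_mat_nth vec_eq_iff)
    fix X :: "'j gmat" assume X: "X \<in> lie_m"
    have "subspace {X :: 'j gmat. X ** ?E = 0}"
      by (rule linear_subspace_kernel) (rule bounded_linear.linear[OF matrix_mult.bounded_linear_left])
    then have "lie_m \<subseteq> {X. X ** ?E = 0}"
      unfolding lie_m_eq by (rule span_minimal[rotated]) (auto simp: Rot_def mat_simps)
    then have XE: "X ** ?E = 0" using X by blast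
    have "((\<lambda>t. ?E) has_vector_derivative (X ** ?E)) (at t)" for t :: real
      by (simp add: XE)
    from mexp_unique[of "\<lambda>t. ?E", OF this refl, of 1] have "mexp X ** ?E = ?E" by simp
    moreover have "mexp X \<in> O2" using X lie_m_o2 mexp_O2' by blast
    ultimately show "mexp X \<in> ?H" by simp
  qed
  with assms show ?thesis by blast
qed

lemma sigma_minus_simps:
  assumes "m \<in> grp_Mhat"
  shows "sigma_minus m = 1" "sigma_minus (Jmat ** m) = -1"
proof -
  have "Jmat ** m \<notin> grp_Mhat"
  proof
    assume "Jmat ** m \<in> grp_Mhat"
    from grp_Mhat_fixes_I1[OF this] grp_Mhat_fixes_I1[OF assms]
    have "- Emat I1 I1 = (Emat I1 I1 :: 'a gmat)" by (simp add: Jmat_def mat_simps)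
    then have "(- Emat I1 I1 :: 'a gmat) $ I1 $ I1 = (Emat I1 I1 :: 'a gmat) $ I1 $ I1" by (simp only:)
    then show False by simp
  qed
  with assms show "sigma_minus m = 1" "sigma_minus (Jmat ** m) = -1"
    by (simp_all add: sigma_minus_def)
qed

text \<open>
  The two parts of the theorem differ only in the group \<open>M\<close> and its character, so everything else is
  proved for both at once.
\<close>

lemma D_prime_Ind:
  fixes u :: "('j::finite) option gmat \<Rightarrow> complex"
  assumes n: "n \<ge> 4" "CARD('j) = n - 3" and u: "u \<in> Ind id grp_Mhat (\<lambda>_. 1) lam"
    and M: "M \<subseteq> O2"
    and s: "\<And>m. m \<in> M \<Longrightarrow> rtrans (emb m) (D_op (coef n N lam) N (zero_ext u)) = smul (\<sigma> m) (D_op (coef n N lam) N (zero_ext u))"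
  shows "D_prime n N lam u \<in> Ind emb M \<sigma> (lam - of_nat N)"
proof -
  let ?w = "D_op (coef n N lam) N (zero_ext u)"
  note W = D_op_symmetry[OF n u, where N = N]
  have sm: "u \<in> smooth_fun O2" using u Ind_smooth by blast
  note eq = D_prime_eq[OF sm, of _ n N lam]
  have "D_prime n N lam u \<in> smooth_fun O2"
    by (rule smooth_fun_cong[OF _ smooth_O2_smooth[OF W(1)]]) (simp add: eq)
  moreover have "D_prime n N lam u (g ** emb (m ** a ** q)) = \<sigma> m * xi (lam - of_nat N) a * D_prime n N lam u g"
    if h: "g \<in> O2" "m \<in> M" "a \<in> grp_A" "q \<in> grp_N_plus" for g m a q
  proof -
    obtain t where a: "a = mexp (t *\<^sub>R Hmat)" using h(3) by (auto simp: grp_A_eq)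
    obtain X where q: "q = mexp X" "X \<in> lie_n_plus" using h(4) by (auto simp: grp_N_plus_def)
    have "m ** a ** q \<in> O2"
      unfolding a q(1) using h(2) M q(2) lie_n_plus_o2 mexp_O2[OF o2_Hmat] mexp_O2' by (auto intro!: O2_mult)
    then have "D_prime n N lam u (g ** emb (m ** a ** q)) = ?w (g ** emb (m ** a ** q))"
      by (rule eq[OF O2_mult[OF h(1) emb_O2]])
    also have "\<dots> = rtrans (emb q) ?w (g ** emb m ** emb a)"
      by (simp add: rtrans_def emb_mult matrix_mul_assoc)
    also have "\<dots> = rtrans (mexp (t *\<^sub>R Hmat)) ?w (g ** emb m)"
      unfolding q(1) W(4)[OF q(2)] by (simp add: rtrans_def a emb_mexp embL_Hmat)
    also have "\<dots> = exp ((lam - of_nat N) * of_real t) * rtrans (emb m) ?w g"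
      unfolding W(3) by (simp add: rtrans_def)
    also have "\<dots> = \<sigma> m * xi (lam - of_nat N) a * ?w g"
      unfolding s[OF h(2)] a xi_mexp by simp
    finally show ?thesis by (simp add: eq[OF h(1)])
  qed
  ultimately show ?thesis by (simp add: Ind_def)
qed

lemma D_prime_Ind_Mhat:
  fixes u :: "('j::finite) option gmat \<Rightarrow> complex"
  assumes n: "n \<ge> 4" "CARD('j) = n - 3" and u: "u \<in> Ind id grp_Mhat (\<lambda>_. 1) lam"
  shows "D_prime n N lam u \<in> Ind emb grp_Mhat (\<lambda>_. 1) (lam - of_nat N)"
proof (rule D_prime_Ind[OF n u grp_Mhat_O2])
  show "rtrans (emb m) (D_op (coef n N lam) N (zero_ext u)) = smul 1 (D_op (coef n N lam) N (zero_ext u))"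
    if "m \<in> grp_Mhat" for m
    using D_op_symmetry(2)[OF n u, where N = N] that by (auto simp: right_stabilizer_def smul_simps)
qed

lemma D_prime_Ind_M:
  fixes u :: "('j::finite) option gmat \<Rightarrow> complex"
  assumes n: "n \<ge> 4" "CARD('j) = n - 3" and u: "u \<in> Ind id grp_M (\<lambda>_. 1) lam"
  shows "D_prime n N lam u \<in> Ind emb grp_M (if even N then (\<lambda>_. 1) else sigma_minus) (lam - of_nat N)"
proof (rule D_prime_Ind[OF n])
  show uh: "u \<in> Ind id grp_Mhat (\<lambda>_. 1) lam" using u Ind_M_subset by blast
  show "grp_M \<subseteq> (O2 :: 'j gmat set)"
    using grp_Mhat_O2 Jmat_O2 O2_mult by (fastforce simp: grp_M_eq)
  fix m :: "'j gmat" assume "m \<in> grp_M"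
  let ?w = "D_op (coef n N lam) N (zero_ext u)"
  have h: "rtrans (emb m) ?w = ?w" if "m \<in> grp_Mhat" for m
    using D_op_symmetry(2)[OF n uh, where N = N] that by (auto simp: right_stabilizer_def)
  from \<open>m \<in> grp_M\<close> consider "m \<in> grp_Mhat" | m' where "m' \<in> grp_Mhat" "m = Jmat ** m'"
    unfolding grp_M_eq by blast
  then show "rtrans (emb m) ?w = smul ((if even N then (\<lambda>_. 1) else sigma_minus) m) ?w"
  proof cases
    case 1
    then show ?thesis by (simp add: h sigma_minus_simps(1) smul_simps)
  next
    case 2
    have "rtrans (emb m) ?w = smul ((-1) ^ N) ?w"
      unfolding 2(2) emb_mult rtrans_mult h[OF 2(1)] by (rule D_op_Jmat[OF u])
    then show ?thesis by (simp add: 2 sigma_minus_simps(2))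
  qed
qed

theorem theorem2:
  fixes n N :: nat and lam :: complex
  assumes "n \<ge> 4" and "CARD('j::finite) = n - 3"
  shows
    "(D0 n N lam :: ('j option gmat word \<Rightarrow>\<^sub>0 complex) set) \<in> carrier (uea lie_n_minus)
     \<and> (let \<sigma> = (if even N then (\<lambda>_. 1) else sigma_minus) in
         equivariant_op id
           (Ind id (grp_M :: 'j option gmat set) (\<lambda>_. 1) lam)
           (Ind emb (grp_M :: 'j gmat set) \<sigma> (lam - of_nat N))
           (D_prime n N lam)
       \<and> equivariant_op emb
           (Ind id (grp_M :: 'j option gmat set) (\<lambda>_. 1) lam)
           (Ind id (grp_M :: 'j gmat set) \<sigma> (lam - of_nat N))
           (D_restr n N lam))
     \<and> (equivariant_op id
           (Ind id (grp_Mhat :: 'j option gmat set) (\<lambda>_. 1) lam)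
           (Ind emb (grp_Mhat :: 'j gmat set) (\<lambda>_. 1) (lam - of_nat N))
           (D_prime n N lam)
       \<and> equivariant_op emb
           (Ind id (grp_Mhat :: 'j option gmat set) (\<lambda>_. 1) lam)
           (Ind id (grp_Mhat :: 'j gmat set) (\<lambda>_. 1) (lam - of_nat N))
           (D_restr n N lam))"
  unfolding Let_def
  by (intro conjI n_minus.acts_carrier[OF acts_D0] equivariant_D_prime equivariant_D_restr Ind_smooth
      D_prime_Ind_M D_prime_Ind_Mhat assms)

end
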